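(* Let $(\Omega,\mathcal F,(\mathcal F_t)_{t\ge0},\mathbb P)$ be a filtered probability space satisfying the usual conditions, $B$ an $(\mathcal F_t)$-adapted $d$-dimensional Brownian motion started at $0$, and let $\mathbf I=\{1,\dots,m\}$. For each $i\in\mathbf I$ let $\phi_i:\mathbb R\to(-\infty,+\infty]$ be convex and lower semicontinuous with $\phi_i=+\infty$ on $(-\infty,0)$ and $\phi_i$ of class $C^1$ on $(0,\infty)$; let $n_i$ be pairwise distinct unit vectors of $\mathbb R^d$ and $a_i\in\mathbb R$. Set $\Phi(x)=\sum_{i}\phi_i(x\cdot n_i-a_i)$, $D=\{x: x\cdot n_i>a_i\ \forall i\}$, assumed nonempty. Let $(X,L)$ be the solution of the multivalued SDE associated with $\Phi$ (see context) with $\mathcal F_0$-measurable initial condition $X_0\in\overline D$. For $\mathbf J\subset\mathbf I$ let $H_{\mathbf J}=\{x: x\cdot n_j=a_j\ \forall j\in\mathbf J\}$ and $\sigma_{\mathbf J}=\inf\{t>0: X_t\in H_{\mathbf J}\}$. Then for every $\mathbf J\subset\mathbf I$ with $\mathrm{card}(\mathbf J)\ge2$, $\mathbb P(\sigma_{\mathbf J}=\infty)=1$.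
   Context: A unit vector $n(x)$ is a unit inward normal to $D$ at $x\in\partial D$ if $n(x)\cdot(x-z)\le0$ for all $z\in\overline D$. The solution of the multivalued SDE associated with $\Phi$ (which exists and is unique) is the pair consisting of a continuous $(\mathcal F_t)$-adapted $\overline D$-valued process $X$ and a continuous $(\mathcal F_t)$-adapted nondecreasing process $L$ such that for all $t\ge0$: $X_t=X_0+B_t-\int_0^t\nabla\Phi(X_s)\,ds+\int_0^t n_s\,dL_s$ and $L_t=\int_0^t\mathbf 1_{\{X_s\in\partial D\}}dL_s$, where $n_s$ is $dL_s$-a.e. a unit inward normal to $D$ at $X_s$; here $\nabla\Phi(x)=\sum_i n_i\phi_i'(x\cdot n_i-a_i)$ on $D$. This solution satisfies $\int_0^T\mathbf 1_{\{X_s\in\partial D\}}ds=0$ and $\int_0^T|\nabla\Phi(X_s)|ds<\infty$ for all $T<\infty$. *)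

theory Defs
  imports "HOL-Probability.Probability"
begin

definition edom :: "(real \<Rightarrow> ereal) \<Rightarrow> real set" where
  "edom f = {x. f x < \<infinity>}"

definition ereal_convex :: "(real \<Rightarrow> ereal) \<Rightarrow> bool" where
  "ereal_convex f \<longleftrightarrow> (\<forall>x y t. 0 \<le> t \<and> t \<le> 1 \<longrightarrow>
      f ((1 - t) * x + t * y) \<le> ereal (1 - t) * f x + ereal t * f y)"

definition ereal_lsc :: "(real \<Rightarrow> ereal) \<Rightarrow> bool" where
  "ereal_lsc f \<longleftrightarrow> (\<forall>c::ereal. closed {x. f x \<le> c})"

text \<open>A filtration on M indexed by t >= 0 (values for t < 0 irrelevant,
  we ask monotonicity for all indices).\<close>

definition is_filtration :: "'a measure \<Rightarrow> (real \<Rightarrow> 'a measure) \<Rightarrow> bool" where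
  "is_filtration M F \<longleftrightarrow> (\<forall>t. space (F t) = space M \<and> sets (F t) \<subseteq> sets M) \<and>
     (\<forall>s t. s \<le> t \<longrightarrow> sets (F s) \<subseteq> sets (F t))"

definition usual_conditions :: "'a measure \<Rightarrow> (real \<Rightarrow> 'a measure) \<Rightarrow> bool" where
  "usual_conditions M F \<longleftrightarrow>
     (\<forall>N A. N \<in> null_sets M \<and> A \<subseteq> N \<longrightarrow> A \<in> sets M) \<and>
     null_sets M \<subseteq> sets (F 0) \<and>
     (\<forall>t\<ge>0. sets (F t) = (\<Inter>s\<in>{t<..}. sets (F s)))"

definition adapted :: "(real \<Rightarrow> 'a measure) \<Rightarrow> (real \<Rightarrow> 'a \<Rightarrow> 'b::topological_space) \<Rightarrow> bool" where
  "adapted F X \<longleftrightarrow> (\<forall>t\<ge>0. X t \<in> borel_measurable (F t))"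

definition brownian_motion ::
  "'a measure \<Rightarrow> (real \<Rightarrow> 'a measure) \<Rightarrow> (real \<Rightarrow> 'a \<Rightarrow> real ^ 'd) \<Rightarrow> bool" where
  "brownian_motion M F B \<longleftrightarrow>
     adapted F B \<and>
     (\<forall>\<omega>\<in>space M. B 0 \<omega> = 0 \<and> continuous_on {0..} (\<lambda>t. B t \<omega>)) \<and>
     (\<forall>s t. 0 \<le> s \<and> s < t \<longrightarrow>
        distributed M lborel (\<lambda>\<omega>. B t \<omega> - B s \<omega>)
          (\<lambda>x. ennreal (\<Prod>i\<in>UNIV. normal_density 0 (sqrt (t - s)) (x $ i))) \<and>
        prob_space.indep_set M (sets (F s))
          {(\<lambda>\<omega>. B t \<omega> - B s \<omega>) -` U \<inter> space M | U. U \<in> sets (borel :: (real ^ 'd) measure)})"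

definition Dom :: "nat set \<Rightarrow> (nat \<Rightarrow> real ^ 'd) \<Rightarrow> (nat \<Rightarrow> real) \<Rightarrow> (real ^ 'd) set" where
  "Dom I n a = {x. \<forall>i\<in>I. x \<bullet> n i > a i}"

definition Hyp :: "nat set \<Rightarrow> (nat \<Rightarrow> real ^ 'd) \<Rightarrow> (nat \<Rightarrow> real) \<Rightarrow> (real ^ 'd) set" where
  "Hyp J n a = {x. \<forall>j\<in>J. x \<bullet> n j = a j}"

text \<open>Gradient of Phi(x) = sum_i phi_i(x . n_i - a_i) on D, where
  phi_i' is the derivative of phi_i on (0, infinity).\<close>

definition gradPhi :: "nat set \<Rightarrow> (nat \<Rightarrow> real \<Rightarrow> ereal) \<Rightarrow> (nat \<Rightarrow> real ^ 'd) \<Rightarrow> (nat \<Rightarrow> real)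
    \<Rightarrow> real ^ 'd \<Rightarrow> real ^ 'd" where
  "gradPhi I \<phi> n a x = (\<Sum>i\<in>I. deriv (\<lambda>y. real_of_ereal (\<phi> i y)) (x \<bullet> n i - a i) *\<^sub>R n i)"

definition inward_normal :: "(real ^ 'd) set \<Rightarrow> real ^ 'd \<Rightarrow> real ^ 'd \<Rightarrow> bool" where
  "inward_normal D x v \<longleftrightarrow> norm v = 1 \<and> (\<forall>z\<in>closure D. v \<bullet> (x - z) \<le> 0)"

definition dL :: "(real \<Rightarrow> real) \<Rightarrow> real \<Rightarrow> real measure" where
  "dL L t = restrict_space (interval_measure (\<lambda>s. L (max 0 s))) {0..t}"

definition msde_solution ::
  "'a measure \<Rightarrow> (real \<Rightarrow> 'a measure) \<Rightarrow> (real \<Rightarrow> 'a \<Rightarrow> real ^ 'd) \<Rightarrow>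
   nat set \<Rightarrow> (nat \<Rightarrow> real \<Rightarrow> ereal) \<Rightarrow> (nat \<Rightarrow> real ^ 'd) \<Rightarrow> (nat \<Rightarrow> real) \<Rightarrow>
   (real \<Rightarrow> 'a \<Rightarrow> real ^ 'd) \<Rightarrow> (real \<Rightarrow> 'a \<Rightarrow> real) \<Rightarrow> (real \<Rightarrow> 'a \<Rightarrow> real ^ 'd) \<Rightarrow> bool" where
  "msde_solution M F B I \<phi> n a X L nn \<longleftrightarrow>
     adapted F X \<and> adapted F L \<and>
     (\<forall>\<omega>\<in>space M.
        continuous_on {0..} (\<lambda>t. X t \<omega>) \<and> continuous_on {0..} (\<lambda>t. L t \<omega>) \<and>
        mono_on {0..} (\<lambda>t. L t \<omega>) \<and>
        (\<forall>t\<ge>0. X t \<omega> \<in> closure (Dom I n a))) \<and>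
     (AE \<omega> in M. \<forall>t\<ge>0.
        set_integrable lborel {0..t} (\<lambda>s. gradPhi I \<phi> n a (X s \<omega>)) \<and>
        integrable (dL (\<lambda>s. L s \<omega>) t) (\<lambda>s. nn s \<omega>) \<and>
        (AE s in dL (\<lambda>s. L s \<omega>) t. inward_normal (Dom I n a) (X s \<omega>) (nn s \<omega>)) \<and>
        X t \<omega> = X 0 \<omega> + B t \<omega> - (LINT s:{0..t}|lborel. gradPhi I \<phi> n a (X s \<omega>))
                 + (\<integral>s. nn s \<omega> \<partial>dL (\<lambda>s. L s \<omega>) t) \<and>
        L t \<omega> = (\<integral>s. indicator (frontier (Dom I n a)) (X s \<omega>) \<partial>dL (\<lambda>s. L s \<omega>) t))"

text \<open>First hitting time of H_J after time 0 (Inf of the empty set is +infinity).\<close>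

definition hitting_time :: "(real \<Rightarrow> 'a \<Rightarrow> real ^ 'd) \<Rightarrow> (real ^ 'd) set \<Rightarrow> 'a \<Rightarrow> ereal" where
  "hitting_time X H \<omega> = Inf {ereal t | t. t > 0 \<and> X t \<omega> \<in> H}"

end

theory Submission
  imports Defs
begin

text \<open>At a point \<open>x\<close> of an edge let \<open>A\<close> be the set of all active faces; the normals indexed by \<open>A\<close> span a
  space of dimension at least 2. Let \<open>p\<close> be the orthogonal projection of \<open>X - h\<^sub>0\<close> on this span, where
  \<open>h\<^sub>0\<close> lies on the edge. Near \<open>x\<close> convexity gives that the drift satisfies
  \<open>\<nabla>\<Phi>(X) \<cdot> p \<le> C |p|\<close> and that the reflection never decreases \<open>|p|\<close>.
  With \<open>q = e + |p|\<^sup>2\<close> the function \<open>- ln q / 2 - 2 C \<surd>q\<close> is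
  therefore, up to a constant drift independent of \<open>e\<close>, a supermartingale which exceeds
  \<open>- ln (2 e) / 2 - O(1)\<close> where \<open>|p|\<^sup>2 \<le> e\<close>; let \<open>e\<close> tend to 0. Its Laplacian also produces the term \<open>- e / q\<^sup>2\<close>, which
  excludes that \<open>X\<close> spends a whole time interval on the edge.
  No stochastic integral is needed: \<open>X\<close> is sampled on a time grid, the Brownian increment is treated by
  a Taylor expansion in \<open>q\<close> and by independence, and the finite-variation increment pathwise, by convexity of the
  potential in \<open>q\<close>.\<close>

section \<open>Moments of Brownian increments\<close>

text \<open>The logarithm alone is exactly critical: in a span of dimension two its generator term
  is only \<open>- e / q\<^sup>2\<close>, which cannot absorb a cost of size
  \<open>C / sqrt q\<close>, the price of the finite-variation part. The term
  \<open>- 2 * C * sqrt q\<close> is added because its own generator term is at most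
  \<open>- C / sqrt q\<close>, while its derivative raises the cost of the finite-variation part
  only by a constant. The regularisation \<open>e > 0\<close> keeps all derivatives of the potential
  bounded, but by constants that blow up as \<open>e\<close> tends to 0. Hence the mesh tends to 0
  first with \<open>e\<close> fixed, and the bound that survives may contain \<open>e\<close> only
  through the potential itself. The face set is the one active at the visited point rather than the
  prescribed one: only then do all remaining faces keep a positive distance, at which their drift is
  bounded. The hitting estimate requires a start at positive distance. The process may begin on the
  edge, and a visit need not be preceded by a time off the edge; this is why intervals spent on the
  edge are excluded by a separate estimate.\<close>

lemma has_bochner_integral_lborel_vec_prod:
  fixes f :: "'d::finite \<Rightarrow> real \<Rightarrow> real"
  assumes f: "\<And>i. integrable lborel (f i)"
  shows "has_bochner_integral lborel (\<lambda>x::real^'d. \<Prod>i\<in>UNIV. f i (x $ i))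
    (\<Prod>i\<in>UNIV. integral\<^sup>L lborel (f i))"
proof -
  \<comment> \<open>\<open>lborel\<close> on \<open>real^'d\<close> is the image of a product
    measure indexed by the vectors of \<open>Basis\<close>; \<open>c\<close> turns a basis vector
    back into its coordinate index.\<close>
  define c :: "real^'d \<Rightarrow> 'd" where "c b = (SOME i. b = axis i 1)" for b
  have c: "c (axis i 1) = i" for i
    unfolding c_def by (rule some_equality) (auto simp: axis_eq_axis)
  have Basis: "Basis = range (\<lambda>i. axis i (1::real) :: real^'d)"
    by (auto simp: Basis_vec_def)
  have inj: "inj (\<lambda>i. axis i (1::real) :: real^'d)"
    by (auto simp: inj_on_def axis_eq_axis)
  have [measurable]: "f i \<in> borel_measurable borel" for i
    using f[of i] by (simp add: borel_measurable_integrable)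
  interpret product_sigma_finite "\<lambda>b::real^'d. (lborel :: real measure)"
    by standard
  have coord: "(\<Sum>b\<in>Basis. x b *\<^sub>R b) $ i = x (axis i 1)" for x :: "real^'d \<Rightarrow> real" and i
  proof -
    have "(\<Sum>b\<in>Basis. x b *\<^sub>R b) $ i = (\<Sum>j\<in>UNIV. x (axis j 1) * axis j 1 $ i)"
      unfolding Basis by (simp add: sum.reindex[OF inj])
    also have "\<dots> = (\<Sum>j\<in>UNIV. if i = j then x (axis j 1) else 0)"
      by (intro sum.cong) (auto simp: axis_def)
    finally show ?thesis by simp
  qed
  have eq: "(\<Prod>b\<in>Basis. f (c b) (x b)) = (\<Prod>i\<in>UNIV. f i ((\<Sum>b\<in>Basis. x b *\<^sub>R b) $ i))"
    for x :: "real^'d \<Rightarrow> real"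
    unfolding coord by (simp add: Basis prod.reindex[OF inj] c)
  have int: "integrable (\<Pi>\<^sub>M b\<in>Basis. lborel) (\<lambda>x::real^'d \<Rightarrow> real. \<Prod>b\<in>Basis. f (c b) (x b))"
    by (intro product_integrable_prod) (auto intro: f)
  have "integral\<^sup>L (\<Pi>\<^sub>M b\<in>Basis. lborel) (\<lambda>x::real^'d \<Rightarrow> real. \<Prod>b\<in>Basis. f (c b) (x b))
     = (\<Prod>b\<in>Basis. integral\<^sup>L lborel (f (c b)))"
    by (intro product_integral_prod) (auto intro: f)
  also have "\<dots> = (\<Prod>i\<in>UNIV. integral\<^sup>L lborel (f i))"
    by (simp add: Basis prod.reindex[OF inj] c)
  finally have val: "integral\<^sup>L (\<Pi>\<^sub>M b\<in>Basis. lborel) (\<lambda>x::real^'d \<Rightarrow> real. \<Prod>b\<in>Basis. f (c b) (x b))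
     = (\<Prod>i\<in>UNIV. integral\<^sup>L lborel (f i))" .
  have m: "(\<lambda>x. \<Sum>b\<in>Basis. x b *\<^sub>R b) \<in> (\<Pi>\<^sub>M b\<in>Basis. lborel) \<rightarrow>\<^sub>M (borel :: (real^'d) measure)"
    by measurable
  show ?thesis
    unfolding has_bochner_integral_iff lborel_eq[where 'a="real^'d"]
    using int val by (simp add: integrable_distr_eq[OF m] integral_distr[OF m] eq)
qed

definition centered_normal_density :: "real \<Rightarrow> real^'d \<Rightarrow> real" where
  "centered_normal_density h x = (\<Prod>i\<in>UNIV. normal_density 0 (sqrt h) (x $ i))"

lemma has_bochner_integral_normal_monomial:
  fixes k :: "'d::finite \<Rightarrow> nat"
  assumes "0 < h"
  shows "has_bochner_integral lborel
    (\<lambda>x::real^'d. centered_normal_density h x * (\<Prod>i\<in>UNIV. (x $ i) ^ k i))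
    (\<Prod>i\<in>UNIV. \<integral>x. normal_density 0 (sqrt h) x * x ^ k i \<partial>lborel)"
proof -
  have "integrable lborel (\<lambda>x. normal_density 0 (sqrt h) x * x ^ j)" for j
    using integrable_normal_moment[of "sqrt h" 0 j] assms by simp
  from has_bochner_integral_lborel_vec_prod[OF this, where 'd='d]
  show ?thesis by (simp add: centered_normal_density_def prod.distrib)
qed

lemma normal_moments:
  assumes "0 < h"
  shows "(\<integral>x. normal_density 0 (sqrt h) x * x ^ 0 \<partial>lborel) = 1"
    "(\<integral>x. normal_density 0 (sqrt h) x * x ^ 1 \<partial>lborel) = 0"
    "(\<integral>x. normal_density 0 (sqrt h) x * x ^ 2 \<partial>lborel) = h"
    "(\<integral>x. normal_density 0 (sqrt h) x * x ^ 4 \<partial>lborel) = 3 * h\<^sup>2"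
  using integral_normal_moment_even[of "sqrt h" 0 0] integral_normal_moment_odd[of "sqrt h" 0 0]
    integral_normal_moment_even[of "sqrt h" 0 1] integral_normal_moment_even[of "sqrt h" 0 2] assms
  by (simp_all add: fact_numeral power2_eq_square field_simps)

text \<open>Each integrand is a monomial, so the integral factorises; coordinates with exponent 0
  contribute the total mass 1. For \<open>i \<noteq> j\<close> the mixed product vanishes through
  the first moment at \<open>i\<close>.\<close>

lemma has_bochner_integral_normal_coordinates:
  fixes i j :: "'d::finite"
  assumes h: "0 < h"
  shows "has_bochner_integral lborel (\<lambda>x::real^'d. centered_normal_density h x * x $ i) 0"
    and "has_bochner_integral lborel (\<lambda>x::real^'d. centered_normal_density h x * (x $ i * x $ j))
           (if i = j then h else 0)"
    and "has_bochner_integral lborel (\<lambda>x::real^'d. centered_normal_density h x * (x $ i) ^ 4) (3 * h\<^sup>2)"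
proof -
  note mom = normal_moments[OF h]
  note mon = has_bochner_integral_normal_monomial[OF h, where 'd='d]
  have p: "(\<Prod>l\<in>UNIV. if l = i then b else 1) = b" for b :: real
    by simp
  have pw: "(\<Prod>l\<in>UNIV. (x $ l) ^ (if l = i then m else 0)) = (x $ i) ^ m" for x :: "real^'d" and m
    by (subst prod.cong[OF refl, where h="\<lambda>l. if l = i then (x $ i) ^ m else 1"]) auto
  have v: "(\<Prod>l\<in>UNIV. \<integral>x. normal_density 0 (sqrt h) x * x ^ (if l = i then m else 0) \<partial>lborel)
      = (\<integral>x. normal_density 0 (sqrt h) x * x ^ m \<partial>lborel)" for m
    by (subst prod.cong[OF refl, where h="\<lambda>l. if l = i then (\<integral>x. normal_density 0 (sqrt h) x * x ^ m \<partial>lborel) else 1"])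
      (use mom(1) in auto)
  show "has_bochner_integral lborel (\<lambda>x::real^'d. centered_normal_density h x * x $ i) 0"
    using mon[of "\<lambda>l. if l = i then 1 else 0"] unfolding pw v mom(2) by simp
  show "has_bochner_integral lborel (\<lambda>x::real^'d. centered_normal_density h x * (x $ i) ^ 4) (3 * h\<^sup>2)"
    using mon[of "\<lambda>l. if l = i then 4 else 0"] unfolding pw v mom(4) by simp
  show "has_bochner_integral lborel (\<lambda>x::real^'d. centered_normal_density h x * (x $ i * x $ j))
           (if i = j then h else 0)"
  proof (cases "i = j")
    case True
    show ?thesis
      using mon[of "\<lambda>l. if l = i then 2 else 0"] True unfolding pw v mom(3)
      by (simp add: power2_eq_square)
  next
    case False
    let ?k = "\<lambda>l. if l = i \<or> l = j then (1::nat) else 0"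
    have a: "(\<Prod>l\<in>UNIV. (x $ l) ^ ?k l) = x $ i * x $ j" for x :: "real^'d"
    proof -
      have "(\<Prod>l\<in>UNIV. (x $ l) ^ ?k l) = (\<Prod>l\<in>{i,j}. x $ l)"
        by (rule prod.mono_neutral_cong_right) auto
      with False show ?thesis by simp
    qed
    have b: "(\<Prod>l\<in>UNIV. \<integral>x. normal_density 0 (sqrt h) x * x ^ ?k l \<partial>lborel) = 0"
      by (rule prod_zero[OF finite], rule bexI[of _ i]) (use mom(2) in auto)
    show ?thesis
      using mon[of ?k] False unfolding a b by simp
  qed
qed

lemma centered_normal_density_nonneg: "0 \<le> centered_normal_density h x"
  by (auto simp: centered_normal_density_def intro!: prod_nonneg)

lemma coordinate_measurable:
  "u \<in> borel_measurable N \<Longrightarrow> (\<lambda>\<omega>. u \<omega> $ i) \<in> borel_measurable N"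
  for u :: "'a \<Rightarrow> real ^ 'd"
  by (rule measurable_compose[OF _ borel_measurable_continuous_onI]) (auto intro!: continuous_intros)

section \<open>Brownian increments tested against variables from the past\<close>

locale filtered_brownian = prob_space M for M :: "'a measure" +
  fixes F :: "real \<Rightarrow> 'a measure" and B :: "real \<Rightarrow> 'a \<Rightarrow> real ^ 'd"
  assumes filtration: "is_filtration M F" and brownian: "brownian_motion M F B"
begin

lemma space_F [simp]: "space (F t) = space M"
  using filtration by (auto simp: is_filtration_def)

lemma sets_F_subset: "sets (F t) \<subseteq> sets M"
  using filtration by (auto simp: is_filtration_def)

lemma sets_F_mono: "s \<le> t \<Longrightarrow> sets (F s) \<subseteq> sets (F t)"
  using filtration by (auto simp: is_filtration_def)

lemma measurable_F_M: "f \<in> measurable (F t) N \<Longrightarrow> f \<in> measurable M N"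
  using sets_F_subset[of t] by (auto simp: measurable_def)

lemma measurable_F_mono: "f \<in> measurable (F s) N \<Longrightarrow> s \<le> t \<Longrightarrow> f \<in> measurable (F t) N"
  using sets_F_mono[of s t] by (auto simp: measurable_def)

lemma B_measurable_F: "0 \<le> t \<Longrightarrow> B t \<in> borel_measurable (F t)"
  using brownian by (auto simp: brownian_motion_def adapted_def)

context
  fixes s t h :: real and \<xi> :: "'a \<Rightarrow> real ^ 'd"
  assumes s: "0 \<le> s" and h: "0 < h" 
  defines "\<xi> \<equiv> \<lambda>\<omega>. B (s + h) \<omega> - B s \<omega>"
begin

lemma increment_measurable [measurable]: "\<xi> \<in> borel_measurable M"
  unfolding \<xi>_def using s h by (auto intro!: borel_measurable_diff measurable_F_M[OF B_measurable_F])

lemma increment_distributed: "distributed M lborel \<xi> (\<lambda>x. ennreal (centered_normal_density h x))"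
proof -
  have "0 \<le> s \<and> s < s + h" using s h by simp
  with brownian have "distributed M lborel (\<lambda>\<omega>. B (s + h) \<omega> - B s \<omega>)
          (\<lambda>x. ennreal (\<Prod>i\<in>UNIV. normal_density 0 (sqrt (s + h - s)) (x $ i)))"
    unfolding brownian_motion_def by blast
  then show ?thesis by (simp add: \<xi>_def centered_normal_density_def)
qed

lemma increment_integral:
  assumes "has_bochner_integral lborel (\<lambda>x. centered_normal_density h x * f x) c"
    and [measurable]: "f \<in> borel_measurable borel"
  shows "has_bochner_integral M (\<lambda>\<omega>. f (\<xi> \<omega>)) c"
  using distributed_integrable[OF increment_distributed, of f]
    distributed_integral[OF increment_distributed, of f] assms(1)
  by (auto simp: has_bochner_integral_iff centered_normal_density_nonneg)

lemma increment_moments: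
  shows "has_bochner_integral M (\<lambda>\<omega>. \<xi> \<omega> $ i) 0"
    and "has_bochner_integral M (\<lambda>\<omega>. \<xi> \<omega> $ i * \<xi> \<omega> $ j) (if i = j then h else 0)"
    and "has_bochner_integral M (\<lambda>\<omega>. (\<xi> \<omega> $ i) ^ 4) (3 * h\<^sup>2)"
  by (rule increment_integral[OF has_bochner_integral_normal_coordinates(1)[OF h]]
        increment_integral[OF has_bochner_integral_normal_coordinates(2)[OF h]]
        increment_integral[OF has_bochner_integral_normal_coordinates(3)[OF h]]; measurable)+

text \<open>The Brownian hypothesis concerns preimages under the increment itself. Preimages under
  \<open>f\<close> of the increment are among them and already form a sigma-algebra, so independence
  carries over without a generator argument.\<close>

lemma increment_indep:
  fixes U :: "'a \<Rightarrow> 'b::topological_space" and f :: "real ^ 'd \<Rightarrow> 'b"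
  assumes U: "U \<in> borel_measurable (F s)" and f [measurable]: "f \<in> borel_measurable borel"
  shows "indep_var borel U borel (\<lambda>\<omega>. f (\<xi> \<omega>))"
  unfolding indep_var_eq
proof (intro conjI)
  show "random_variable borel U" using U by (rule measurable_F_M)
  have "0 \<le> s \<and> s < s + h" using s h by simp
  with brownian have "indep_set (sets (F s))
          {(\<lambda>\<omega>. B (s + h) \<omega> - B s \<omega>) -` U \<inter> space M | U. U \<in> sets (borel :: (real ^ 'd) measure)}"
    unfolding brownian_motion_def by blast
  then have *: "indep_set (sets (F s)) {\<xi> -` A \<inter> space M | A. A \<in> sets borel}" by (simp add: \<xi>_def)
  have 1: "sigma_sets (space M) {U -` A \<inter> space M | A. A \<in> sets borel} \<subseteq> sets (F s)"
    using sets.sigma_sets_subset[of "{U -` A \<inter> space M | A. A \<in> sets borel}" "F s"]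
      measurable_sets[OF U] by auto
  have "sigma_sets (space M) {(\<lambda>\<omega>. f (\<xi> \<omega>)) -` A \<inter> space M | A. A \<in> sets borel}
      = {(\<lambda>\<omega>. f (\<xi> \<omega>)) -` A \<inter> space M | A. A \<in> sets borel}"
    using sigma_sets_vimage_commute[of "\<lambda>\<omega>. f (\<xi> \<omega>)" "space M" UNIV "sets borel"]
      sets.sigma_sets_eq[of "borel :: 'b measure"] by simp
  also have "\<dots> \<subseteq> {\<xi> -` A \<inter> space M | A. A \<in> sets borel}"
  proof safe
    fix A :: "'b set" assume "A \<in> sets borel"
    then have "f -` A \<in> sets borel" using measurable_sets[OF f] by auto
    then show "\<exists>A'. (\<lambda>\<omega>. f (\<xi> \<omega>)) -` A \<inter> space M = \<xi> -` A' \<inter> space M \<and> A' \<in> sets borel"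
      by (intro exI[of _ "f -` A"]) auto
  qed
  finally have 2: "sigma_sets (space M) {(\<lambda>\<omega>. f (\<xi> \<omega>)) -` A \<inter> space M | A. A \<in> sets borel}
      \<subseteq> {\<xi> -` A \<inter> space M | A. A \<in> sets borel}" .
  show "indep_set (sigma_sets (space M) {U -` A \<inter> space M | A. A \<in> sets borel})
     (sigma_sets (space M) {(\<lambda>\<omega>. f (\<xi> \<omega>)) -` A \<inter> space M | A. A \<in> sets borel})"
    unfolding indep_set_def
    by (rule indep_sets_mono[OF *[unfolded indep_set_def]]) (use 1 2 in \<open>auto split: bool.split\<close>)
qed simp

lemma increment_product:
  fixes u :: "'a \<Rightarrow> real"
  assumes u: "u \<in> borel_measurable (F s)" "\<And>\<omega>. \<omega> \<in> space M \<Longrightarrow> \<bar>u \<omega>\<bar> \<le> c"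
    and f: "has_bochner_integral M (\<lambda>\<omega>. f (\<xi> \<omega>)) m" and [measurable]: "f \<in> borel_measurable borel"
  shows "has_bochner_integral M (\<lambda>\<omega>. u \<omega> * f (\<xi> \<omega>)) (m * (\<integral>\<omega>. u \<omega> \<partial>M))"
proof -
  have ui: "integrable M u"
    by (rule integrable_const_bound[where B=c]) (use measurable_F_M[OF u(1)] u(2) in auto)
  have i: "indep_var borel u borel (\<lambda>\<omega>. f (\<xi> \<omega>))"
    by (rule increment_indep[OF u(1)]) simp
  show ?thesis
    using indep_var_lebesgue_integral[OF i ui] indep_var_integrable[OF i ui] f
    by (simp add: has_bochner_integral_iff)
qed

text \<open>The discrete martingale property: a bounded coefficient from the past makes the
  first-order term of the expansion vanish in mean.\<close>

lemma increment_linear: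
  assumes u: "u \<in> borel_measurable (F s)" "\<And>\<omega>. \<omega> \<in> space M \<Longrightarrow> norm (u \<omega>) \<le> c"
  shows "has_bochner_integral M (\<lambda>\<omega>. u \<omega> \<bullet> \<xi> \<omega>) 0"
proof -
  have "has_bochner_integral M (\<lambda>\<omega>. u \<omega> $ i * \<xi> \<omega> $ i) (0 * (\<integral>\<omega>. u \<omega> $ i \<partial>M))" for i
  proof (rule increment_product[OF _ _ increment_moments(1), where c=c])
    show "(\<lambda>\<omega>. u \<omega> $ i) \<in> borel_measurable (F s)" by (rule coordinate_measurable[OF u(1)])
    show "\<bar>u \<omega> $ i\<bar> \<le> c" if "\<omega> \<in> space M" for \<omega>
      using component_le_norm_cart[of "u \<omega>" i] u(2)[OF that] by simp
  qed auto
  then have "has_bochner_integral M (\<lambda>\<omega>. \<Sum>i\<in>UNIV. u \<omega> $ i * \<xi> \<omega> $ i) (\<Sum>i\<in>UNIV. 0 * (\<integral>\<omega>. u \<omega> $ i \<partial>M))"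
    by (rule has_bochner_integral_sum)
  then show ?thesis by (simp add: inner_vec_def)
qed

text \<open>A weighted Ito isometry for one step: off-diagonal covariances vanish and each diagonal
  one gives \<open>h\<close>. It yields both terms of order \<open>h\<close> in the
  expansion.\<close>

lemma increment_quadratic:
  fixes w :: "'a \<Rightarrow> real"
  assumes u: "u \<in> borel_measurable (F s)" "\<And>\<omega>. \<omega> \<in> space M \<Longrightarrow> norm (u \<omega>) \<le> c"
    and w: "w \<in> borel_measurable (F s)" "\<And>\<omega>. \<omega> \<in> space M \<Longrightarrow> \<bar>w \<omega>\<bar> \<le> c'"
  shows "has_bochner_integral M (\<lambda>\<omega>. w \<omega> * (u \<omega> \<bullet> \<xi> \<omega>)\<^sup>2) (h * (\<integral>\<omega>. w \<omega> * (norm (u \<omega>))\<^sup>2 \<partial>M))"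
proof -
  define a where "a i j \<omega> = w \<omega> * (u \<omega> $ i * u \<omega> $ j)" for i j \<omega>
  have am: "a i j \<in> borel_measurable (F s)" for i j
    unfolding a_def by (intro borel_measurable_times coordinate_measurable u w)
  have ab: "\<bar>a i j \<omega>\<bar> \<le> c' * (c * c)" if "\<omega> \<in> space M" for i j \<omega>
  proof -
    have "\<bar>u \<omega> $ i\<bar> \<le> c" for i
      using component_le_norm_cart[of "u \<omega>" i] u(2)[OF that] by simp
    then show ?thesis
      unfolding a_def abs_mult using w(2)[OF that]
      by (intro mult_mono) (auto intro: order_trans[OF abs_ge_zero])
  qed
  have ai: "integrable M (a i j)" for i j
    by (rule integrable_const_bound[where B="c' * (c * c)"]) (use measurable_F_M[OF am] ab in auto)
  have "has_bochner_integral M (\<lambda>\<omega>. a i j \<omega> * (\<xi> \<omega> $ i * \<xi> \<omega> $ j)) ((if i = j then h else 0) * (\<integral>\<omega>. a i j \<omega> \<partial>M))" for i j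
    by (rule increment_product[OF am ab increment_moments(2)]) auto
  then have "has_bochner_integral M (\<lambda>\<omega>. \<Sum>i\<in>UNIV. \<Sum>j\<in>UNIV. a i j \<omega> * (\<xi> \<omega> $ i * \<xi> \<omega> $ j))
     (\<Sum>i\<in>UNIV. \<Sum>j\<in>UNIV. (if i = j then h else 0) * (\<integral>\<omega>. a i j \<omega> \<partial>M))"
    by (intro has_bochner_integral_sum) auto
  also have "(\<lambda>\<omega>. \<Sum>i\<in>UNIV. \<Sum>j\<in>UNIV. a i j \<omega> * (\<xi> \<omega> $ i * \<xi> \<omega> $ j)) = (\<lambda>\<omega>. w \<omega> * (u \<omega> \<bullet> \<xi> \<omega>)\<^sup>2)"
    by (simp add: a_def inner_vec_def power2_eq_square sum_product sum_distrib_left algebra_simps)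
  also have "(\<Sum>i\<in>UNIV. \<Sum>j\<in>UNIV. (if i = j then h else 0) * (\<integral>\<omega>. a i j \<omega> \<partial>M))
      = h * (\<integral>\<omega>. (\<Sum>i\<in>UNIV. a i i \<omega>) \<partial>M)"
    by (subst Bochner_Integration.integral_sum) (auto simp: ai sum_distrib_left if_distrib[of "\<lambda>x. x * _"] cong: if_cong)
  also have "(\<lambda>\<omega>. \<Sum>i\<in>UNIV. a i i \<omega>) = (\<lambda>\<omega>. w \<omega> * (norm (u \<omega>))\<^sup>2)"
    by (simp add: a_def power2_norm_eq_inner inner_vec_def sum_distrib_left)
  finally show ?thesis .
qed

lemma increment_norm2:
  "has_bochner_integral M (\<lambda>\<omega>. (norm (\<xi> \<omega>))\<^sup>2) (CARD('d) * h)"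
proof -
  have "has_bochner_integral M (\<lambda>\<omega>. \<xi> \<omega> $ i * \<xi> \<omega> $ i) h" for i
    using increment_moments(2)[of i i] by simp
  then have "has_bochner_integral M (\<lambda>\<omega>. \<Sum>i\<in>UNIV. \<xi> \<omega> $ i * \<xi> \<omega> $ i) (\<Sum>i\<in>(UNIV::'d set). h)"
    by (rule has_bochner_integral_sum)
  then show ?thesis by (simp add: power2_norm_eq_inner inner_vec_def)
qed

text \<open>Cauchy-Schwarz against the constant vector reduces the fourth power of the norm to the
  coordinate moments \<open>3 * h\<^sup>2\<close>. It costs one factor \<open>CARD('d)\<close>; the
  summation gives the other.\<close>

lemma increment_norm4:
  shows "integrable M (\<lambda>\<omega>. (norm (\<xi> \<omega>)) ^ 4)"
    and "(\<integral>\<omega>. (norm (\<xi> \<omega>)) ^ 4 \<partial>M) \<le> 3 * (real CARD('d))\<^sup>2 * h\<^sup>2"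
proof -
  have m: "has_bochner_integral M (\<lambda>\<omega>. CARD('d) * (\<Sum>i\<in>UNIV. (\<xi> \<omega> $ i) ^ 4)) (CARD('d) * (\<Sum>i\<in>(UNIV::'d set). 3 * h\<^sup>2))"
    by (intro has_bochner_integral_mult_right has_bochner_integral_sum increment_moments(3))
  have le: "(norm x) ^ 4 \<le> CARD('d) * (\<Sum>i\<in>UNIV. (x $ i) ^ 4)" for x :: "real^'d"
  proof -
    have "(norm x) ^ 4 = ((norm x)\<^sup>2)\<^sup>2"
      by (simp flip: power_mult)
    also have "(norm x)\<^sup>2 = (\<Sum>i\<in>UNIV. 1 * (x $ i)\<^sup>2)"
      unfolding power2_norm_eq_inner by (simp add: inner_vec_def power2_eq_square)
    also have "(\<Sum>i\<in>UNIV. 1 * (x $ i)\<^sup>2)\<^sup>2 \<le> (\<Sum>i\<in>(UNIV::'d set). (1::real)\<^sup>2) * (\<Sum>i\<in>UNIV. ((x $ i)\<^sup>2)\<^sup>2)"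
      by (rule Cauchy_Schwarz_ineq_sum)
    finally show ?thesis by (simp flip: power_mult)
  qed
  show i: "integrable M (\<lambda>\<omega>. (norm (\<xi> \<omega>)) ^ 4)"
    by (rule Bochner_Integration.integrable_bound[OF integrable.intros[OF m]])
       (use le in \<open>auto intro!: AE_I2 order_trans[OF le abs_ge_self]\<close>)
  have "(\<integral>\<omega>. (norm (\<xi> \<omega>)) ^ 4 \<partial>M) \<le> (\<integral>\<omega>. CARD('d) * (\<Sum>i\<in>UNIV. (\<xi> \<omega> $ i) ^ 4) \<partial>M)"
    by (rule integral_mono[OF i integrable.intros[OF m] le])
  also have "\<dots> = CARD('d) * (\<Sum>i\<in>(UNIV::'d set). 3 * h\<^sup>2)"
    using m by (rule has_bochner_integral_integral_eq)
  finally show "(\<integral>\<omega>. (norm (\<xi> \<omega>)) ^ 4 \<partial>M) \<le> 3 * (real CARD('d))\<^sup>2 * h\<^sup>2"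
    by (simp add: power2_eq_square)
qed

end
end

section \<open>Orthogonal projections and the logarithmic potential\<close>

definition proj_span :: "'v::euclidean_space set \<Rightarrow> 'v \<Rightarrow> 'v" where
  "proj_span E x = (\<Sum>e\<in>E. (x \<bullet> e) *\<^sub>R e)"

definition orthonormal :: "'v::euclidean_space set \<Rightarrow> bool" where
  "orthonormal E \<longleftrightarrow> finite E \<and> pairwise orthogonal E \<and> (\<forall>e\<in>E. norm e = 1)"

lemma proj_span_add: "proj_span E (x + y) = proj_span E x + proj_span E y"
  by (simp add: proj_span_def inner_add_left scaleR_add_left sum.distrib)

lemma proj_span_diff: "proj_span E (x - y) = proj_span E x - proj_span E y"
  by (simp add: proj_span_def inner_diff_left scaleR_diff_left sum_subtractf)

lemma continuous_on_proj_span [continuous_intros]: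
  "continuous_on S f \<Longrightarrow> continuous_on S (\<lambda>x. proj_span E (f x))"
  unfolding proj_span_def by (intro continuous_intros)

lemma proj_span_inner_commute: "proj_span E x \<bullet> y = x \<bullet> proj_span E y"
  by (simp add: proj_span_def inner_sum_left inner_sum_right mult.commute inner_commute)

lemma proj_span_base:
  assumes "orthonormal E" "e \<in> E"
  shows "proj_span E e = e"
proof -
  have "(\<Sum>e'\<in>E. (e \<bullet> e') *\<^sub>R e') = (\<Sum>e'\<in>{e}. (e \<bullet> e') *\<^sub>R e')"
    using assms by (intro sum.mono_neutral_right) (auto simp: orthonormal_def pairwise_def orthogonal_def)
  then show ?thesis using assms by (auto simp: proj_span_def orthonormal_def norm_eq_1)
qed

lemma proj_span_in_span: "proj_span E x \<in> span E"
  unfolding proj_span_def by (intro span_sum span_scale span_base)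

lemma proj_span_fixes:
  assumes E: "orthonormal E" and v: "v \<in> span E"
  shows "proj_span E v = v"
  using v
proof (induction rule: span_induct_alt)
  case base show ?case by (simp add: proj_span_def)
next
  case (step c x y)
  have "proj_span E (c *\<^sub>R x) = c *\<^sub>R proj_span E x"
    by (simp add: proj_span_def scaleR_sum_right)
  with step show ?case by (simp add: proj_span_add proj_span_base[OF E])
qed

lemma proj_span_inner_span:
  assumes "orthonormal E" "v \<in> span E"
  shows "proj_span E x \<bullet> v = x \<bullet> v"
  by (simp add: proj_span_inner_commute proj_span_fixes[OF assms])

lemma norm_proj_span_square:
  assumes "orthonormal E"
  shows "(norm (proj_span E x))\<^sup>2 = (\<Sum>e\<in>E. (e \<bullet> x)\<^sup>2)"
proof -
  have "(norm (proj_span E x))\<^sup>2 = x \<bullet> proj_span E x"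
    using proj_span_inner_span[OF assms proj_span_in_span] by (simp add: power2_norm_eq_inner)
  then show ?thesis
    by (simp add: proj_span_def inner_sum_right power2_eq_square inner_commute)
qed

lemma norm_proj_span_le:
  assumes "orthonormal E"
  shows "norm (proj_span E x) \<le> norm x"
proof -
  have "norm (proj_span E x) * norm (proj_span E x) = x \<bullet> proj_span E x"
    using proj_span_inner_span[OF assms proj_span_in_span, of x x]
    by (metis power2_eq_square power2_norm_eq_inner)
  also have "\<dots> \<le> norm x * norm (proj_span E x)"
    by (rule norm_cauchy_schwarz)
  finally show ?thesis
    by (cases "norm (proj_span E x) = 0") (auto simp: mult_le_cancel_right)
qed

lemma norm_proj_span_add_square:
  assumes "orthonormal E"
  shows "(norm (proj_span E (x + y)))\<^sup>2 =
    (norm (proj_span E x))\<^sup>2 + (2 * (proj_span E x \<bullet> y) + (norm (proj_span E y))\<^sup>2)"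
  unfolding proj_span_add
  using proj_span_inner_span[OF assms proj_span_in_span, of y x]
  by (simp add: power2_norm_eq_inner inner_add_left inner_add_right inner_commute)

section \<open>The scalar potential in the variable \<open>q\<close> and its Taylor
  estimates\<close>

definition pot :: "real \<Rightarrow> real \<Rightarrow> real" where "pot K q = - ln q / 2 - K * sqrt q"
definition pot1 :: "real \<Rightarrow> real \<Rightarrow> real" where "pot1 K q = - 1 / (2 * q) - K / (2 * sqrt q)"
definition pot2 :: "real \<Rightarrow> real \<Rightarrow> real" where "pot2 K q = 1 / (2 * q\<^sup>2) + K / (4 * (q * sqrt q))"
definition pot3 :: "real \<Rightarrow> real \<Rightarrow> real" where "pot3 K q = - 1 / q ^ 3 - 3 * K / (8 * (q\<^sup>2 * sqrt q))"

lemma pot_deriv: "0 < q \<Longrightarrow> (pot K has_real_derivative pot1 K q) (at q)"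
  unfolding pot_def pot1_def
  by (auto intro!: derivative_eq_intros simp: field_simps)

lemma pot1_deriv: "0 < q \<Longrightarrow> (pot1 K has_real_derivative pot2 K q) (at q)"
  unfolding pot1_def pot2_def
  apply (auto intro!: derivative_eq_intros)
  apply (simp add: power2_eq_square field_simps)
  done

lemma pot2_deriv:
  assumes q: "0 < q" shows "(pot2 K has_real_derivative pot3 K q) (at q)"
proof -
  define r where "r = sqrt q"
  have r: "0 < r" "q = r * r" using q by (auto simp: r_def)
  have "((\<lambda>q. q * sqrt q) has_real_derivative 1 * sqrt q + inverse (sqrt q) / 2 * q) (at q)"
    by (rule DERIV_mult[OF DERIV_ident DERIV_real_sqrt[OF q]])
  also have "1 * sqrt q + inverse (sqrt q) / 2 * q = 3 * r / 2"
    using r by (simp add: field_simps r_def[symmetric])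
  finally have "((\<lambda>q. K / (4 * (q * sqrt q))) has_real_derivative
      (0 * (4 * (q * sqrt q)) - K * (4 * (3 * r / 2))) / ((4 * (q * sqrt q)) * (4 * (q * sqrt q)))) (at q)"
    by (intro DERIV_divide DERIV_const DERIV_cmult) (use q in auto)
  also have "(0 * (4 * (q * sqrt q)) - K * (4 * (3 * r / 2))) / ((4 * (q * sqrt q)) * (4 * (q * sqrt q)))
      = - 3 * K / (8 * (q\<^sup>2 * sqrt q))"
    using r(1) unfolding r_def[symmetric] r(2) by (simp add: power2_eq_square field_simps)
  finally have 1: "((\<lambda>q. K / (4 * (q * sqrt q))) has_real_derivative - 3 * K / (8 * (q\<^sup>2 * sqrt q))) (at q)" .
  have "((\<lambda>q. 1 / (2 * q\<^sup>2)) has_real_derivative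
      (0 * (2 * q\<^sup>2) - 1 * (2 * (2 * q))) / ((2 * q\<^sup>2) * (2 * q\<^sup>2))) (at q)"
    by (intro DERIV_divide DERIV_const DERIV_cmult) (use q in \<open>auto intro!: derivative_eq_intros\<close>)
  also have "(0 * (2 * q\<^sup>2) - 1 * (2 * (2 * q))) / ((2 * q\<^sup>2) * (2 * q\<^sup>2)) = - 1 / q ^ 3"
    using q by (simp add: power2_eq_square power3_eq_cube)
  finally show ?thesis
    using DERIV_add[OF _ 1] by (simp add: pot2_def[abs_def] pot3_def)
qed

text \<open>Convexity, proved for the two summands separately: \<open>ln z \<le> z - 1\<close> for
  the logarithm and a completed square for the root. The tangent is taken at the end point
  \<open>b\<close> of the move.\<close>

lemma pot_tangent:
  assumes a: "0 < a" and b: "0 < b" and K: "0 \<le> K"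
  shows "pot K b - pot K a \<le> pot1 K b * (b - a)"
proof -
  have "ln (a / b) \<le> a / b - 1" using a b by (intro ln_le_minus_one) auto
  then have 1: "- ln b / 2 + ln a / 2 \<le> - 1 / (2 * b) * (b - a)"
    using a b by (simp add: ln_div field_simps)
  have "0 \<le> (sqrt a - sqrt b)\<^sup>2" by simp
  moreover have "sqrt a * sqrt a = a" "sqrt b * sqrt b = b" using a b by auto
  ultimately have "2 * sqrt b * (sqrt a - sqrt b) \<le> a - b"
    unfolding power2_eq_square by (simp add: algebra_simps del: real_sqrt_mult_self real_sqrt_mult)
  then have "sqrt a - sqrt b \<le> (a - b) / (2 * sqrt b)"
    using b by (simp add: pos_le_divide_eq mult.commute)
  then have "K * (sqrt a - sqrt b) \<le> K * ((a - b) / (2 * sqrt b))"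
    using K by (rule mult_left_mono)
  also have "\<dots> = - K / (2 * sqrt b) * (b - a)"
    using b by (simp add: field_simps)
  finally have 2: "K * sqrt a - K * sqrt b \<le> - K / (2 * sqrt b) * (b - a)"
    by (simp only: right_diff_distrib)
  have "pot1 K b * (b - a) = - 1 / (2 * b) * (b - a) + - K / (2 * sqrt b) * (b - a)"
    by (simp add: pot1_def left_diff_distrib)
  then show ?thesis using 1 2 by (simp add: pot_def)
qed

lemma pot1_nonpos: "0 < q \<Longrightarrow> 0 \<le> K \<Longrightarrow> pot1 K q \<le> 0"
proof -
  assume "0 < q" "0 \<le> K"
  then have "0 \<le> 1 / (2 * q)" "0 \<le> K / (2 * sqrt q)" by simp_all
  then show ?thesis unfolding pot1_def minus_divide_left[symmetric] by linarith
qed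

text \<open>Since \<open>q\<close> never drops below \<open>e\<close>, this and the bounds for
  \<open>pot2\<close> and \<open>pot3\<close> replace the derivatives by constants depending on
  \<open>e\<close> and \<open>K\<close> only.\<close>

lemma pot1_bound:
  assumes "0 < e" "e \<le> q" "0 \<le> K"
  shows "\<bar>pot1 K q\<bar> \<le> - pot1 K e"
proof -
  have "1 / (2 * q) \<le> 1 / (2 * e)" "K / (2 * sqrt q) \<le> K / (2 * sqrt e)"
    using assms by (auto intro!: divide_left_mono)
  moreover have "\<bar>pot1 K q\<bar> = - pot1 K q" using pot1_nonpos[of q K] assms by simp
  ultimately show ?thesis by (simp add: pot1_def)
qed

lemma pot2_nonneg: "0 < q \<Longrightarrow> 0 \<le> K \<Longrightarrow> 0 \<le> pot2 K q"
  by (simp add: pot2_def)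

lemma pot2_bound:
  assumes "0 < e" "e \<le> q" "0 \<le> K"
  shows "pot2 K q \<le> pot2 K e"
  unfolding pot2_def using assms
  by (intro add_mono divide_left_mono mult_left_mono mult_mono power_mono) auto

lemma pot3_bound:
  assumes "0 < e" "e \<le> q" "0 \<le> K"
  shows "- pot3 K q \<le> - pot3 K e"
proof -
  have "1 / q ^ 3 + 3 * K / (8 * (q\<^sup>2 * sqrt q)) \<le> 1 / e ^ 3 + 3 * K / (8 * (e\<^sup>2 * sqrt e))"
    using assms by (intro add_mono divide_left_mono mult_left_mono mult_mono power_mono) auto
  then show ?thesis by (simp add: pot3_def)
qed

lemma pot3_nonpos: "0 < q \<Longrightarrow> 0 \<le> K \<Longrightarrow> pot3 K q \<le> 0"
proof -
  assume "0 < q" "0 \<le> K"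
  then have "0 \<le> 1 / q ^ 3" "0 \<le> 3 * K / (8 * (q\<^sup>2 * sqrt q))" by simp_all
  then show ?thesis unfolding pot3_def minus_divide_left[symmetric] by linarith
qed

text \<open>The third derivative is nonpositive, so the cubic remainder counts only for negative
  \<open>w\<close>. In the application the negative part of \<open>w\<close> is at most linear in
  the Gaussian increment, which keeps the error within fourth moments.\<close>

lemma pot_taylor:
  assumes e: "0 < e" "e \<le> q" "e \<le> q + w" and K: "0 \<le> K"
  shows "pot K (q + w) - pot K q \<le> pot1 K q * w + pot2 K q * w\<^sup>2 / 2 + (- pot3 K e) * (max 0 (- w)) ^ 3"
proof (cases "w = 0")
  case True then show ?thesis by simp
next
  case False
  define diff where "diff m = (if m = 0 then pot K else if m = 1 then pot1 K else if m = 2 then pot2 K else pot3 K)" for m :: nat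
  have "\<exists>t. (if q + w < q then q + w < t \<and> t < q else q < t \<and> t < q + w) \<and>
    pot K (q + w) = (\<Sum>m<3. diff m q / fact m * (q + w - q) ^ m) + diff 3 t / fact 3 * (q + w - q) ^ 3"
  proof (rule Taylor[where a = e and b = "max q (q + w)"])
    show "\<forall>m t. m < 3 \<and> e \<le> t \<and> t \<le> max q (q + w) \<longrightarrow> (diff m has_real_derivative diff (Suc m) t) (at t)"
    proof (intro allI impI)
      fix m t assume "m < (3::nat) \<and> e \<le> t \<and> t \<le> max q (q + w)"
      then have t: "0 < t" and "m = 0 \<or> m = 1 \<or> m = 2" using e by auto
      then show "(diff m has_real_derivative diff (Suc m) t) (at t)"
        using pot_deriv[OF t] pot1_deriv[OF t] pot2_deriv[OF t] by (auto simp: diff_def)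
    qed
  qed (use e False in \<open>auto simp: diff_def\<close>)
  then obtain t where t: "if w < 0 then q + w < t \<and> t < q else q < t \<and> t < q + w"
    and eq: "pot K (q + w) = pot K q + pot1 K q * w + pot2 K q / 2 * w\<^sup>2 + pot3 K t / 6 * w ^ 3"
    by (auto simp: diff_def eval_nat_numeral fact_numeral)
  have te: "e \<le> t" using t e by (auto split: if_splits)
  have "pot3 K t / 6 * w ^ 3 \<le> (- pot3 K e) * (max 0 (- w)) ^ 3"
  proof (cases "w < 0")
    case True
    have "pot3 K t / 6 * w ^ 3 = (- pot3 K t / 6) * (- w) ^ 3" by simp
    also have "\<dots> \<le> (- pot3 K e) * (- w) ^ 3"
      using pot3_bound[OF e(1) te K] pot3_nonpos[of t K] te e(1) K True
      by (intro mult_right_mono) auto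
    finally show ?thesis using True by simp
  next
    case f: False
    then have "0 \<le> w ^ 3" "pot3 K t / 6 \<le> 0"
      using pot3_nonpos[of t K] te e(1) K by auto
    then show ?thesis using f by (simp add: mult_nonpos_nonneg)
  qed
  then show ?thesis using eq by simp
qed

text \<open>The left side is half the Laplacian of the potential in an \<open>m\<close>-dimensional
  span, because \<open>q - e\<close> is the squared distance. For \<open>m = 2\<close> the
  logarithmic part collapses to \<open>- e / q\<^sup>2\<close> and the root leaves
  \<open>- K / (2 * sqrt q)\<close> plus a further negative term. Larger \<open>m\<close> only
  helps, \<open>pot1\<close> being nonpositive.\<close>

lemma pot_generator:
  assumes e: "0 < e" "e \<le> q" and K: "0 \<le> K" and m: "2 \<le> m"
  shows "m * pot1 K q + 2 * (pot2 K q * (q - e)) \<le> - e / q\<^sup>2 - K / (2 * sqrt q)"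
proof -
  have q: "0 < q" "sqrt q * sqrt q = q" using e by auto
  have "m * pot1 K q \<le> 2 * pot1 K q"
    using pot1_nonpos[OF q(1) K] m by (simp add: mult_right_mono_neg)
  also have "2 * pot1 K q + 2 * (pot2 K q * (q - e)) = - e / q\<^sup>2 - K / (2 * sqrt q) - K * e / (2 * (q * sqrt q))"
    using q by (simp add: pot1_def pot2_def power2_eq_square divide_simps) (simp add: algebra_simps)
  then have "2 * pot1 K q + 2 * (pot2 K q * (q - e)) \<le> - e / q\<^sup>2 - K / (2 * sqrt q)"
    using e q K by simp
  finally show ?thesis by simp
qed

lemma sqrt_le_Suc: "0 \<le> q \<Longrightarrow> sqrt q \<le> 1 + q"
  by (rule real_le_lsqrt) (auto simp: power2_eq_square algebra_simps)

text \<open>The bound is linear in \<open>q\<close> with constants free of \<open>e\<close>, so the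
  potential at a stopped point is controlled by second moments alone.\<close>

lemma pot_lower:
  assumes "0 < q" "0 \<le> K" shows "- (1 + K) * (1 + q) \<le> pot K q"
proof -
  have "ln q \<le> q - 1" "K * sqrt q \<le> K * (1 + q)"
    using ln_le_minus_one sqrt_le_Suc[of q] assms by (auto intro: mult_left_mono)
  then show ?thesis using assms by (simp add: pot_def algebra_simps)
qed

text \<open>Serves integrability, where the dependence on \<open>ln e\<close> is harmless.\<close>

lemma pot_abs_bound:
  assumes "0 < e" "e \<le> 1" "e \<le> q" "0 \<le> K"
  shows "\<bar>pot K q\<bar> \<le> - ln e + (1 + K) * (1 + q)"
proof -
  have "ln e \<le> ln q" "ln e \<le> 0" "0 \<le> K * sqrt q" using assms by auto
  moreover have "0 \<le> (1 + K) * (1 + q)" using assms by simp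
  ultimately have "pot K q \<le> - ln e + (1 + K) * (1 + q)"
    unfolding pot_def using assms by linarith
  moreover have "- (pot K q) \<le> - ln e + (1 + K) * (1 + q)"
  proof -
    have "- ((1 + K) * (1 + q)) \<le> pot K q"
      using pot_lower[of q K] assms by (simp only: mult_minus_left)
    then show ?thesis using \<open>ln e \<le> 0\<close> by linarith
  qed
  ultimately show ?thesis by linarith
qed

section \<open>One Gaussian step\<close>

context filtered_brownian
begin

text \<open>The coefficient of \<open>h * sqrt h\<close> in \<open>pot_step\<close>;
  \<open>d\<close> and \<open>3 * d\<^sup>2\<close> are the second and fourth moment constants. It
  may explode as \<open>e\<close> tends to 0: summed over a grid it carries a factor
  \<open>sqrt h\<close>, which vanishes first.\<close>

definition step_const :: "real \<Rightarrow> real \<Rightarrow> real \<Rightarrow> real" where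
  "step_const e K R = (let d = real CARD('d) in
     (2 * pot2 K e * R + 8 * (- pot3 K e) * R ^ 3) * (d + 3 * d\<^sup>2) / 2 + 3 * pot2 K e * d\<^sup>2)"

text \<open>The arithmetic-geometric mean inequality with weight \<open>sqrt h\<close>, chosen so
  that the second and the fourth moment both contribute order \<open>h * sqrt h\<close>.\<close>

lemma cube_le:
  fixes x h :: real
  assumes "0 \<le> x" "0 < h"
  shows "x ^ 3 \<le> (sqrt h * x\<^sup>2 + x ^ 4 / sqrt h) / 2"
proof -
  have r: "0 < sqrt h" using assms by simp
  have "0 \<le> x\<^sup>2 * (x - sqrt h)\<^sup>2" by simp
  then have "2 * sqrt h * x ^ 3 \<le> sqrt h * sqrt h * x\<^sup>2 + x ^ 4"
    by (simp add: power2_eq_square eval_nat_numeral algebra_simps)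
  also have "\<dots> = 2 * sqrt h * ((sqrt h * x\<^sup>2 + x ^ 4 / sqrt h) / 2)"
    using r by (simp add: field_simps)
  finally show ?thesis using r by (simp add: mult_le_cancel_left_pos)
qed

lemma pot_step_pointwise:
  fixes p \<xi> :: "real ^ 'd"
  assumes E: "orthonormal E" and e: "0 < e" and K: "0 \<le> K" and R: "norm p \<le> R"
    and w: "w = 2 * (p \<bullet> \<xi>) + (norm (proj_span E \<xi>))\<^sup>2" and q: "q = e + (norm p)\<^sup>2" and nn: "0 \<le> (norm p)\<^sup>2 + w"
  shows "pot K (q + w) - pot K q \<le> pot1 K q * (2 * (p \<bullet> \<xi>)) + pot1 K q * (norm (proj_span E \<xi>))\<^sup>2
     + 2 * pot2 K q * (p \<bullet> \<xi>)\<^sup>2 + (2 * pot2 K e * R + 8 * (- pot3 K e) * R ^ 3) * norm \<xi> ^ 3 + pot2 K e * norm \<xi> ^ 4"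
proof -
  define x where "x = norm \<xi>"
  define y where "y = norm (proj_span E \<xi>)"
  have xy: "0 \<le> y" "y \<le> x" "0 \<le> x" "0 \<le> R"
    using norm_proj_span_le[OF E] order_trans[OF norm_ge_zero R] by (auto simp: x_def y_def)
  have px: "\<bar>p \<bullet> \<xi>\<bar> \<le> R * x"
    unfolding x_def by (rule order_trans[OF Cauchy_Schwarz_ineq2 mult_right_mono[OF R norm_ge_zero]])
  have qe: "e \<le> q" using q by simp
  have pp: "0 \<le> pot2 K q" "pot2 K q \<le> pot2 K e" "0 \<le> pot2 K e" "0 \<le> - pot3 K e"
    using pot2_nonneg[of q K] pot2_bound[OF e qe K] pot2_nonneg[OF e K] pot3_nonpos[OF e K] e qe K by auto
  have y24: "y\<^sup>2 \<le> x\<^sup>2" "(y\<^sup>2)\<^sup>2 \<le> x ^ 4"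
  proof -
    show "y\<^sup>2 \<le> x\<^sup>2" using xy by (intro power_mono)
    have "y ^ 4 \<le> x ^ 4" using xy by (intro power_mono)
    then show "(y\<^sup>2)\<^sup>2 \<le> x ^ 4" by simp
  qed
  have "pot K (q + w) - pot K q \<le> pot1 K q * w + pot2 K q * w\<^sup>2 / 2 + (- pot3 K e) * (max 0 (- w)) ^ 3"
    by (rule pot_taylor) (use e K q nn in auto)
  moreover have "pot1 K q * w = pot1 K q * (2 * (p \<bullet> \<xi>)) + pot1 K q * y\<^sup>2"
    by (simp add: w y_def distrib_left)
  \<comment> \<open>Only the linear part of \<open>w\<close> can be negative, and it is at least
    \<open>- 2 * R * x\<close>; hence an error of degree three rather than six.\<close>
  moreover have "(- pot3 K e) * (max 0 (- w)) ^ 3 \<le> (- pot3 K e) * (8 * R ^ 3 * x ^ 3)"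
  proof (rule mult_left_mono[OF _ pp(4)])
    have "max 0 (- w) \<le> 2 * (R * x)"
      using px xy mult_nonneg_nonneg[OF xy(4,3)] zero_le_power2[of y] unfolding w y_def[symmetric] by linarith
    then have "(max 0 (- w)) ^ 3 \<le> (2 * (R * x)) ^ 3" by (intro power_mono) auto
    then show "(max 0 (- w)) ^ 3 \<le> 8 * R ^ 3 * x ^ 3" by (simp add: power_mult_distrib)
  qed
  moreover have "pot2 K q * w\<^sup>2 / 2 \<le> 2 * pot2 K q * (p \<bullet> \<xi>)\<^sup>2 + pot2 K e * (2 * R * x ^ 3 + x ^ 4)"
  proof -
    have "w\<^sup>2 = 4 * (p \<bullet> \<xi>)\<^sup>2 + (4 * (p \<bullet> \<xi>) * y\<^sup>2 + (y\<^sup>2)\<^sup>2)"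
      by (simp add: w y_def power2_eq_square algebra_simps)
    moreover have "4 * (p \<bullet> \<xi>) * y\<^sup>2 \<le> 4 * (R * x) * x\<^sup>2"
    proof -
      have "4 * (p \<bullet> \<xi>) * y\<^sup>2 \<le> 4 * (R * x) * y\<^sup>2" using px by (intro mult_right_mono) auto
      also have "\<dots> \<le> 4 * (R * x) * x\<^sup>2" using xy y24 by (intro mult_left_mono) auto
      finally show ?thesis .
    qed
    ultimately have "w\<^sup>2 / 2 \<le> 2 * (p \<bullet> \<xi>)\<^sup>2 + (2 * R * x ^ 3 + x ^ 4)"
    proof -
      assume a: "w\<^sup>2 = 4 * (p \<bullet> \<xi>)\<^sup>2 + (4 * (p \<bullet> \<xi>) * y\<^sup>2 + (y\<^sup>2)\<^sup>2)"
        and b: "4 * (p \<bullet> \<xi>) * y\<^sup>2 \<le> 4 * (R * x) * x\<^sup>2"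
      have "4 * (R * x) * x\<^sup>2 = 4 * (R * x ^ 3)" by (simp add: power2_eq_square power3_eq_cube)
      moreover have "0 \<le> x ^ 4" by simp
      ultimately show ?thesis using a b y24(2) by linarith
    qed
    then have "pot2 K q * (w\<^sup>2 / 2) \<le> pot2 K q * (2 * (p \<bullet> \<xi>)\<^sup>2 + (2 * R * x ^ 3 + x ^ 4))"
      using pp by (intro mult_left_mono)
    also have "\<dots> = 2 * pot2 K q * (p \<bullet> \<xi>)\<^sup>2 + pot2 K q * (2 * R * x ^ 3 + x ^ 4)"
      by (simp add: algebra_simps)
    also have "pot2 K q * (2 * R * x ^ 3 + x ^ 4) \<le> pot2 K e * (2 * R * x ^ 3 + x ^ 4)"
      using pp xy by (intro mult_right_mono) auto
    finally show ?thesis by simp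
  qed
  ultimately show ?thesis
    unfolding x_def[symmetric] y_def[symmetric] by (simp add: algebra_simps)
qed

text \<open>Expectations in \<open>pot_step_pointwise\<close>: the linear term has mean zero, the
  squared projection contributes \<open>card E * h\<close>, the squared inner product
  \<open>h\<close> times the squared distance. Allowing any event \<open>A\<close> of the past is
  what later permits stopping.\<close>

lemma pot_step:
  fixes Z :: "'a \<Rightarrow> real ^ 'd"
  assumes s: "0 \<le> s" and h: "0 < h" "h \<le> 1"
    and E: "orthonormal E" "2 \<le> card E" and e: "0 < e" "e \<le> 1" and K: "0 \<le> K"
    and R0: "0 \<le> R" and Z: "Z \<in> borel_measurable (F s)" and A: "A \<in> sets (F s)"
    and R: "\<And>\<omega>. \<omega> \<in> A \<Longrightarrow> norm (proj_span E (Z \<omega> - h0)) \<le> R"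
  defines "\<xi> \<equiv> \<lambda>\<omega>. B (s + h) \<omega> - B s \<omega>"
    and "q \<equiv> \<lambda>x. e + (norm (proj_span E (x - h0)))\<^sup>2"
  shows "integrable M (\<lambda>\<omega>. indicator A \<omega> * (pot K (q (Z \<omega> + \<xi> \<omega>)) - pot K (q (Z \<omega>))))" (is "integrable M ?f")
    and "integrable M (\<lambda>\<omega>. indicator A \<omega> * (- e / (q (Z \<omega>))\<^sup>2 - K / (2 * sqrt (q (Z \<omega>)))))" (is "integrable M ?g")
    and "(\<integral>\<omega>. indicator A \<omega> * (pot K (q (Z \<omega> + \<xi> \<omega>)) - pot K (q (Z \<omega>))) \<partial>M)
      \<le> h * (\<integral>\<omega>. indicator A \<omega> * (- e / (q (Z \<omega>))\<^sup>2 - K / (2 * sqrt (q (Z \<omega>)))) \<partial>M)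
        + step_const e K R * (h * sqrt h)"
proof -
  define p where "p = (\<lambda>\<omega>. proj_span E (Z \<omega> - h0))"
  \<comment> \<open>Cutting off by \<open>A\<close> makes the coefficient bounded everywhere, as the
    moment identities demand.\<close>
  define u where "u = (\<lambda>\<omega>. indicator A \<omega> *\<^sub>R p \<omega>)"
  define Q where "Q = (\<lambda>\<omega>. q (Z \<omega>))"
  have Qp: "Q \<omega> = e + (norm (p \<omega>))\<^sup>2" for \<omega> by (simp add: Q_def q_def p_def)
  have Qe: "e \<le> Q \<omega>" "0 < Q \<omega>" for \<omega> using e by (auto simp: Qp intro: add_pos_nonneg)
  have [measurable]: "A \<in> sets (F s)" "Z \<in> borel_measurable (F s)" by fact+
  have pr [measurable]: "proj_span E \<in> borel_measurable borel"
    by (intro borel_measurable_continuous_onI continuous_intros)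
  have pm [measurable]: "p \<in> borel_measurable (F s)" unfolding p_def by measurable
  have Qm [measurable]: "Q \<in> borel_measurable (F s)" unfolding Qp[abs_def] by measurable
  have um [measurable]: "u \<in> borel_measurable (F s)" unfolding u_def by measurable
  have pot [measurable]: "pot K \<in> borel_measurable borel" "pot1 K \<in> borel_measurable borel" "pot2 K \<in> borel_measurable borel"
    unfolding pot_def[abs_def] pot1_def[abs_def] pot2_def[abs_def] by measurable
  have uR: "norm (u \<omega>) \<le> R" for \<omega>
    using R[of \<omega>] R0 by (auto simp: u_def p_def split: split_indicator)
  define w1 where "w1 = (\<lambda>\<omega>. indicator A \<omega> * pot1 K (Q \<omega>))"
  define w2 where "w2 = (\<lambda>\<omega>. indicator A \<omega> * (2 * pot2 K (Q \<omega>)))"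
  have w1m [measurable]: "w1 \<in> borel_measurable (F s)" and w2m [measurable]: "w2 \<in> borel_measurable (F s)"
    unfolding w1_def w2_def by measurable
  have w1b: "\<bar>w1 \<omega>\<bar> \<le> - pot1 K e" for \<omega>
    using pot1_bound[OF e(1) Qe(1) K, of \<omega>] pot1_nonpos[OF e(1) K] by (auto simp: w1_def split: split_indicator)
  have w2b: "\<bar>w2 \<omega>\<bar> \<le> 2 * pot2 K e" for \<omega>
    using pot2_bound[OF e(1) Qe(1) K, of \<omega>] pot2_nonneg[OF Qe(2) K, of \<omega>] pot2_nonneg[OF e(1) K]
    by (auto simp: w2_def split: split_indicator)
  define d where "d = real CARD('d)"
  define c2 where "c2 = pot2 K e"
  define c4 where "c4 = 2 * c2 * R + 8 * (- pot3 K e) * R ^ 3"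
  have "0 \<le> - pot3 K e" using pot3_nonpos[OF e(1) K] by simp
  moreover have c20: "0 \<le> c2" unfolding c2_def by (rule pot2_nonneg[OF e(1) K])
  ultimately have "0 \<le> c4"
    unfolding c4_def using R0 by (intro add_nonneg_nonneg mult_nonneg_nonneg zero_le_power) simp_all
  note c = c20 this
  have [measurable]: "\<xi> \<in> borel_measurable M"
    unfolding \<xi>_def by (rule increment_measurable[OF s h(1)])
  have n2: "integrable M (\<lambda>\<omega>. (norm (\<xi> \<omega>))\<^sup>2)" "(\<integral>\<omega>. (norm (\<xi> \<omega>))\<^sup>2 \<partial>M) = d * h"
    using increment_norm2[OF s h(1)] by (simp_all add: has_bochner_integral_iff \<xi>_def d_def)
  have n4: "integrable M (\<lambda>\<omega>. norm (\<xi> \<omega>) ^ 4)" "(\<integral>\<omega>. norm (\<xi> \<omega>) ^ 4 \<partial>M) \<le> 3 * d\<^sup>2 * h\<^sup>2"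
    using increment_norm4[OF s h(1)] by (simp_all add: \<xi>_def d_def)
  define Er where "Er = (\<lambda>\<omega>. c4 * ((sqrt h * (norm (\<xi> \<omega>))\<^sup>2 + norm (\<xi> \<omega>) ^ 4 / sqrt h) / 2) + c2 * norm (\<xi> \<omega>) ^ 4)"
  have Er_int: "integrable M Er"
    unfolding Er_def by (intro Bochner_Integration.integrable_add integrable_mult_right integrable_divide n2 n4)
  have Er_le: "(\<integral>\<omega>. Er \<omega> \<partial>M) \<le> step_const e K R * (h * sqrt h)"
  proof -
    define I4 where "I4 = (\<integral>\<omega>. norm (\<xi> \<omega>) ^ 4 \<partial>M)"
    have hh: "h\<^sup>2 / sqrt h = h * sqrt h" "h\<^sup>2 \<le> h * sqrt h"
    proof -
      have "h\<^sup>2 = h * sqrt h * sqrt h" using h by (simp add: power2_eq_square)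
      then show "h\<^sup>2 / sqrt h = h * sqrt h" using h by (simp add: divide_simps)
      have "sqrt h \<le> 1" using h by simp
      then have "h * sqrt h * sqrt h \<le> h * sqrt h * 1" using h by (intro mult_left_mono) auto
      then show "h\<^sup>2 \<le> h * sqrt h" using \<open>h\<^sup>2 = h * sqrt h * sqrt h\<close> by simp
    qed
    have "(\<integral>\<omega>. Er \<omega> \<partial>M) = c4 * ((sqrt h * (d * h) + I4 / sqrt h) / 2) + c2 * I4"
      unfolding Er_def I4_def using n2 n4 by (simp add: Bochner_Integration.integral_add integrable_divide)
    also have "\<dots> \<le> c4 * ((sqrt h * (d * h) + 3 * d\<^sup>2 * h\<^sup>2 / sqrt h) / 2) + c2 * (3 * d\<^sup>2 * h\<^sup>2)"
      using n4(2) c h unfolding I4_def[symmetric]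
      by (intro add_mono mult_left_mono divide_right_mono order_refl) auto
    also have "3 * d\<^sup>2 * h\<^sup>2 / sqrt h = 3 * d\<^sup>2 * (h * sqrt h)" using hh(1) by (metis times_divide_eq_right)
    also have "c4 * ((sqrt h * (d * h) + 3 * d\<^sup>2 * (h * sqrt h)) / 2) + c2 * (3 * d\<^sup>2 * h\<^sup>2)
       \<le> c4 * ((sqrt h * (d * h) + 3 * d\<^sup>2 * (h * sqrt h)) / 2) + c2 * (3 * d\<^sup>2 * (h * sqrt h))"
      using hh(2) c by (intro add_mono mult_left_mono order_refl) auto
    also have "\<dots> = step_const e K R * (h * sqrt h)"
      by (simp add: step_const_def Let_def d_def c4_def c2_def field_simps)
    finally show ?thesis .
  qed
  define l where "l = (\<lambda>\<omega>. ((2 * w1 \<omega>) *\<^sub>R u \<omega>) \<bullet> \<xi> \<omega>)"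
  have l: "has_bochner_integral M l 0"
    unfolding l_def \<xi>_def
  proof (rule increment_linear[OF s h(1), where c = "2 * (- pot1 K e) * R"])
    show "norm ((2 * w1 \<omega>) *\<^sub>R u \<omega>) \<le> 2 * (- pot1 K e) * R" for \<omega>
    proof -
      have "\<bar>w1 \<omega>\<bar> * norm (u \<omega>) \<le> (- pot1 K e) * R"
        using w1b[of \<omega>] uR[of \<omega>] pot1_nonpos[OF e(1) K] by (intro mult_mono) auto
      then have "2 * (\<bar>w1 \<omega>\<bar> * norm (u \<omega>)) \<le> 2 * ((- pot1 K e) * R)" by (rule mult_left_mono) simp
      then show ?thesis by (simp only: norm_scaleR abs_mult abs_numeral mult.assoc)
    qed
  qed measurable
  define t where "t = (\<lambda>\<omega>. w1 \<omega> * (norm (proj_span E (\<xi> \<omega>)))\<^sup>2)"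
  have t: "has_bochner_integral M t (real (card E) * (h * (\<integral>\<omega>. w1 \<omega> \<partial>M)))"
  proof -
    have "has_bochner_integral M (\<lambda>\<omega>. w1 \<omega> * (e' \<bullet> \<xi> \<omega>)\<^sup>2) (h * (\<integral>\<omega>. w1 \<omega> * (norm e')\<^sup>2 \<partial>M))" if "e' \<in> E" for e'
      unfolding \<xi>_def by (rule increment_quadratic[OF s h(1) _ _ w1m w1b]) auto
    then have "has_bochner_integral M (\<lambda>\<omega>. \<Sum>e'\<in>E. w1 \<omega> * (e' \<bullet> \<xi> \<omega>)\<^sup>2) (\<Sum>e'\<in>E. h * (\<integral>\<omega>. w1 \<omega> * (norm e')\<^sup>2 \<partial>M))"
      by (rule has_bochner_integral_sum)
    moreover have "(\<Sum>e'\<in>E. h * (\<integral>\<omega>. w1 \<omega> * (norm e')\<^sup>2 \<partial>M)) = real (card E) * (h * (\<integral>\<omega>. w1 \<omega> \<partial>M))"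
      using E by (simp add: orthonormal_def)
    moreover have "(\<lambda>\<omega>. \<Sum>e'\<in>E. w1 \<omega> * (e' \<bullet> \<xi> \<omega>)\<^sup>2) = t"
      by (simp add: t_def norm_proj_span_square[OF E(1)] sum_distrib_left)
    ultimately show ?thesis by simp
  qed
  define v where "v = (\<lambda>\<omega>. w2 \<omega> * (u \<omega> \<bullet> \<xi> \<omega>)\<^sup>2)"
  have v: "has_bochner_integral M v (h * (\<integral>\<omega>. w2 \<omega> * (norm (u \<omega>))\<^sup>2 \<partial>M))"
    unfolding v_def \<xi>_def by (rule increment_quadratic[OF s h(1) um uR w2m w2b])
  have qZ: "q (Z \<omega> + \<xi> \<omega>) = Q \<omega> + (2 * (p \<omega> \<bullet> \<xi> \<omega>) + (norm (proj_span E (\<xi> \<omega>)))\<^sup>2)" for \<omega>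
    using norm_proj_span_add_square[OF E(1), of "Z \<omega> - h0" "\<xi> \<omega>"]
    by (simp add: q_def Qp p_def add_diff_eq add.commute[of _ "\<xi> \<omega>"] diff_add_eq)
  have qe: "e \<le> q x" for x by (simp add: q_def)
  have f_le: "?f \<omega> \<le> l \<omega> + t \<omega> + v \<omega> + Er \<omega>" for \<omega>
  proof (cases "\<omega> \<in> A")
    case True
    have "pot K (q (Z \<omega> + \<xi> \<omega>)) - pot K (Q \<omega>) \<le> pot1 K (Q \<omega>) * (2 * (p \<omega> \<bullet> \<xi> \<omega>)) + pot1 K (Q \<omega>) * (norm (proj_span E (\<xi> \<omega>)))\<^sup>2
     + 2 * pot2 K (Q \<omega>) * (p \<omega> \<bullet> \<xi> \<omega>)\<^sup>2 + (2 * pot2 K e * R + 8 * (- pot3 K e) * R ^ 3) * norm (\<xi> \<omega>) ^ 3 + pot2 K e * norm (\<xi> \<omega>) ^ 4"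
      unfolding qZ
      by (rule pot_step_pointwise[OF E(1) e(1) K _ refl Qp])
        (use R[OF True] qe[of "Z \<omega> + \<xi> \<omega>"] qZ[of \<omega>] Qp[of \<omega>] in \<open>auto simp: p_def\<close>)
    moreover have "c4 * norm (\<xi> \<omega>) ^ 3 \<le> c4 * ((sqrt h * (norm (\<xi> \<omega>))\<^sup>2 + norm (\<xi> \<omega>) ^ 4 / sqrt h) / 2)"
      by (intro mult_left_mono cube_le c h norm_ge_zero)
    ultimately have "pot K (q (Z \<omega> + \<xi> \<omega>)) - pot K (Q \<omega>) \<le> pot1 K (Q \<omega>) * (2 * (p \<omega> \<bullet> \<xi> \<omega>))
       + pot1 K (Q \<omega>) * (norm (proj_span E (\<xi> \<omega>)))\<^sup>2 + 2 * pot2 K (Q \<omega>) * (p \<omega> \<bullet> \<xi> \<omega>)\<^sup>2 + Er \<omega>"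
      unfolding Er_def c2_def[symmetric] c4_def[symmetric] by linarith
    then show ?thesis
      using True by (simp add: l_def t_def v_def w1_def w2_def u_def Q_def)
  next
    case False
    moreover have "0 \<le> Er \<omega>" unfolding Er_def using c h by simp
    ultimately show ?thesis by (simp add: l_def t_def v_def w1_def w2_def)
  qed
  note MF = measurable_F_M[where t = s]
  note [measurable] = MF[OF pm] MF[OF Qm] MF[OF um] MF[OF w1m] MF[OF w2m] MF[OF Z]
  have [measurable]: "A \<in> sets M" using A sets_F_subset by blast
  have qm [measurable]: "q \<in> borel_measurable borel" unfolding q_def by measurable
  show f: "integrable M ?f"
  proof (rule Bochner_Integration.integrable_bound)
    show "integrable M (\<lambda>\<omega>. 2 * (- ln e) + (1 + K) * (2 + (e + 2 * R\<^sup>2 + 2 * (norm (\<xi> \<omega>))\<^sup>2) + (e + R\<^sup>2)))"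
      by (intro Bochner_Integration.integrable_add integrable_mult_right n2 integrable_const)
    show "AE \<omega> in M. norm (?f \<omega>) \<le> norm (2 * (- ln e) + (1 + K) * (2 + (e + 2 * R\<^sup>2 + 2 * (norm (\<xi> \<omega>))\<^sup>2) + (e + R\<^sup>2)))"
    proof (rule AE_I2)
      fix \<omega>
      let ?b = "2 * (- ln e) + (1 + K) * (2 + (e + 2 * R\<^sup>2 + 2 * (norm (\<xi> \<omega>))\<^sup>2) + (e + R\<^sup>2))"
      have "ln e \<le> 0" using e by simp
      then have b0: "0 \<le> ?b" using K e by (intro add_nonneg_nonneg mult_nonneg_nonneg) auto
      show "norm (?f \<omega>) \<le> norm ?b"
      proof (cases "\<omega> \<in> A")
        case True
        have pR: "norm (p \<omega>) \<le> R" using R[OF True] by (simp add: p_def)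
        have "norm (proj_span E (Z \<omega> + \<xi> \<omega> - h0)) \<le> R + norm (\<xi> \<omega>)"
        proof -
          have "proj_span E (Z \<omega> + \<xi> \<omega> - h0) = p \<omega> + proj_span E (\<xi> \<omega>)"
            by (simp add: p_def proj_span_add proj_span_diff)
          then show ?thesis
            using norm_triangle_ineq[of "p \<omega>" "proj_span E (\<xi> \<omega>)"] pR norm_proj_span_le[OF E(1), of "\<xi> \<omega>"] by simp
        qed
        then have "(norm (proj_span E (Z \<omega> + \<xi> \<omega> - h0)))\<^sup>2 \<le> (R + norm (\<xi> \<omega>))\<^sup>2" by (intro power_mono) auto
        also have "\<dots> \<le> 2 * R\<^sup>2 + 2 * (norm (\<xi> \<omega>))\<^sup>2"
          using sum_squares_bound[of R "norm (\<xi> \<omega>)"] by (simp add: power2_sum)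
        finally have q1: "q (Z \<omega> + \<xi> \<omega>) \<le> e + 2 * R\<^sup>2 + 2 * (norm (\<xi> \<omega>))\<^sup>2" by (simp add: q_def)
        have q2: "q (Z \<omega>) \<le> e + R\<^sup>2" using pR by (simp add: q_def p_def power_mono)
        have "\<bar>pot K (q (Z \<omega> + \<xi> \<omega>)) - pot K (q (Z \<omega>))\<bar>
           \<le> (- ln e + (1 + K) * (1 + q (Z \<omega> + \<xi> \<omega>))) + (- ln e + (1 + K) * (1 + q (Z \<omega>)))"
          using pot_abs_bound[OF e qe K, of "Z \<omega> + \<xi> \<omega>"] pot_abs_bound[OF e qe K, of "Z \<omega>"] by linarith
        also have "\<dots> = 2 * (- ln e) + (1 + K) * (2 + q (Z \<omega> + \<xi> \<omega>) + q (Z \<omega>))" by (simp add: algebra_simps)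
        also have "\<dots> \<le> ?b" using q1 q2 K by (intro add_left_mono mult_left_mono) auto
        finally show ?thesis using True b0 by simp
      qed (use b0 in simp)
    qed
  qed measurable
  have gm: "?g \<in> borel_measurable M" by measurable
  show g: "integrable M ?g"
  proof (rule integrable_const_bound[where B = "e / e\<^sup>2 + K / (2 * sqrt e)"])
    show "AE \<omega> in M. norm (?g \<omega>) \<le> e / e\<^sup>2 + K / (2 * sqrt e)"
    proof (rule AE_I2)
      fix \<omega>
      have "0 \<le> e / (q (Z \<omega>))\<^sup>2" "0 \<le> K / (2 * sqrt (q (Z \<omega>)))"
        "e / (q (Z \<omega>))\<^sup>2 \<le> e / e\<^sup>2" "K / (2 * sqrt (q (Z \<omega>))) \<le> K / (2 * sqrt e)"
        using e K qe[of "Z \<omega>"] by (auto intro!: divide_left_mono power_mono mult_pos_pos zero_less_power)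
      then show "norm (?g \<omega>) \<le> e / e\<^sup>2 + K / (2 * sqrt e)" by (auto split: split_indicator)
    qed
  qed (rule gm)
  have w1i: "integrable M w1" by (rule integrable_const_bound[where B = "- pot1 K e"]) (use w1b in auto)
  have w2i: "integrable M (\<lambda>\<omega>. w2 \<omega> * (norm (u \<omega>))\<^sup>2)"
  proof (rule integrable_const_bound[where B = "2 * pot2 K e * R\<^sup>2"])
    show "AE \<omega> in M. norm (w2 \<omega> * (norm (u \<omega>))\<^sup>2) \<le> 2 * pot2 K e * R\<^sup>2"
      using w2b uR pot2_nonneg[OF e(1) K] by (auto simp: abs_mult intro!: AE_I2 mult_mono power_mono)
  qed measurable
  have "(\<integral>\<omega>. ?f \<omega> \<partial>M) \<le> (\<integral>\<omega>. l \<omega> + t \<omega> + v \<omega> + Er \<omega> \<partial>M)"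
    by (intro integral_mono f Bochner_Integration.integrable_add Er_int f_le
      integrable.intros[OF l] integrable.intros[OF t] integrable.intros[OF v])
  also have "\<dots> = 0 + real (card E) * (h * (\<integral>\<omega>. w1 \<omega> \<partial>M)) + h * (\<integral>\<omega>. w2 \<omega> * (norm (u \<omega>))\<^sup>2 \<partial>M) + (\<integral>\<omega>. Er \<omega> \<partial>M)"
    by (intro has_bochner_integral_integral_eq has_bochner_integral_add l t v has_bochner_integral_integrable Er_int)
  also have "\<dots> = h * (\<integral>\<omega>. real (card E) * w1 \<omega> + w2 \<omega> * (norm (u \<omega>))\<^sup>2 \<partial>M) + (\<integral>\<omega>. Er \<omega> \<partial>M)"
    using w1i w2i by (simp add: algebra_simps)
  also have "(\<integral>\<omega>. real (card E) * w1 \<omega> + w2 \<omega> * (norm (u \<omega>))\<^sup>2 \<partial>M) \<le> (\<integral>\<omega>. ?g \<omega> \<partial>M)"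
  proof (rule integral_mono[OF _ g])
    show "integrable M (\<lambda>\<omega>. real (card E) * w1 \<omega> + w2 \<omega> * (norm (u \<omega>))\<^sup>2)" using w1i w2i by simp
    have qQ: "q (Z \<omega>) = Q \<omega>" for \<omega> by (simp add: Q_def)
    show "real (card E) * w1 \<omega> + w2 \<omega> * (norm (u \<omega>))\<^sup>2 \<le> ?g \<omega>" for \<omega>
      unfolding qQ
      using pot_generator[OF e(1) Qe(1)[of \<omega>] K, of "real (card E)"] E(2)
      by (auto simp: w1_def w2_def u_def Qp mult.assoc split: split_indicator)
  qed
  finally show "(\<integral>\<omega>. ?f \<omega> \<partial>M) \<le> h * (\<integral>\<omega>. ?g \<omega> \<partial>M) + step_const e K R * (h * sqrt h)"
    using Er_le h by (simp add: mult_left_mono)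
qed

end

section \<open>Geometry of the polyhedral domain\<close>

text \<open>A point of the closed polyhedron is the limit of points on the segment towards a point
  \<open>d\<close> of the open one, since every convex combination with positive weight at
  \<open>d\<close> satisfies the inequalities strictly.\<close>

lemma closure_Dom:
  fixes n :: "nat \<Rightarrow> real ^ 'd"
  assumes "Dom I n a \<noteq> {}"
  shows "closure (Dom I n a) = {x. \<forall>i\<in>I. a i \<le> x \<bullet> n i}"
proof
  have "closed {x. \<forall>i\<in>I. a i \<le> x \<bullet> n i}"
  proof -
    have "{x. \<forall>i\<in>I. a i \<le> x \<bullet> n i} = (\<Inter>i\<in>I. {x. a i \<le> n i \<bullet> x})" by (auto simp: inner_commute)
    then show ?thesis by (auto intro!: closed_INT closed_halfspace_ge)
  qed
  then show "closure (Dom I n a) \<subseteq> {x. \<forall>i\<in>I. a i \<le> x \<bullet> n i}"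
    by (intro closure_minimal) (auto simp: Dom_def less_imp_le)
  show "{x. \<forall>i\<in>I. a i \<le> x \<bullet> n i} \<subseteq> closure (Dom I n a)"
  proof
    fix x assume x: "x \<in> {x. \<forall>i\<in>I. a i \<le> x \<bullet> n i}"
    obtain d where d: "d \<in> Dom I n a" using assms by auto
    define f where "f k = x + (1 / real (Suc k)) *\<^sub>R (d - x)" for k
    have "f k \<in> Dom I n a" for k
      unfolding Dom_def
    proof (intro CollectI ballI)
      fix i assume i: "i \<in> I"
      have xi: "a i \<le> x \<bullet> n i" and di: "a i < d \<bullet> n i" using x d i by (auto simp: Dom_def)
      define t where "t = 1 / real (Suc k)"
      have t: "0 < t" "t \<le> 1" by (auto simp: t_def)
      have "f k = x + t *\<^sub>R (d - x)" by (simp add: f_def t_def)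
      then have "f k \<bullet> n i = (x + t *\<^sub>R (d - x)) \<bullet> n i" by (rule arg_cong)
      also have "\<dots> = (1 - t) * (x \<bullet> n i) + t * (d \<bullet> n i)"
        by (simp add: inner_add_left inner_diff_left algebra_simps)
      also have "\<dots> > (1 - t) * a i + t * a i"
        using t xi di by (intro add_le_less_mono mult_left_mono mult_strict_left_mono) auto
      finally show "a i < f k \<bullet> n i" by (simp add: algebra_simps)
    qed
    moreover have "f \<longlonglongrightarrow> x + 0 *\<^sub>R (d - x)"
      unfolding f_def by (intro tendsto_intros LIMSEQ_Suc[OF lim_1_over_n])
    ultimately show "x \<in> closure (Dom I n a)"
      unfolding closure_sequential by (intro exI[of _ f]) auto
  qed
qed

text \<open>Moving from \<open>x\<close> slightly in the direction \<open>p\<close> stays inside \<open>closure (Dom I n a)\<close>.\<close>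

lemma inward_normal_inner_nonneg:
  fixes n :: "nat \<Rightarrow> real ^ 'd"
  assumes D: "Dom I n a \<noteq> {}" and I: "finite I" "A \<subseteq> I" and x: "x \<in> closure (Dom I n a)"
    and free: "\<And>k. k \<in> I - A \<Longrightarrow> a k < x \<bullet> n k"
    and p: "\<And>j. j \<in> A \<Longrightarrow> p \<bullet> n j = x \<bullet> n j - a j"
    and v: "inward_normal (Dom I n a) x v"
  shows "0 \<le> v \<bullet> p"
proof -
  have "\<forall>k\<in>I - A. \<exists>\<delta>>0. \<forall>t. 0 \<le> t \<and> t \<le> \<delta> \<longrightarrow> a k \<le> (x + t *\<^sub>R p) \<bullet> n k"
  proof
    fix k assume k: "k \<in> I - A"
    \<comment> \<open>Up to this time the displacement \<open>t * (p \<bullet> n k)\<close> cannot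
      use up the slack of face \<open>k\<close>; the added 1 keeps the denominator positive.\<close>
    define \<delta> where "\<delta> = (x \<bullet> n k - a k) / (1 + \<bar>p \<bullet> n k\<bar>)"
    have pos: "0 < 1 + \<bar>p \<bullet> n k\<bar>" by simp
    have "a k \<le> (x + t *\<^sub>R p) \<bullet> n k" if t: "0 \<le> t" "t \<le> \<delta>" for t
    proof -
      have "t * (1 + \<bar>p \<bullet> n k\<bar>) \<le> x \<bullet> n k - a k"
        using t(2) pos by (simp add: \<delta>_def pos_le_divide_eq)
      moreover have "t * - (p \<bullet> n k) \<le> t * (1 + \<bar>p \<bullet> n k\<bar>)"
        using t(1) by (intro mult_left_mono) auto
      ultimately show ?thesis by (simp add: inner_add_left)
    qed
    moreover have "0 < \<delta>" using free[OF k] by (simp add: \<delta>_def)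
    ultimately show "\<exists>\<delta>>0. \<forall>t. 0 \<le> t \<and> t \<le> \<delta> \<longrightarrow> a k \<le> (x + t *\<^sub>R p) \<bullet> n k" by auto
  qed
  then obtain \<delta> where \<delta>: "\<And>k. k \<in> I - A \<Longrightarrow> 0 < \<delta> k"
    "\<And>k t. k \<in> I - A \<Longrightarrow> 0 \<le> t \<Longrightarrow> t \<le> \<delta> k \<Longrightarrow> a k \<le> (x + t *\<^sub>R p) \<bullet> n k"
    by metis
  \<comment> \<open>The inserted 1 keeps the minimum meaningful when every face is active.\<close>
  define t where "t = Min (insert 1 (\<delta> ` (I - A)))"
  have fin: "finite (insert 1 (\<delta> ` (I - A)))" using I by auto
  have t: "0 < t" using \<delta>(1) fin by (simp add: t_def)
  have tk: "t \<le> \<delta> k" if "k \<in> I - A" for k using fin that by (simp add: t_def)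
  have "x + t *\<^sub>R p \<in> closure (Dom I n a)"
    unfolding closure_Dom[OF D]
  proof (intro CollectI ballI)
    fix i assume i: "i \<in> I"
    show "a i \<le> (x + t *\<^sub>R p) \<bullet> n i"
    proof (cases "i \<in> A")
      case True
      have "a i \<le> x \<bullet> n i" using x i by (simp add: closure_Dom[OF D])
      moreover from this have "0 \<le> t * (x \<bullet> n i - a i)" using t by simp
      ultimately show ?thesis by (simp add: inner_add_left p[OF True])
    qed (use \<delta>(2) tk t i in auto)
  qed
  then have "v \<bullet> (x - (x + t *\<^sub>R p)) \<le> 0" using v unfolding inward_normal_def by blast
  then show ?thesis using t by (simp add: zero_le_mult_iff)
qed

text \<open>The derivative of a convex function is nondecreasing, so its value at
  \<open>R + 1\<close> bounds it on the interval; near 0 it may tend to minus infinity, hence a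
  one-sided bound. Comparing with \<open>R + 1\<close> instead of \<open>R\<close> keeps the factor
  \<open>R + 1 - u\<close> positive for cancellation.\<close>

lemma deriv_bounded_above_of_ereal_convex:
  assumes conv: "ereal_convex \<phi>" and R: "0 < R"
    and f: "\<And>x. 0 < x \<Longrightarrow> \<phi> x = ereal (f x)" "\<And>x. 0 < x \<Longrightarrow> f differentiable (at x)"
  shows "\<exists>c\<ge>0. \<forall>u. 0 < u \<and> u \<le> R \<longrightarrow> deriv (\<lambda>y. real_of_ereal (\<phi> y)) u \<le> c"
proof -
  have cf: "convex_on {0<..} f"
  proof (rule convex_onI)
    fix t x y :: real assume a: "0 < t" "t < 1" "x \<in> {0<..}" "y \<in> {0<..}"
    have pos: "0 < (1 - t) * x + t * y" using a by (auto intro!: add_pos_pos mult_pos_pos)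
    have "0 \<le> t \<and> t \<le> 1" using a by simp
    then have "\<phi> ((1 - t) * x + t * y) \<le> ereal (1 - t) * \<phi> x + ereal t * \<phi> y"
      using conv unfolding ereal_convex_def by blast
    then show "f ((1 - t) *\<^sub>R x + t *\<^sub>R y) \<le> (1 - t) * f x + t * f y"
      using a pos by (simp add: f(1))
  qed simp
  have eq: "deriv (\<lambda>y. real_of_ereal (\<phi> y)) u = deriv f u" if "0 < u" for u
  proof (rule deriv_cong_ev)
    show "\<forall>\<^sub>F x in nhds u. real_of_ereal (\<phi> x) = f x"
      using eventually_nhds_in_open[of "{0<..}" u] that
      by (auto elim!: eventually_mono simp: f(1))
  qed simp
  have tangent: "f y \<ge> f x + deriv f x * (y - x)" if "0 < x" "0 < y" for x y
  proof -
    have "f y - f x \<ge> deriv f x * (y - x)"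
    proof (rule convex_on_imp_above_tangent[OF cf connected_Ioi])
      show "(f has_real_derivative deriv f x) (at x within {0<..})"
        using f(2)[OF that(1)] DERIV_deriv_iff_real_differentiable has_field_derivative_at_within by blast
    qed (use that in \<open>simp_all add: interior_open\<close>)
    then show ?thesis by simp
  qed
  have "deriv f u \<le> max 0 (deriv f (R + 1))" if u: "0 < u" "u \<le> R" for u
  proof -
    have "f (R + 1) \<ge> f u + deriv f u * (R + 1 - u)" "f u \<ge> f (R + 1) + deriv f (R + 1) * (u - (R + 1))"
      using tangent u R by auto
    then have "deriv f u * (R + 1 - u) \<le> deriv f (R + 1) * (R + 1 - u)" by (simp add: algebra_simps)
    then show ?thesis using u by (simp add: mult_le_cancel_right)
  qed
  then show ?thesis using eq by (intro exI[of _ "max 0 (deriv f (R + 1))"]) auto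
qed

text \<open>On a face in \<open>A\<close> the coefficient
  \<open>n i \<bullet> p = x \<bullet> n i - a i\<close> is nonnegative, so an upper bound on the
  possibly unbounded derivative suffices. On the other faces the argument stays in a compact
  interval inside the open half-line, where continuity bounds the derivative.\<close>

lemma gradPhi_inner_bound:
  fixes n :: "nat \<Rightarrow> real ^ 'd"
  assumes I: "finite I" "A \<subseteq> I" and unit: "\<And>i. i \<in> I \<Longrightarrow> norm (n i) = 1"
    and conv: "\<And>i. i \<in> I \<Longrightarrow> ereal_convex (\<phi> i)"
    and smooth: "\<And>i. i \<in> I \<Longrightarrow> \<exists>f. (\<forall>x>0. \<phi> i x = ereal (f x)) \<and>
            (\<forall>x>0. f differentiable (at x)) \<and> continuous_on {0<..} (deriv f)"
    and r: "0 < r" "\<And>k. k \<in> I - A \<Longrightarrow> 2 * r < x0 \<bullet> n k - a k"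
  shows "\<exists>C\<ge>0. \<forall>x p. dist x x0 < 2 * r \<and> (\<forall>i\<in>I. a i \<le> x \<bullet> n i) \<and>
           (\<forall>j\<in>A. p \<bullet> n j = x \<bullet> n j - a j) \<longrightarrow> gradPhi I \<phi> n a x \<bullet> p \<le> C * norm p"
proof -
  define g where "g i = deriv (\<lambda>y. real_of_ereal (\<phi> i y))" for i
  have close: "\<bar>x \<bullet> n i - x0 \<bullet> n i\<bar> < 2 * r" if "dist x x0 < 2 * r" "i \<in> I" for x i
  proof -
    have "\<bar>x \<bullet> n i - x0 \<bullet> n i\<bar> \<le> norm (x - x0)"
      using Cauchy_Schwarz_ineq2[of "x - x0" "n i"] unit[OF that(2)] by (simp add: inner_diff_left)
    with that show ?thesis by (simp add: dist_norm)
  qed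
  have "\<exists>c\<ge>0. \<forall>x p. dist x x0 < 2 * r \<and> a i \<le> x \<bullet> n i \<and>
           (i \<in> A \<longrightarrow> p \<bullet> n i = x \<bullet> n i - a i) \<longrightarrow> g i (x \<bullet> n i - a i) * (n i \<bullet> p) \<le> c * norm p" if i: "i \<in> I" for i
  proof -
    define R where "R = \<bar>x0 \<bullet> n i - a i\<bar> + 2 * r"
    have R: "0 < R" using r by (simp add: R_def)
    have xR: "x \<bullet> n i - a i \<le> R" if "dist x x0 < 2 * r" for x
      using close[OF that i] by (simp add: R_def)
    have np: "\<bar>n i \<bullet> p\<bar> \<le> norm p" for p
      using Cauchy_Schwarz_ineq2[of "n i" p] unit[OF i] by simp
    obtain f where f: "\<And>x. 0 < x \<Longrightarrow> \<phi> i x = ereal (f x)" "\<And>x. 0 < x \<Longrightarrow> f differentiable (at x)"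
       "continuous_on {0<..} (deriv f)" using smooth[OF i] by blast
    show ?thesis
    proof (cases "i \<in> A")
      case True
      obtain c where c: "0 \<le> c" "\<And>u. 0 < u \<Longrightarrow> u \<le> R \<Longrightarrow> g i u \<le> c"
        using deriv_bounded_above_of_ereal_convex[OF conv[OF i] R f(1,2)] unfolding g_def by blast
      show ?thesis
      proof (intro exI[of _ c] conjI c(1) allI impI)
        fix x p assume "dist x x0 < 2 * r \<and> a i \<le> x \<bullet> n i \<and> (i \<in> A \<longrightarrow> p \<bullet> n i = x \<bullet> n i - a i)"
        then have x: "dist x x0 < 2 * r" "a i \<le> x \<bullet> n i" and p: "n i \<bullet> p = x \<bullet> n i - a i"
          using True by (auto simp: inner_commute)
        have "g i (x \<bullet> n i - a i) * (n i \<bullet> p) \<le> c * (n i \<bullet> p)"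
        proof (cases "x \<bullet> n i - a i = 0")
          \<comment> \<open>On the face itself \<open>deriv\<close> is a junk value, but it is multiplied by 0.\<close>
          case False
          then show ?thesis using x c(2)[OF _ xR[OF x(1)]] by (intro mult_right_mono) (auto simp: p)
        qed (simp add: p)
        also have "\<dots> \<le> c * norm p" using np[of p] c(1) by (intro mult_left_mono) auto
        finally show "g i (x \<bullet> n i - a i) * (n i \<bullet> p) \<le> c * norm p" .
      qed
    next
      case False
      define l where "l = x0 \<bullet> n i - a i - 2 * r"
      have l: "0 < l" using r(2) i False by (simp add: l_def)
      have lx: "l \<le> x \<bullet> n i - a i" if "dist x x0 < 2 * r" for x
        using close[OF that i] by (simp add: l_def)
      have "g i u = deriv f u" if "0 < u" for u
        unfolding g_def
      proof (rule deriv_cong_ev)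
        show "\<forall>\<^sub>F x in nhds u. real_of_ereal (\<phi> i x) = f x"
          using eventually_nhds_in_open[of "{0<..}" u] that
          by (auto elim!: eventually_mono simp: f(1))
      qed simp
      then have "continuous_on {l..R} (g i)"
        using continuous_on_subset[OF f(3), of "{l..R}"] greaterThan_iff atLeastAtMost_iff l
        by (subst continuous_on_cong[OF refl, of _ _ "deriv f"]) (auto simp: subset_iff)
      then have "bounded (g i ` {l..R})" by (intro compact_imp_bounded compact_continuous_image) auto
      then obtain c where "\<forall>y\<in>g i ` {l..R}. norm y \<le> c" unfolding bounded_iff by blast
      then have c: "\<bar>g i u\<bar> \<le> c" if "u \<in> {l..R}" for u using that by auto
      show ?thesis
      proof (intro exI[of _ "max 0 c"] conjI allI impI)
        fix x p assume "dist x x0 < 2 * r \<and> a i \<le> x \<bullet> n i \<and> (i \<in> A \<longrightarrow> p \<bullet> n i = x \<bullet> n i - a i)"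
        then have x: "dist x x0 < 2 * r" by auto
        have "g i (x \<bullet> n i - a i) * (n i \<bullet> p) \<le> \<bar>g i (x \<bullet> n i - a i)\<bar> * \<bar>n i \<bullet> p\<bar>"
          by (metis abs_ge_self abs_mult)
        also have "\<dots> \<le> max 0 c * norm p"
          using c[of "x \<bullet> n i - a i"] lx[OF x] xR[OF x] np[of p] by (intro mult_mono) auto
        finally show "g i (x \<bullet> n i - a i) * (n i \<bullet> p) \<le> max 0 c * norm p" .
      qed simp
    qed
  qed
  then obtain c where c: "\<And>i. i \<in> I \<Longrightarrow> 0 \<le> c i" "\<And>i x p. i \<in> I \<Longrightarrow> dist x x0 < 2 * r \<Longrightarrow> a i \<le> x \<bullet> n i \<Longrightarrow>
           (i \<in> A \<longrightarrow> p \<bullet> n i = x \<bullet> n i - a i) \<Longrightarrow> g i (x \<bullet> n i - a i) * (n i \<bullet> p) \<le> c i * norm p"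
    by metis
  show ?thesis
  proof (intro exI[of _ "sum c I"] conjI allI impI sum_nonneg c(1))
    fix x p assume *: "dist x x0 < 2 * r \<and> (\<forall>i\<in>I. a i \<le> x \<bullet> n i) \<and> (\<forall>j\<in>A. p \<bullet> n j = x \<bullet> n j - a j)"
    have "gradPhi I \<phi> n a x \<bullet> p = (\<Sum>i\<in>I. g i (x \<bullet> n i - a i) * (n i \<bullet> p))"
      by (simp add: gradPhi_def g_def inner_sum_left)
    also have "\<dots> \<le> (\<Sum>i\<in>I. c i * norm p)" using * by (intro sum_mono c(2)) auto
    finally show "gradPhi I \<phi> n a x \<bullet> p \<le> sum c I * norm p" by (simp add: sum_distrib_right)
  qed
qed

text \<open>Distinct unit vectors are dependent only if they are opposite. Opposite normals of two
  faces through \<open>h0\<close> would force \<open>a i = - a j\<close>, and the two strict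
  inequalities at a point of the domain would then add up to \<open>0 > 0\<close>.\<close>

lemma normals_basis:
  fixes n :: "nat \<Rightarrow> real ^ 'd"
  assumes unit: "\<And>i. i \<in> I \<Longrightarrow> norm (n i) = 1" and inj: "inj_on n I"
    and D: "Dom I n a \<noteq> {}" and A: "A \<subseteq> I" "card A \<ge> 2" and h0: "h0 \<in> Hyp A n a"
  shows "\<exists>E. orthonormal E \<and> 2 \<le> card E \<and> span E = span (n ` A)"
proof -
  obtain E where E: "E \<subseteq> span (n ` A)" "pairwise orthogonal E" "\<And>x. x \<in> E \<Longrightarrow> norm x = 1"
    "independent E" "card E = dim (span (n ` A))" "span E = span (n ` A)"
    using orthonormal_basis_subspace[OF subspace_span[of "n ` A"]] by metis
  obtain d where d: "d \<in> Dom I n a" using D by auto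
  have "\<exists>i j. i \<in> A \<and> j \<in> A \<and> i \<noteq> j"
    using A(2) by (metis card_2_iff' card_le_Suc0_iff_eq card.infinite le_SucE not_less_eq_eq numeral_2_eq_2 zero_le)
  then obtain i j where ij: "i \<in> A" "j \<in> A" "i \<noteq> j" by auto
  have nij: "n i \<noteq> n j" using ij A(1) inj by (auto simp: inj_on_def)
  have u: "norm (n i) = 1" "norm (n j) = 1" using ij A unit by auto
  have "independent {n i, n j}"
  proof
    assume "dependent {n i, n j}"
    moreover have "independent {n j}" using u by (auto simp: dependent_single)
    ultimately have "n i \<in> span {n j}" using independent_insertI[of "n i" "{n j}"] by blast
    then obtain k where k: "n i = k *\<^sub>R n j" by (auto simp: span_singleton)
    then have "\<bar>k\<bar> = 1" using u by simp
    then have "n i = - n j" using k nij by (auto simp: abs_if split: if_splits)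
    moreover have "h0 \<bullet> n i = a i" "h0 \<bullet> n j = a j" using h0 ij by (auto simp: Hyp_def)
    moreover have "d \<bullet> n i > a i" "d \<bullet> n j > a j" using d ij A by (auto simp: Dom_def)
    ultimately show False by simp
  qed
  then have "card {n i, n j} \<le> dim (span (n ` A))"
    using ij by (intro independent_card_le_dim) (auto intro: span_base)
  then have "2 \<le> card E" using nij E by simp
  then show ?thesis using E by (intro exI[of _ E]) (auto simp: orthonormal_def intro: card_ge_0_finite)
qed

section \<open>Paths driven by a drift and a reflection term\<close>

text \<open>One sample path, free of probability. \<open>N s\<close> abstracts the inward unit
  normals at time \<open>s\<close>; \<open>V\<close> is to be the solution minus its starting value
  and the Brownian path.\<close>

locale bv_path =
  fixes b nn :: "real \<Rightarrow> real ^ 'd" and L :: "real \<Rightarrow> real" and N :: "real \<Rightarrow> real ^ 'd \<Rightarrow> bool"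
    and V :: "real \<Rightarrow> real ^ 'd"
  assumes L_cont: "continuous_on {0..} L" and L_mono: "mono_on {0..} L"
    and b_int: "\<And>t. 0 \<le> t \<Longrightarrow> set_integrable lborel {0..t} b"
    and nn_int: "\<And>t. 0 \<le> t \<Longrightarrow> integrable (dL L t) nn"
    and nn_normal: "\<And>t. 0 \<le> t \<Longrightarrow> AE s in dL L t. N s (nn s)"
    and N_unit: "\<And>s v. N s v \<Longrightarrow> norm v = 1"
    and V_eq: "\<And>t. 0 \<le> t \<Longrightarrow> V t = - (LINT s:{0..t}|lborel. b s) + (\<integral>s. nn s \<partial>dL L t)"
begin

text \<open>One Stieltjes measure of which every \<open>dL L t\<close> is a restriction, so that
  integrals over adjacent intervals can be added.\<close>

definition \<mu> where "\<mu> = interval_measure (\<lambda>s. L (max 0 s))"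
text \<open>A majorant for the variation of \<open>V\<close>: the reflection contributes at most the
  increment of \<open>L\<close>, because its directions are unit vectors.\<close>

definition W where "W t = (LINT s:{0..t}|lborel. norm (b s)) + L t"

lemma dL_eq: "dL L t = restrict_space \<mu> {0..t}"
  by (simp add: dL_def \<mu>_def)

lemma sets_\<mu> [simp, measurable_cong]: "sets \<mu> = sets borel" and space_\<mu> [simp]: "space \<mu> = UNIV"
  by (simp_all add: \<mu>_def)

lemma emeasure_\<mu>:
  assumes "0 \<le> s" "s \<le> t"
  shows "emeasure \<mu> {s<..t} = ennreal (L t - L s)"
proof -
  have c: "continuous_on UNIV (\<lambda>s. L (max 0 s))"
    by (rule continuous_on_compose2[OF L_cont]) (auto intro!: continuous_intros)
  have "emeasure \<mu> {s<..t} = L (max 0 t) - L (max 0 s)"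
    unfolding \<mu>_def
  proof (rule emeasure_interval_measure_Ioc[OF assms(2)])
    show "x \<le> y \<Longrightarrow> L (max 0 x) \<le> L (max 0 y)" for x y
      by (rule mono_onD[OF L_mono]) auto
    show "continuous (at_right a) (\<lambda>s. L (max 0 s))" for a
      using c by (auto simp: continuous_on_eq_continuous_at intro: continuous_at_imp_continuous_at_within)
  qed
  then show ?thesis using assms by simp
qed

lemma measure_\<mu>:
  assumes "0 \<le> s" "s \<le> t" shows "measure \<mu> {s<..t} = L t - L s"
  using emeasure_\<mu>[OF assms] mono_onD[OF L_mono, of s t] assms by (simp add: measure_def)

lemma const_int_\<mu>:
  assumes "0 \<le> s" "s \<le> t" shows "set_integrable \<mu> {s<..t} (\<lambda>_. c :: real)" "(LINT r:{s<..t}|\<mu>. c) = c * (L t - L s)"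
  using emeasure_\<mu>[OF assms] measure_\<mu>[OF assms]
  by (auto simp: set_integrable_def set_lebesgue_integral_def)

lemma const_int_lborel:
  assumes "s \<le> t" shows "set_integrable lborel {s<..t} (\<lambda>_. c :: real)" "(LINT r:{s<..t}|lborel. c) = (t - s) * c"
  using assms by (auto simp: set_integrable_def set_lebesgue_integral_def intro!: integrable_mult_left integrable_real_indicator)

lemma nn_set_int: "0 \<le> t \<Longrightarrow> set_integrable \<mu> {0..t} nn"
  using nn_int[of t] by (simp add: dL_eq integrable_restrict_space set_integrable_def)

lemma nn_set_AE: "0 \<le> t \<Longrightarrow> AE s in \<mu>. s \<in> {0..t} \<longrightarrow> N s (nn s)"
  using nn_normal[of t, unfolded dL_eq] AE_restrict_space_iff[of "{0..t}" \<mu> "\<lambda>s. N s (nn s)"]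
  by simp

lemma V_eq': "0 \<le> t \<Longrightarrow> V t = - (LINT s:{0..t}|lborel. b s) + (LINT s:{0..t}|\<mu>. nn s)"
  using V_eq[of t] by (simp add: dL_eq integral_restrict_space set_lebesgue_integral_def)

lemma split_integral:
  fixes f :: "real \<Rightarrow> 'v::{banach, second_countable_topology}"
  assumes "0 \<le> s" "s \<le> t" "set_integrable M {0..t} f" "sets M = sets borel"
  shows "(LINT r:{0..t}|M. f r) = (LINT r:{0..s}|M. f r) + (LINT r:{s<..t}|M. f r)"
    and "set_integrable M {s<..t} f"
proof -
  show i: "set_integrable M {s<..t} f"
    by (rule set_integrable_subset[OF assms(3)]) (use assms in auto)
  have "set_integrable M {0..s} f"
    by (rule set_integrable_subset[OF assms(3)]) (use assms in auto)
  then have "(LINT r:{0..s} \<union> {s<..t}|M. f r) = (LINT r:{0..s}|M. f r) + (LINT r:{s<..t}|M. f r)"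
    by (intro set_integral_Un i) auto
  moreover have "{0..s} \<union> {s<..t} = {0..t}" using assms by auto
  ultimately show "(LINT r:{0..t}|M. f r) = (LINT r:{0..s}|M. f r) + (LINT r:{s<..t}|M. f r)" by simp
qed

context
  fixes s t :: real assumes st: "0 \<le> s" "s \<le> t"
begin

lemma V_increment: "V t - V s = - (LINT r:{s<..t}|lborel. b r) + (LINT r:{s<..t}|\<mu>. nn r)"
  using split_integral(1)[OF st b_int] split_integral(1)[OF st nn_set_int] st
  by (simp add: V_eq')

lemma W_increment: "W t - W s = (LINT r:{s<..t}|lborel. norm (b r)) + (L t - L s)"
  using split_integral(1)[OF st set_integrable_norm[OF b_int]] st by (simp add: W_def)

lemma b_int': "set_integrable lborel {s<..t} b"
  using split_integral(2)[OF st b_int] st by simp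

lemma nn_int': "set_integrable \<mu> {s<..t} nn"
  using split_integral(2)[OF st nn_set_int] st by simp

lemma nn_AE': "AE r in \<mu>. r \<in> {s<..t} \<longrightarrow> N r (nn r)"
  using nn_set_AE[of t] st by (auto elim!: eventually_mono)

lemma V_increment_le: "norm (V t - V s) \<le> W t - W s"
proof -
  have "norm (LINT r:{s<..t}|lborel. b r) \<le> (LINT r:{s<..t}|lborel. norm (b r))"
    by (rule set_integral_norm_bound[OF b_int'])
  moreover have "norm (LINT r:{s<..t}|\<mu>. nn r) \<le> L t - L s"
  proof -
    have "norm (LINT r:{s<..t}|\<mu>. nn r) \<le> (LINT r:{s<..t}|\<mu>. norm (nn r))"
      by (rule set_integral_norm_bound[OF nn_int'])
    also have "\<dots> \<le> (LINT r:{s<..t}|\<mu>. 1)"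
      by (rule set_integral_mono_AE[OF set_integrable_norm[OF nn_int'] const_int_\<mu>(1)[OF st]])
        (use nn_AE' in \<open>auto elim!: eventually_mono dest: N_unit\<close>)
    finally show ?thesis by (simp add: const_int_\<mu>(2)[OF st])
  qed
  ultimately show ?thesis
    unfolding V_increment W_increment
    using norm_triangle_ineq[of "- (LINT r:{s<..t}|lborel. b r)" "LINT r:{s<..t}|\<mu>. nn r"] by simp
qed

text \<open>The sign conditions concern \<open>p r\<close> at the running time \<open>r\<close>,
  whereas the convexity estimate supplies one fixed vector \<open>v\<close>. Exchanging them costs
  \<open>\<eta>\<close> times the variation, and \<open>norm (p r)\<close> exceeds
  \<open>norm v\<close> by at most \<open>\<eta>\<close>.\<close>

lemma V_increment_inner_le:
  assumes C: "0 \<le> C" and \<eta>: "0 \<le> \<eta>"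
    and close: "\<And>r. r \<in> {s..t} \<Longrightarrow> norm (v - p r) \<le> \<eta>"
    and drift: "\<And>r. r \<in> {s..t} \<Longrightarrow> b r \<bullet> p r \<le> C * norm (p r)"
    and push: "\<And>r \<nu>. r \<in> {s..t} \<Longrightarrow> N r \<nu> \<Longrightarrow> 0 \<le> \<nu> \<bullet> p r"
  shows "- (v \<bullet> (V t - V s)) \<le> (t - s) * (C * (norm v + \<eta>)) + \<eta> * (W t - W s)"
proof -
  have "(LINT r:{s<..t}|lborel. v \<bullet> b r) \<le> (LINT r:{s<..t}|lborel. C * (norm v + \<eta>) + \<eta> * norm (b r))"
  proof (rule set_integral_mono)
    show "set_integrable lborel {s<..t} (\<lambda>r. v \<bullet> b r)"
      using integrable_inner_right[of v, OF b_int'[unfolded set_integrable_def]]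
      by (simp add: set_integrable_def)
    show "set_integrable lborel {s<..t} (\<lambda>r. C * (norm v + \<eta>) + \<eta> * norm (b r))"
      by (intro set_integral_add set_integrable_mult_right set_integrable_norm b_int' const_int_lborel st)
    fix r assume r: "r \<in> {s<..t}"
    then have r': "r \<in> {s..t}" by auto
    have "v \<bullet> b r = b r \<bullet> p r + (v - p r) \<bullet> b r"
      by (simp add: inner_diff_left inner_commute[of "b r"])
    also have "\<dots> \<le> C * norm (p r) + norm (v - p r) * norm (b r)"
      using drift[OF r'] by (intro add_mono norm_cauchy_schwarz) auto
    also have "\<dots> \<le> C * (norm v + \<eta>) + \<eta> * norm (b r)"
    proof (intro add_mono mult_left_mono mult_right_mono C close[OF r'] norm_ge_zero)
      show "norm (p r) \<le> norm v + \<eta>"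
        using norm_triangle_ineq2[of "p r" v] close[OF r'] by (simp add: norm_minus_commute)
    qed
    finally show "v \<bullet> b r \<le> C * (norm v + \<eta>) + \<eta> * norm (b r)" .
  qed
  also have "\<dots> = (t - s) * (C * (norm v + \<eta>)) + \<eta> * (LINT r:{s<..t}|lborel. norm (b r))"
    using set_integral_add(2)[OF const_int_lborel(1)[OF st(2), of "C * (norm v + \<eta>)"]
        set_integrable_mult_right[OF set_integrable_norm[OF b_int'], of \<eta>]]
    by (simp add: const_int_lborel(2)[OF st(2)])
  finally have 1: "(LINT r:{s<..t}|lborel. v \<bullet> b r) \<le> \<dots>" .
  have "(LINT r:{s<..t}|\<mu>. - (v \<bullet> nn r)) \<le> (LINT r:{s<..t}|\<mu>. \<eta>)"
  proof (rule set_integral_mono_AE[OF _ const_int_\<mu>(1)[OF st]])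
    show "set_integrable \<mu> {s<..t} (\<lambda>r. - (v \<bullet> nn r))"
      using integrable_inner_right[of "- v", OF nn_int'[unfolded set_integrable_def]]
      by (simp add: set_integrable_def)
    show "AE r \<in> {s<..t} in \<mu>. - (v \<bullet> nn r) \<le> \<eta>"
      using nn_AE'
    proof eventually_elim
      case (elim r)
      show ?case
      proof
        assume r: "r \<in> {s<..t}"
        then have N: "N r (nn r)" and r': "r \<in> {s..t}" using elim by auto
        have "- (v \<bullet> nn r) = - (nn r \<bullet> p r) + (p r - v) \<bullet> nn r"
          by (simp add: inner_diff_left inner_commute[of "nn r"])
        also have "\<dots> \<le> 0 + norm (p r - v) * norm (nn r)"
          using push[OF r' N] by (intro add_mono norm_cauchy_schwarz) auto
        also have "\<dots> \<le> \<eta>" using close[OF r'] N_unit[OF N] by (simp add: norm_minus_commute)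
        finally show "- (v \<bullet> nn r) \<le> \<eta>" .
      qed
    qed
  qed
  also have "\<dots> = \<eta> * (L t - L s)" by (rule const_int_\<mu>(2)[OF st])
  finally have 2: "(LINT r:{s<..t}|\<mu>. - (v \<bullet> nn r)) \<le> \<eta> * (L t - L s)" .
  have "v \<bullet> (LINT r:{s<..t}|lborel. b r) = (LINT r:{s<..t}|lborel. v \<bullet> b r)"
    using integral_inner_right[of v, OF b_int'[unfolded set_integrable_def]]
    by (simp add: set_lebesgue_integral_def)
  moreover have "- (v \<bullet> (LINT r:{s<..t}|\<mu>. nn r)) = (LINT r:{s<..t}|\<mu>. - (v \<bullet> nn r))"
    using integral_inner_right[of "- v", OF nn_int'[unfolded set_integrable_def]]
    by (simp add: set_lebesgue_integral_def)
  ultimately have "- (v \<bullet> (V t - V s)) = (LINT r:{s<..t}|lborel. v \<bullet> b r) + (LINT r:{s<..t}|\<mu>. - (v \<bullet> nn r))"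
    unfolding V_increment by (simp add: inner_diff_right)
  then show ?thesis using 1 2 unfolding W_increment by (simp add: distrib_left)
qed

end
end

section \<open>Increments of the potential along a time grid, path by path\<close>

definition dst :: "'v::euclidean_space set \<Rightarrow> 'v \<Rightarrow> 'v \<Rightarrow> real" where
  "dst E h0 x = norm (proj_span E (x - h0))"

definition grid :: "real \<Rightarrow> real \<Rightarrow> nat \<Rightarrow> nat \<Rightarrow> real" where
  "grid s T N k = s + real k * ((T - s) / real N)"

text \<open>How far the finite-variation move from \<open>x + \<beta>\<close> to \<open>y\<close>
  raises the potential above a drift allowance. The part \<open>C / sqrt q\<close> of the allowance
  is the gain of \<open>pot_generator\<close> for \<open>K = 2 * C\<close>; the part
  \<open>C * (2 * C)\<close> ends up in a constant. The allowance is evaluated at the left end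
  \<open>x\<close>, so that it belongs to the past of the Brownian increment.\<close>

definition jump_excess :: "'v::euclidean_space set \<Rightarrow> 'v \<Rightarrow> real \<Rightarrow> real \<Rightarrow> real \<Rightarrow> 'v \<Rightarrow> 'v \<Rightarrow> 'v \<Rightarrow> real" where
  "jump_excess E h0 C e h x y \<beta> =
     max 0 (pot (2 * C) (e + (dst E h0 y)\<^sup>2) - pot (2 * C) (e + (dst E h0 (x + \<beta>))\<^sup>2)
       - (C / sqrt (e + (dst E h0 x)\<^sup>2) + C * (2 * C)) * h)"

text \<open>Only steps with both ends within \<open>r\<close> of \<open>x0\<close> count; on a fine
  grid the path between them stays within \<open>2 * r\<close>, where the drift and reflection
  estimates hold.\<close>

definition excess_sum :: "'v::euclidean_space set \<Rightarrow> 'v \<Rightarrow> real \<Rightarrow> real \<Rightarrow> 'v \<Rightarrow> real \<Rightarrow> real \<Rightarrow> real \<Rightarrow> (real \<Rightarrow> 'v) \<Rightarrow> (real \<Rightarrow> 'v) \<Rightarrow> nat \<Rightarrow> real" where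
  "excess_sum E h0 C e x0 r s T X Y n = (\<Sum>k<n.
      if dist (X (grid s T n k)) x0 < r \<and> dist (X (grid s T n (Suc k))) x0 < r
      then jump_excess E h0 C e ((T - s) / real n) (X (grid s T n k)) (X (grid s T n (Suc k)))
        (Y (grid s T n (Suc k)) - Y (grid s T n k)) else 0)"

lemma dst_nonneg [simp]: "0 \<le> dst E h0 x" by (simp add: dst_def)

lemma dst_lipschitz:
  assumes "orthonormal E" shows "\<bar>dst E h0 x - dst E h0 y\<bar> \<le> norm (x - y)"
proof -
  have "\<bar>dst E h0 x - dst E h0 y\<bar> \<le> norm (proj_span E (x - h0) - proj_span E (y - h0))"
    unfolding dst_def by (rule norm_triangle_ineq3)
  also have "\<dots> = norm (proj_span E (x - y))" by (simp flip: proj_span_diff)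
  also have "\<dots> \<le> norm (x - y)" by (rule norm_proj_span_le[OF assms])
  finally show ?thesis .
qed

text \<open>The function \<open>sqrt (e + x\<^sup>2)\<close> is 1-Lipschitz in \<open>x\<close> and
  at least \<open>sqrt e\<close>. This moves the drift allowance from the right end of a step to its
  left end.\<close>

lemma inverse_sqrt_lipschitz:
  fixes x y e :: real
  assumes e: "0 < e" and xy: "0 \<le> x" "0 \<le> y" "\<bar>x - y\<bar> \<le> \<eta>"
  shows "1 / sqrt (e + y\<^sup>2) \<le> 1 / sqrt (e + x\<^sup>2) + \<eta> / e"
proof -
  define a b where "a = sqrt (e + x\<^sup>2)" and "b = sqrt (e + y\<^sup>2)"
  have pos: "sqrt e \<le> a" "sqrt e \<le> b" "0 < sqrt e" "y \<le> b" "x \<le> a" using e xy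
    by (auto simp: a_def b_def intro!: real_le_rsqrt)
  have "a\<^sup>2 \<le> (b + \<bar>x - y\<bar>)\<^sup>2"
  proof -
    have "y * (x - y) \<le> b * \<bar>x - y\<bar>"
      using pos xy by (metis abs_ge_self abs_ge_zero mult_left_mono mult_right_mono order_trans)
    moreover have "a\<^sup>2 = e + x\<^sup>2" "b\<^sup>2 = e + y\<^sup>2" using e by (auto simp: a_def b_def)
    moreover have "x\<^sup>2 = y\<^sup>2 + 2 * (y * (x - y)) + (x - y)\<^sup>2" by (simp add: power2_eq_square algebra_simps)
    moreover have "(b + \<bar>x - y\<bar>)\<^sup>2 = b\<^sup>2 + 2 * (b * \<bar>x - y\<bar>) + (x - y)\<^sup>2" by (simp add: power2_sum)
    ultimately show ?thesis by linarith
  qed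
  then have "a \<le> b + \<bar>x - y\<bar>" using pos by (auto intro: power2_le_imp_le)
  then have "a - b \<le> \<eta>" using xy by linarith
  have ab: "0 < a" "0 < b" using pos by linarith+
  then have "1 / b - 1 / a = (a - b) / (a * b)" by (simp add: field_simps)
  also have "\<dots> \<le> \<eta> / (a * b)" using \<open>a - b \<le> \<eta>\<close> ab by (intro divide_right_mono) auto
  also have "\<dots> \<le> \<eta> / e"
  proof (rule divide_left_mono)
    have "sqrt e * sqrt e \<le> a * b" using pos ab by (intro mult_mono) auto
    then show "e \<le> a * b" using e by simp
  qed (use ab e xy in \<open>auto intro!: mult_pos_pos\<close>)
  finally show ?thesis by (simp add: a_def b_def)
qed

text \<open>\<open>pot_tangent\<close> at the end point \<open>y\<close>. Since \<open>pot1\<close>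
  is nonpositive, a lower bound for the growth of the squared distance is enough, and the squared
  projection of \<open>d\<close> may be enlarged to the square of \<open>d\<close>.\<close>

lemma pot_increment:
  assumes E: "orthonormal E" and e: "0 < e" and K: "0 \<le> K"
  shows "pot K (e + (dst E h0 y)\<^sup>2) - pot K (e + (dst E h0 (y - d))\<^sup>2)
    \<le> - pot1 K (e + (dst E h0 y)\<^sup>2) * (- 2 * (proj_span E (y - h0) \<bullet> d) + (norm d)\<^sup>2)"
proof -
  define b where "b = e + (dst E h0 y)\<^sup>2"
  define a where "a = e + (dst E h0 (y - d))\<^sup>2"
  have pos: "0 < a" "0 < b" using e by (auto simp: a_def b_def intro: add_pos_nonneg)
  have "(norm (proj_span E (y - h0 + - d)))\<^sup>2 = (norm (proj_span E (y - h0)))\<^sup>2 + (2 * (proj_span E (y - h0) \<bullet> - d) + (norm (proj_span E (- d)))\<^sup>2)"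
    by (rule norm_proj_span_add_square[OF E])
  moreover have "(norm (proj_span E (- d)))\<^sup>2 \<le> (norm d)\<^sup>2"
    using norm_proj_span_le[OF E, of "- d"] by (intro power_mono) auto
  moreover have "dst E h0 (y - d) = norm (proj_span E (y - h0 + - d))"
    unfolding dst_def by (rule arg_cong[where f = "\<lambda>x. norm (proj_span E x)"]) simp
  ultimately have "- (b - a) \<le> - 2 * (proj_span E (y - h0) \<bullet> d) + (norm d)\<^sup>2"
    unfolding a_def b_def dst_def[of E h0 y] by simp
  then have "- pot1 K b * - (b - a) \<le> - pot1 K b * (- 2 * (proj_span E (y - h0) \<bullet> d) + (norm d)\<^sup>2)"
    using pot1_nonpos[OF pos(2) K] by (intro mult_left_mono) auto
  moreover have "pot K b - pot K a \<le> pot1 K b * (b - a)" by (rule pot_tangent[OF pos K])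
  moreover have "- pot1 K b * - (b - a) = pot1 K b * (b - a)" by (simp add: algebra_simps)
  ultimately show ?thesis unfolding a_def[symmetric] b_def[symmetric] by linarith
qed

context bv_path
begin

text \<open>The bound is \<open>\<eta>\<close> times a quantity additive over adjacent intervals,
  which makes the sum over a grid small. The 3 consists of 2 from the doubled inner product and 1
  from the squared increment, estimated by \<open>\<eta>\<close> times the variation.\<close>

lemma jump_excess_le:
  assumes st: "0 \<le> s" "s \<le> t" and E: "orthonormal E" and e: "0 < e" and C: "0 \<le> C" and \<eta>: "0 \<le> \<eta>"
    and close: "\<And>r. r \<in> {s..t} \<Longrightarrow> norm (X t - X r) \<le> \<eta>"
    and V\<eta>: "norm (V t - V s) \<le> \<eta>" and V: "V t - V s = X t - X s - \<beta>"
    and drift: "\<And>r. r \<in> {s..t} \<Longrightarrow> b r \<bullet> proj_span E (X r - h0) \<le> C * dst E h0 (X r)"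
    and push: "\<And>r \<nu>. r \<in> {s..t} \<Longrightarrow> N r \<nu> \<Longrightarrow> 0 \<le> \<nu> \<bullet> proj_span E (X r - h0)"
  shows "jump_excess E h0 C e (t - s) (X s) (X t) \<beta>
    \<le> \<eta> * ((C / e + - pot1 (2 * C) e * (2 * C)) * (t - s) + - pot1 (2 * C) e * 3 * (W t - W s))"
proof -
  define p where "p r = proj_span E (X r - h0)" for r
  define u where "u = e + (dst E h0 (X t))\<^sup>2"
  define c where "c = - pot1 (2 * C) e"
  define w where "w = W t - W s"
  have up: "0 < u" "e \<le> u" using e by (auto simp: u_def intro: add_pos_nonneg)
  have w: "norm (V t - V s) \<le> w" unfolding w_def by (rule V_increment_le[OF st])
  then have w0: "0 \<le> w" using norm_ge_zero order_trans by blast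
  have c: "0 \<le> - pot1 (2 * C) u" "- pot1 (2 * C) u \<le> c" "0 \<le> c"
    using pot1_bound[OF e up(2), of "2 * C"] pot1_nonpos[OF up(1), of "2 * C"] C by (auto simp: c_def)
  have pclose: "norm (p t - p r) \<le> \<eta>" if "r \<in> {s..t}" for r
  proof -
    have "norm (p t - p r) \<le> norm (X t - X r)"
      using norm_proj_span_le[OF E, of "X t - X r"] by (simp add: p_def flip: proj_span_diff)
    with close[OF that] show ?thesis by simp
  qed
  have "- (p t \<bullet> (V t - V s)) \<le> (t - s) * (C * (norm (p t) + \<eta>)) + \<eta> * (W t - W s)"
    by (rule V_increment_inner_le[OF st C \<eta>, where p = p])
      (use pclose drift push in \<open>auto simp: p_def dst_def\<close>)
  moreover have "(norm (V t - V s))\<^sup>2 \<le> \<eta> * w"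
    unfolding power2_eq_square using w V\<eta> \<eta> by (intro mult_mono) auto
  ultimately have le: "- 2 * (p t \<bullet> (V t - V s)) + (norm (V t - V s))\<^sup>2 \<le>
      2 * C * (t - s) * norm (p t) + (2 * C * (t - s) * \<eta> + 3 * \<eta> * w)"
    by (simp add: w_def algebra_simps)
  have "X t - (V t - V s) = X s + \<beta>" using V by simp
  then have "pot (2 * C) u - pot (2 * C) (e + (dst E h0 (X s + \<beta>))\<^sup>2)
     \<le> - pot1 (2 * C) u * (- 2 * (p t \<bullet> (V t - V s)) + (norm (V t - V s))\<^sup>2)"
    using pot_increment[OF E e, of "2 * C" h0 "X t" "V t - V s"] C by (simp add: u_def p_def)
  also have "\<dots> \<le> - pot1 (2 * C) u * (2 * C * (t - s) * norm (p t) + (2 * C * (t - s) * \<eta> + 3 * \<eta> * w))"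
    using le c by (intro mult_left_mono) auto
  also have "\<dots> = C * (t - s) * (- pot1 (2 * C) u * (2 * norm (p t))) + - pot1 (2 * C) u * (2 * C * (t - s) * \<eta> + 3 * \<eta> * w)"
    by (simp add: algebra_simps)
  also have "\<dots> \<le> C * (t - s) * ((1 / sqrt (e + (dst E h0 (X s))\<^sup>2) + \<eta> / e) + 2 * C) + c * (2 * C * (t - s) * \<eta> + 3 * \<eta> * w)"
  proof (intro add_mono mult_left_mono mult_right_mono c)
    have pu: "norm (p t) \<le> sqrt u" unfolding u_def p_def dst_def using e by (intro real_le_rsqrt) auto
    have su: "0 < sqrt u" "sqrt u * sqrt u = u" using up by auto
    \<comment> \<open>The logarithm gives the singular part of the allowance, at most
      \<open>1 / sqrt u\<close>; the root gives a bounded part.\<close>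
    have "- pot1 (2 * C) u * (2 * norm (p t)) = norm (p t) / u + 2 * C * (norm (p t) / sqrt u)"
      using up by (simp add: pot1_def field_simps)
    also have "\<dots> \<le> 1 / sqrt u + 2 * C * 1"
    proof (intro add_mono mult_left_mono)
      have "norm (p t) / u \<le> sqrt u / u" using pu up by (intro divide_right_mono) auto
      also have "\<dots> = 1 / sqrt u" using su by (simp add: field_simps)
      finally show "norm (p t) / u \<le> 1 / sqrt u" .
    qed (use pu su C in auto)
    also have "1 / sqrt u \<le> 1 / sqrt (e + (dst E h0 (X s))\<^sup>2) + \<eta> / e"
      unfolding u_def
      by (rule inverse_sqrt_lipschitz[OF e])
        (use dst_lipschitz[OF E, of h0 "X t" "X s"] close[of s] st in \<open>auto simp: abs_minus_commute\<close>)
    finally show "- pot1 (2 * C) u * (2 * norm (p t)) \<le> 1 / sqrt (e + (dst E h0 (X s))\<^sup>2) + \<eta> / e + 2 * C" by simp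
  qed (use st C w0 \<eta> in auto)
  also have "\<dots> = (C / sqrt (e + (dst E h0 (X s))\<^sup>2) + C * (2 * C)) * (t - s)
      + \<eta> * ((C / e + c * (2 * C)) * (t - s) + c * 3 * w)"
    by (simp add: algebra_simps diff_divide_distrib)
  finally have "pot (2 * C) u - pot (2 * C) (e + (dst E h0 (X s + \<beta>))\<^sup>2)
       - (C / sqrt (e + (dst E h0 (X s))\<^sup>2) + C * (2 * C)) * (t - s)
       \<le> \<eta> * ((C / e + c * (2 * C)) * (t - s) + c * 3 * w)" by simp
  moreover have "0 \<le> \<eta> * ((C / e + c * (2 * C)) * (t - s) + c * 3 * w)"
    using \<eta> c C e st w0 by simp
  ultimately show ?thesis
    unfolding jump_excess_def u_def[symmetric] c_def[symmetric] w_def[symmetric] by simp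
qed

text \<open>Summing \<open>jump_excess_le\<close> telescopes to \<open>\<eta> * c\<close>, where
  \<open>c\<close> depends on the variation over the whole interval only, and uniform continuity
  makes \<open>\<eta>\<close> arbitrarily small.\<close>

lemma jump_excess_sum_tendsto_0:
  assumes sT: "0 \<le> s" "s < T" and E: "orthonormal E" and e: "0 < e" and C: "0 \<le> C" and r: "0 < r"
    and X: "continuous_on {0..} X" and Y: "continuous_on {0..} Y"
    and V: "\<And>t. 0 \<le> t \<Longrightarrow> V t = X t - X 0 - Y t"
    and drift: "\<And>t. 0 \<le> t \<Longrightarrow> dist (X t) x0 < 2 * r \<Longrightarrow> b t \<bullet> proj_span E (X t - h0) \<le> C * dst E h0 (X t)"
    and push: "\<And>t \<nu>. 0 \<le> t \<Longrightarrow> dist (X t) x0 < 2 * r \<Longrightarrow> N t \<nu> \<Longrightarrow> 0 \<le> \<nu> \<bullet> proj_span E (X t - h0)"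
  shows "excess_sum E h0 C e x0 r s T X Y \<longlonglongrightarrow> 0"
proof (rule LIMSEQ_I)
  fix \<epsilon> :: real assume \<epsilon>: "0 < \<epsilon>"
  define c1 where "c1 = C / e + - pot1 (2 * C) e * (2 * C)"
  define c2 where "c2 = - pot1 (2 * C) e * 3"
  define c where "c = c1 * (T - s) + c2 * (W T - W s)"
  have "0 \<le> - pot1 (2 * C) e" using C pot1_nonpos[OF e, of "2 * C"] by simp
  then have c12: "0 \<le> c1" "0 \<le> c2"
    unfolding c1_def c2_def using C e by (blast intro: add_nonneg_nonneg mult_nonneg_nonneg divide_nonneg_nonneg zero_le_numeral less_imp_le)+
  have WsT: "0 \<le> W T - W s" using V_increment_le[of s T] norm_ge_zero order_trans sT by (meson less_imp_le)
  have c0: "0 \<le> c" using c12 WsT sT by (simp add: c_def)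
  \<comment> \<open>At most \<open>r\<close>, so that a step starting within \<open>r\<close> of
    \<open>x0\<close> stays within \<open>2 * r\<close>.\<close>
  define \<eta> where "\<eta> = min r (\<epsilon> / (2 * (1 + c)))"
  have \<eta>: "0 < \<eta>" "\<eta> \<le> r" "\<eta> * c < \<epsilon>"
  proof -
    show "0 < \<eta>" "\<eta> \<le> r" using r \<epsilon> c0 by (auto simp: \<eta>_def)
    have "\<eta> * c \<le> \<epsilon> / (2 * (1 + c)) * (1 + c)" using c0 \<epsilon> by (intro mult_mono) (auto simp: \<eta>_def)
    also have "\<dots> = \<epsilon> / 2"
    proof -
      have "1 + c \<noteq> 0" using c0 by simp
      then show ?thesis by (metis mult.commute nonzero_mult_divide_mult_cancel_right times_divide_eq_right)
    qed
    finally show "\<eta> * c < \<epsilon>" using \<epsilon> by simp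
  qed
  have "uniformly_continuous_on {s..T} X"
    by (rule compact_uniformly_continuous[OF continuous_on_subset[OF X]]) (use sT in auto)
  then obtain d1 where d1: "0 < d1" "\<And>x y. x \<in> {s..T} \<Longrightarrow> y \<in> {s..T} \<Longrightarrow> dist y x < d1 \<Longrightarrow> dist (X y) (X x) < \<eta>"
    unfolding uniformly_continuous_on_def using \<eta>(1) by metis
  \<comment> \<open>\<open>X - Y\<close> differs from \<open>V\<close> by a constant, so this
    controls the increments of \<open>V\<close>.\<close>
  have "uniformly_continuous_on {s..T} (\<lambda>t. X t - Y t)"
    by (rule compact_uniformly_continuous[OF continuous_on_diff[OF continuous_on_subset[OF X] continuous_on_subset[OF Y]]])
      (use sT in auto)
  then obtain d2 where d2: "0 < d2" "\<And>x y. x \<in> {s..T} \<Longrightarrow> y \<in> {s..T} \<Longrightarrow> dist y x < d2 \<Longrightarrow> dist (X y - Y y) (X x - Y x) < \<eta>"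
    unfolding uniformly_continuous_on_def using \<eta>(1) by metis
  obtain n0 :: nat where n0: "(T - s) / min d1 d2 < real n0" using reals_Archimedean2 by blast
  show "\<exists>no. \<forall>n\<ge>no. norm (excess_sum E h0 C e x0 r s T X Y n - 0) < \<epsilon>"
  proof (intro exI[of _ "max 1 n0"] allI impI)
    fix n assume n: "max 1 n0 \<le> n"
    define t where "t = grid s T n"
    define h where "h = (T - s) / real n"
    have n1: "0 < real n" using n by simp
    have h: "0 < h" "h < d1" "h < d2"
    proof -
      show "0 < h" using n1 sT by (simp add: h_def)
      have "0 < min d1 d2" using d1(1) d2(1) by simp
      then have "T - s < real n0 * min d1 d2" using n0 by (simp add: pos_divide_less_eq)
      also have "\<dots> \<le> real n * min d1 d2" using n d1(1) d2(1) by (intro mult_right_mono) auto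
      finally have "h < min d1 d2" unfolding h_def pos_divide_less_eq[OF n1] by (simp only: mult.commute)
      then show "h < d1" "h < d2" by auto
    qed
    have tS: "t (Suc k) - t k = h" for k by (simp add: t_def grid_def h_def distrib_right add_divide_distrib)
    have tin: "t k \<in> {s..T}" if "k \<le> n" for k
    proof -
      have "real k * h \<le> real n * h" using that h by (intro mult_right_mono) auto
      also have "\<dots> = T - s" using n1 by (simp add: h_def)
      finally show ?thesis using h by (simp add: t_def grid_def h_def[symmetric])
    qed
    define f where "f k = (if dist (X (t k)) x0 < r \<and> dist (X (t (Suc k))) x0 < r
      then jump_excess E h0 C e h (X (t k)) (X (t (Suc k))) (Y (t (Suc k)) - Y (t k)) else 0)" for k
    have f0: "0 \<le> f k" for k by (simp add: f_def jump_excess_def)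
    have fle: "f k \<le> \<eta> * (c1 * h + c2 * (W (t (Suc k)) - W (t k)))" if k: "k < n" for k
    proof -
      have tk: "t k \<in> {s..T}" "t (Suc k) \<in> {s..T}" using tin k by auto
      then have t0: "0 \<le> t k" "t k \<le> t (Suc k)" using sT tS[of k] h by auto
      have sub: "u \<in> {s..T}" "0 \<le> u" "dist u (t k) < d1" "dist u (t (Suc k)) < d1" if "u \<in> {t k..t (Suc k)}" for u
        using that tk tS[of k] h sT by (auto simp: dist_real_def)
      show ?thesis
      proof (cases "dist (X (t k)) x0 < r \<and> dist (X (t (Suc k))) x0 < r")
        case True
        have near: "dist (X u) x0 < 2 * r" if "u \<in> {t k..t (Suc k)}" for u
          using d1(2)[OF tk(1) sub(1)[OF that] sub(3)[OF that]] True \<eta>(2) dist_triangle[of "X u" x0 "X (t k)"] by linarith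
        have Vd: "V (t (Suc k)) - V (t k) = X (t (Suc k)) - X (t k) - (Y (t (Suc k)) - Y (t k))"
          using V t0 by simp
        have "jump_excess E h0 C e (t (Suc k) - t k) (X (t k)) (X (t (Suc k))) (Y (t (Suc k)) - Y (t k))
          \<le> \<eta> * ((C / e + - pot1 (2 * C) e * (2 * C)) * (t (Suc k) - t k) + - pot1 (2 * C) e * 3 * (W (t (Suc k)) - W (t k)))"
        proof (rule jump_excess_le[OF t0 E e C _ _ _ Vd])
          show "norm (V (t (Suc k)) - V (t k)) \<le> \<eta>"
          proof -
            have "V (t (Suc k)) - V (t k) = (X (t (Suc k)) - Y (t (Suc k))) - (X (t k) - Y (t k))"
              by (simp add: Vd)
            then show ?thesis
              using d2(2)[OF tk] tS[of k] h by (simp add: dist_norm dist_real_def)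
          qed
          show "norm (X (t (Suc k)) - X u) \<le> \<eta>" if "u \<in> {t k..t (Suc k)}" for u
            using d1(2)[OF tk(2) sub(1)[OF that] sub(4)[OF that]] by (simp add: dist_norm norm_minus_commute)
          show "b u \<bullet> proj_span E (X u - h0) \<le> C * dst E h0 (X u)" if "u \<in> {t k..t (Suc k)}" for u
            using drift sub near that by blast
          show "0 \<le> \<nu> \<bullet> proj_span E (X u - h0)" if "u \<in> {t k..t (Suc k)}" "N u \<nu>" for u \<nu>
            using push sub near that by blast
        qed (use \<eta> in simp)
        then show ?thesis using True by (simp add: f_def tS c1_def c2_def)
      next
        case False
        have "0 \<le> W (t (Suc k)) - W (t k)"
          using V_increment_le[OF t0] norm_ge_zero order_trans by blast
        then have "0 \<le> \<eta> * (c1 * h + c2 * (W (t (Suc k)) - W (t k)))"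
          using \<eta> c12 h by (intro mult_nonneg_nonneg add_nonneg_nonneg) auto
        then show ?thesis using False by (auto simp: f_def)
      qed
    qed
    have "(\<Sum>k<n. f k) \<le> (\<Sum>k<n. \<eta> * (c1 * h + c2 * (W (t (Suc k)) - W (t k))))"
      by (intro sum_mono fle) auto
    also have "\<dots> = \<eta> * (c1 * (real n * h) + c2 * (\<Sum>k<n. W (t (Suc k)) - W (t k)))"
      by (simp add: sum_distrib_left[symmetric] sum.distrib mult.left_commute)
    also have "(\<Sum>k<n. W (t (Suc k)) - W (t k)) = W (t n) - W (t 0)"
      by (rule sum_lessThan_telescope)
    also have "W (t n) - W (t 0) = W T - W s" using n1 by (simp add: t_def grid_def)
    also have "\<eta> * (c1 * (real n * h) + c2 * (W T - W s)) = \<eta> * c"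
      using n1 by (simp add: c_def h_def)
    finally have "(\<Sum>k<n. f k) < \<epsilon>" using \<eta>(3) by simp
    moreover have "0 \<le> (\<Sum>k<n. f k)" by (intro sum_nonneg f0)
    ultimately show "norm (excess_sum E h0 C e x0 r s T X Y n - 0) < \<epsilon>"
      unfolding f_def t_def h_def excess_sum_def by simp
  qed
qed

end

section \<open>Discrete supermartingale argument near an edge\<close>

text \<open>\<open>g\<close> is the value at grid points, \<open>g'\<close> the value after the
  Brownian half of a step. Switching off the summands once \<open>act\<close> fails freezes the sum
  at the exit value; if the exit also breaks \<open>good\<close>, only the Brownian half of the last
  step is kept.\<close>

lemma stopped_telescope:
  fixes D J g g' :: "nat \<Rightarrow> real"
  assumes step: "\<And>k. act (Suc k) \<Longrightarrow> act k" "\<And>k. act k \<Longrightarrow> good k"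
    and D: "\<And>k. D k = g' k - g k" and J: "\<And>k. J k = g (Suc k) - g' k"
    and start: "act 0"
  defines "S \<equiv> \<lambda>n. g 0 + (\<Sum>k<n. if act k then D k + (if good (Suc k) then J k else 0) else 0)"
  shows "act n \<Longrightarrow> S n = g n"
    and "\<not> act n \<Longrightarrow> \<exists>m<n. act m \<and> \<not> act (Suc m) \<and> S n = (if good (Suc m) then g (Suc m) else g' m)"
proof -
  have *: "(act n \<longrightarrow> S n = g n) \<and>
    (\<not> act n \<longrightarrow> (\<exists>m<n. act m \<and> \<not> act (Suc m) \<and> S n = (if good (Suc m) then g (Suc m) else g' m)))"
  proof (induction n)
    case 0 show ?case using start by (simp add: S_def)
  next
    case (Suc n)
    have S: "S (Suc n) = S n + (if act n then D n + (if good (Suc n) then J n else 0) else 0)"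
      by (simp add: S_def)
    show ?case
    proof (cases "act n")
      case True
      then have "S (Suc n) = (if good (Suc n) then g (Suc n) else g' n)"
        using Suc S by (simp add: D J)
      then show ?thesis using True step(2) by auto
    next
      case False
      then show ?thesis using Suc S step(1) by (auto intro: less_SucI)
    qed
  qed
  show "act n \<Longrightarrow> S n = g n"
    "\<not> act n \<Longrightarrow> \<exists>m<n. act m \<and> \<not> act (Suc m) \<and> S n = (if good (Suc m) then g (Suc m) else g' m)"
    using * by auto
qed

text \<open>A summand requires \<open>good\<close> at the next index, so the increment that would
  exceed the budget \<open>\<kappa>\<close> is never counted.\<close>

lemma stopped_sum_le:
  fixes v :: "nat \<Rightarrow> real"
  assumes "\<And>k. good (Suc k) \<Longrightarrow> good k" "\<And>k. good k \<Longrightarrow> (\<Sum>j<k. v j) \<le> \<kappa>" "0 \<le> \<kappa>"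
  shows "(\<Sum>k<n. if good (Suc k) then v k else 0) \<le> \<kappa>"
proof (induction n)
  case (Suc n)
  show ?case
  proof (cases "good (Suc n)")
    case True
    have "good (Suc k)" if "k < Suc n" for k
    proof -
      have "Suc k \<le> Suc n" using that by simp
      then show ?thesis by (rule inc_induct) (use True assms(1) in auto)
    qed
    then have "(\<Sum>k<Suc n. if good (Suc k) then v k else 0) = (\<Sum>k<Suc n. v k)"
      by (intro sum.cong) auto
    then show ?thesis using assms(2)[OF True] by simp
  next
    case False then show ?thesis using Suc by simp
  qed
qed (use assms in simp)

text \<open>The equation enters through \<open>jump_limit\<close> alone; beyond it the argument
  works with an adapted continuous process and Brownian increments.\<close>

locale corner = filtered_brownian M F B
  for M :: "'a measure" and F :: "real \<Rightarrow> 'a measure" and B :: "real \<Rightarrow> 'a \<Rightarrow> real ^ 'd" +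
  fixes X :: "real \<Rightarrow> 'a \<Rightarrow> real ^ 'd" and E :: "(real ^ 'd) set" and h0 x0 :: "real ^ 'd" and r C :: real
  assumes X_adapted: "\<And>t. 0 \<le> t \<Longrightarrow> X t \<in> borel_measurable (F t)"
    and X_cont: "\<And>\<omega>. \<omega> \<in> space M \<Longrightarrow> continuous_on {0..} (\<lambda>t. X t \<omega>)"
    and E: "orthonormal E" "2 \<le> card E" and r: "0 < r" and C: "0 \<le> C"
    and jump_limit: "\<And>s T e. 0 \<le> s \<Longrightarrow> s < T \<Longrightarrow> 0 < e \<Longrightarrow> AE \<omega> in M.
      excess_sum E h0 C e x0 r s T (\<lambda>t. X t \<omega>) (\<lambda>t. B t \<omega>) \<longlonglongrightarrow> 0"
begin

text \<open>With this choice \<open>K / (2 * sqrt q)\<close> equals \<open>C / sqrt q\<close> and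
  cancels the singular part of the drift allowance.\<close>

abbreviation "K \<equiv> 2 * C"
definition "q e x = e + (dst E h0 x)\<^sup>2"
definition "R = r + norm (x0 - h0)"

lemma K: "0 \<le> K" using C by simp
lemma R: "0 \<le> R" using r by (simp add: R_def)

lemma dst_le_R: "dist x x0 < r \<Longrightarrow> dst E h0 x \<le> R"
  using norm_proj_span_le[OF E(1), of "x - h0"] norm_triangle_ineq[of "x - x0" "x0 - h0"]
  by (simp add: dst_def R_def dist_norm)

lemma q_ge: "e \<le> q e x" by (simp add: q_def)

end

text \<open>The length bound gives mesh size at most 1 and constants free of \<open>T - s\<close>;
  \<open>\<kappa>\<close> is a cutoff for the variation seen on the grid.\<close>

locale corner_grid = corner M F B X E h0 x0 r C
  for M :: "'a measure" and F and B :: "real \<Rightarrow> 'a \<Rightarrow> real ^ 'd" and X E h0 x0 r C +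
  fixes s T \<kappa> :: real
  assumes sT: "0 \<le> s" "s < T" "T \<le> s + 1" and \<kappa>: "0 \<le> \<kappa>"
begin

abbreviation "t \<equiv> grid s T"
abbreviation "Z n k \<omega> \<equiv> X (t n k) \<omega>"
definition "\<beta> n k \<omega> = B (t n (Suc k)) \<omega> - B (t n k) \<omega>"
text \<open>The size of the combined drift and reflection increment, written through
  \<open>X\<close> and \<open>B\<close> so that it is adapted.\<close>

definition "v n k \<omega> = norm (Z n (Suc k) \<omega> - Z n k \<omega> - \<beta> n k \<omega>)"
text \<open>Both conditions involve grid times up to \<open>k\<close> only, so this is an event of
  the past. The cutoff \<open>\<kappa>\<close> supplies the dominating constant when the excesses
  tend to 0.\<close>

definition "good n k \<omega> \<longleftrightarrow> (\<forall>j\<le>k. dist (Z n j \<omega>) x0 < r) \<and> (\<Sum>j<k. v n j \<omega>) \<le> \<kappa>"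
text \<open>The condition for executing step \<open>k\<close>. For \<open>\<delta> = 0\<close> and
  \<open>\<epsilon> = - 1\<close> both distance conditions hold automatically, the form that
  \<open>no_stay\<close> uses.\<close>

definition "act \<delta> \<epsilon> n k \<omega> \<longleftrightarrow> good n k \<omega> \<and> \<delta> \<le> dst E h0 (Z n 0 \<omega>) \<and> (\<forall>j\<le>k. \<epsilon> < dst E h0 (Z n j \<omega>))"
abbreviation act_ind :: "real \<Rightarrow> real \<Rightarrow> nat \<Rightarrow> nat \<Rightarrow> 'a \<Rightarrow> real" where
  "act_ind \<delta> \<epsilon> n k \<omega> \<equiv> indicator {\<omega>. act \<delta> \<epsilon> n k \<omega>} \<omega>"
definition "hit \<delta> \<epsilon> n \<omega> \<longleftrightarrow> good n n \<omega> \<and> \<delta> \<le> dst E h0 (Z n 0 \<omega>) \<and> (\<exists>j\<le>n. dst E h0 (Z n j \<omega>) \<le> \<epsilon>)"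
text \<open>A grid step is split at the point reached by the Brownian increment alone:
  \<open>Dm\<close> leads to it, \<open>Jm\<close> leads on from it. That point may lie outside the
  domain, which is harmless because the potential is defined on the whole space.\<close>

definition "Jm e n k \<omega> = pot K (q e (Z n (Suc k) \<omega>)) - pot K (q e (Z n k \<omega> + \<beta> n k \<omega>))"
definition "Dm e n k \<omega> = pot K (q e (Z n k \<omega> + \<beta> n k \<omega>)) - pot K (q e (Z n k \<omega>))"
text \<open>Requiring \<open>good\<close> at the next index puts both ends in the ball and keeps the
  increment within the budget \<open>\<kappa>\<close>.\<close>

definition "exc e n k \<omega> = (if good n (Suc k) \<omega> then jump_excess E h0 C e ((T - s) / real n) (Z n k \<omega>) (Z n (Suc k) \<omega>) (\<beta> n k \<omega>) else 0)"

lemma v_nonneg: "0 \<le> v n k \<omega>" by (simp add: v_def)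

lemma good_Suc: "good n (Suc k) \<omega> \<Longrightarrow> good n k \<omega>"
  using v_nonneg[of n k \<omega>] unfolding good_def by (auto intro: order_trans[rotated])

lemma good_mono: "j \<le> k \<Longrightarrow> good n k \<omega> \<Longrightarrow> good n j \<omega>"
  by (induction rule: inc_induct) (use good_Suc in auto)

lemma act_Suc: "act \<delta> \<epsilon> n (Suc k) \<omega> \<Longrightarrow> act \<delta> \<epsilon> n k \<omega>"
  using good_Suc unfolding act_def by auto

lemma act_good: "act \<delta> \<epsilon> n k \<omega> \<Longrightarrow> good n k \<omega>" by (simp add: act_def)

lemma good_near: "good n k \<omega> \<Longrightarrow> j \<le> k \<Longrightarrow> dst E h0 (Z n j \<omega>) \<le> R"
  by (rule dst_le_R) (auto simp: good_def)

lemma t_nonneg: "0 \<le> t n k"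
  using sT by (simp add: grid_def)

lemma t_mono: "j \<le> k \<Longrightarrow> t n j \<le> t n k"
  unfolding grid_def by (intro add_left_mono mult_right_mono divide_nonneg_nonneg) (use sT in auto)

lemma t_Suc: "t n (Suc k) = t n k + (T - s) / real n"
  by (simp add: grid_def distrib_right add_divide_distrib)

lemma Z_measurable_F: "j \<le> k \<Longrightarrow> Z n j \<in> borel_measurable (F (t n k))"
  by (rule measurable_F_mono[OF X_adapted[OF t_nonneg] t_mono])

lemma B_measurable_F': "j \<le> k \<Longrightarrow> B (t n j) \<in> borel_measurable (F (t n k))"
  by (rule measurable_F_mono[OF B_measurable_F[OF t_nonneg] t_mono])

lemma dst_measurable [measurable]: "dst E h0 \<in> borel_measurable borel"
  unfolding dst_def[abs_def]
  by (intro borel_measurable_continuous_onI continuous_intros)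

lemma v_measurable_F: "j < k \<Longrightarrow> v n j \<in> borel_measurable (F (t n k))"
proof -
  assume "j < k"
  then have [measurable]: "Z n j \<in> borel_measurable (F (t n k))" "Z n (Suc j) \<in> borel_measurable (F (t n k))"
    "B (t n j) \<in> borel_measurable (F (t n k))" "B (t n (Suc j)) \<in> borel_measurable (F (t n k))"
    by (intro Z_measurable_F B_measurable_F'; simp)+
  show ?thesis unfolding v_def[abs_def] \<beta>_def by measurable
qed

lemma good_measurable_F: "{\<omega> \<in> space M. good n k \<omega>} \<in> sets (F (t n k))"
proof -
  have [measurable]: "\<And>j. j \<le> k \<Longrightarrow> Z n j \<in> borel_measurable (F (t n k))"
    "\<And>j. j < k \<Longrightarrow> v n j \<in> borel_measurable (F (t n k))"
    by (rule Z_measurable_F v_measurable_F; simp)+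
  have 1: "{\<omega> \<in> space (F (t n k)). dist (Z n j \<omega>) x0 < r} \<in> sets (F (t n k))" if "j \<le> k" for j
    using that by measurable
  have "(\<lambda>\<omega>. \<Sum>j<k. v n j \<omega>) \<in> borel_measurable (F (t n k))"
    by (intro borel_measurable_sum v_measurable_F) auto
  then have 2: "{\<omega> \<in> space (F (t n k)). (\<Sum>j<k. v n j \<omega>) \<le> \<kappa>} \<in> sets (F (t n k))"
    by measurable
  have "{\<omega> \<in> space M. good n k \<omega>} =
     (\<Inter>j\<in>{..k}. {\<omega> \<in> space (F (t n k)). dist (Z n j \<omega>) x0 < r}) \<inter> {\<omega> \<in> space (F (t n k)). (\<Sum>j<k. v n j \<omega>) \<le> \<kappa>}"
    by (auto simp: good_def)
  also have "\<dots> \<in> sets (F (t n k))"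
    by (intro sets.Int sets.finite_INT 2) (use 1 in auto)
  finally show ?thesis .
qed

lemma act_measurable_F: "{\<omega> \<in> space M. act \<delta> \<epsilon> n k \<omega>} \<in> sets (F (t n k))"
proof -
  have m: "(\<lambda>\<omega>. dst E h0 (Z n j \<omega>)) \<in> borel_measurable (F (t n k))" if "j \<le> k" for j
    by (rule measurable_compose[OF Z_measurable_F[OF that] dst_measurable])
  have 1: "{\<omega> \<in> space (F (t n k)). \<epsilon> < dst E h0 (Z n j \<omega>)} \<in> sets (F (t n k))"
      "{\<omega> \<in> space (F (t n k)). \<delta> \<le> dst E h0 (Z n j \<omega>)} \<in> sets (F (t n k))" if "j \<le> k" for j
    using m[OF that] by measurable
  have "{\<omega> \<in> space M. act \<delta> \<epsilon> n k \<omega>} = {\<omega> \<in> space M. good n k \<omega>} \<inter>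
     {\<omega> \<in> space (F (t n k)). \<delta> \<le> dst E h0 (Z n 0 \<omega>)} \<inter>
     (\<Inter>j\<in>{..k}. {\<omega> \<in> space (F (t n k)). \<epsilon> < dst E h0 (Z n j \<omega>)})"
    by (auto simp: act_def)
  also have "\<dots> \<in> sets (F (t n k))"
    by (intro sets.Int sets.finite_INT good_measurable_F) (use 1 in auto)
  finally show ?thesis .
qed

lemma measurable_M [measurable]:
  "Z n k \<in> borel_measurable M" "\<beta> n k \<in> borel_measurable M" "v n k \<in> borel_measurable M"
  "Measurable.pred M (good n k)" "Measurable.pred M (act \<delta> \<epsilon> n k)"
proof -
  show z [measurable]: "Z n k \<in> borel_measurable M" for k by (rule measurable_F_M[OF Z_measurable_F[OF order_refl]])
  have [measurable]: "B (t n k) \<in> borel_measurable M" for k by (rule measurable_F_M[OF B_measurable_F'[OF order_refl]])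
  show b [measurable]: "\<beta> n k \<in> borel_measurable M" unfolding \<beta>_def[abs_def] by measurable
  show "v n k \<in> borel_measurable M" unfolding v_def[abs_def] by measurable
  show "Measurable.pred M (good n k)" "Measurable.pred M (act \<delta> \<epsilon> n k)"
    using good_measurable_F act_measurable_F sets_F_subset unfolding pred_def by blast+
qed

lemma hit_measurable [measurable]: "Measurable.pred M (hit \<delta> \<epsilon> n)"
  unfolding hit_def[abs_def] by measurable

lemma q_measurable [measurable]: "q e \<in> borel_measurable borel"
  unfolding q_def[abs_def] by measurable

lemma pot_measurable [measurable]: "pot K \<in> borel_measurable borel"
  unfolding pot_def[abs_def] by measurable

lemma exc_measurable [measurable]: "exc e n k \<in> borel_measurable M"
  unfolding exc_def[abs_def] jump_excess_def by measurable

lemma pot_antimono: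
  assumes "0 < a" "a \<le> b" shows "pot K b \<le> pot K a"
proof -
  have "ln a \<le> ln b" "K * sqrt a \<le> K * sqrt b" using assms C by (auto intro!: mult_left_mono)
  then show ?thesis by (simp add: pot_def)
qed

text \<open>The exit index depends on the path, so the Brownian increment at exit is bounded by the
  sum over all steps, whose mean is the same for every grid.\<close>

lemma norm_beta_square: 
  assumes n: "0 < n"
  shows "has_bochner_integral M (\<lambda>\<omega>. \<Sum>k<n. (norm (\<beta> n k \<omega>))\<^sup>2) (CARD('d) * (T - s))"
proof -
  have h: "0 < (T - s) / real n" using sT n by simp
  have "has_bochner_integral M (\<lambda>\<omega>. (norm (\<beta> n k \<omega>))\<^sup>2) (CARD('d) * ((T - s) / real n))" for k
    using increment_norm2[OF t_nonneg h, of n k] by (simp add: \<beta>_def t_Suc)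
  then have "has_bochner_integral M (\<lambda>\<omega>. \<Sum>k<n. (norm (\<beta> n k \<omega>))\<^sup>2) (\<Sum>k<n. CARD('d) * ((T - s) / real n))"
    by (rule has_bochner_integral_sum)
  then show ?thesis using n by simp
qed

text \<open>Stopping at the first grid time at which the path leaves the good set or gets closer than
  \<open>\<epsilon>\<close>. If the good set is left, the last finite-variation increment is discarded, so that the
  terminal value is controlled by the Brownian increment alone.\<close>

definition "S e \<delta> \<epsilon> n \<omega> =
  (\<Sum>k<n. if act \<delta> \<epsilon> n k \<omega> then Dm e n k \<omega> + (if good n (Suc k) \<omega> then Jm e n k \<omega> else 0) else 0)"

text \<open>At the exit the potential is at least \<open>pot K (e + \<epsilon>\<^sup>2)\<close>
  after a hit, and otherwise it is bounded below through second moments. The condition on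
  \<open>\<epsilon>\<close> ensures that a path with a hit starts strictly above
  \<open>\<epsilon>\<close>, hence active.\<close>

lemma S_lower:
  assumes e: "0 < e" "e \<le> 1" and \<epsilon>: "\<epsilon> < \<delta> \<or> \<epsilon> < 0"
  shows "indicator {\<omega>. hit \<delta> \<epsilon> n \<omega>} \<omega> * pot K (e + \<epsilon>\<^sup>2)
      - (1 + K) * (2 + 2 * R\<^sup>2 + 2 * (\<Sum>k<n. (norm (\<beta> n k \<omega>))\<^sup>2))
    \<le> act_ind \<delta> \<epsilon> n 0 \<omega> * (pot K (q e (Z n 0 \<omega>)) + S e \<delta> \<epsilon> n \<omega>)"
proof -
  define b2 where "b2 = (\<Sum>k<n. (norm (\<beta> n k \<omega>))\<^sup>2)"
  have b2: "0 \<le> b2" by (simp add: b2_def sum_nonneg)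
  have K1: "0 \<le> 1 + K" using K by simp
  have err: "0 \<le> (1 + K) * (2 + 2 * R\<^sup>2 + 2 * b2)" using b2 K1 by (intro mult_nonneg_nonneg) auto
  have lower: "- ((1 + K) * (2 + 2 * R\<^sup>2 + 2 * b2)) \<le> pot K (q e x)" if "(dst E h0 x)\<^sup>2 \<le> 2 * R\<^sup>2 + 2 * b2" for x
  proof -
    have "(1 + K) * (1 + q e x) \<le> (1 + K) * (2 + 2 * R\<^sup>2 + 2 * b2)"
      using that e K1 by (intro mult_left_mono) (auto simp: q_def)
    moreover have "- (1 + K) * (1 + q e x) \<le> pot K (q e x)"
      by (rule pot_lower) (use e q_ge[of e x] K in auto)
    ultimately show ?thesis unfolding mult_minus_left by linarith
  qed
  have low1: "- ((1 + K) * (2 + 2 * R\<^sup>2 + 2 * b2)) \<le> pot K (q e (Z n k \<omega>))" if "good n k \<omega>" for k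
  proof (rule lower)
    have "(dst E h0 (Z n k \<omega>))\<^sup>2 \<le> R\<^sup>2" using good_near[OF that order_refl] by (intro power_mono) auto
    moreover have "0 \<le> R\<^sup>2" by simp
    ultimately show "(dst E h0 (Z n k \<omega>))\<^sup>2 \<le> 2 * R\<^sup>2 + 2 * b2" using b2 by linarith
  qed
  have low2: "- ((1 + K) * (2 + 2 * R\<^sup>2 + 2 * b2)) \<le> pot K (q e (Z n k \<omega> + \<beta> n k \<omega>))" if "good n k \<omega>" "k < n" for k
  proof (rule lower)
    have "dst E h0 (Z n k \<omega> + \<beta> n k \<omega>) \<le> R + norm (\<beta> n k \<omega>)"
      using dst_lipschitz[OF E(1), of h0 "Z n k \<omega> + \<beta> n k \<omega>" "Z n k \<omega>"] good_near[OF that(1) order_refl] by simp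
    then have "(dst E h0 (Z n k \<omega> + \<beta> n k \<omega>))\<^sup>2 \<le> (R + norm (\<beta> n k \<omega>))\<^sup>2" by (intro power_mono) auto
    also have "\<dots> \<le> 2 * R\<^sup>2 + 2 * (norm (\<beta> n k \<omega>))\<^sup>2"
      using sum_squares_bound[of R "norm (\<beta> n k \<omega>)"] by (simp add: power2_sum)
    also have "(norm (\<beta> n k \<omega>))\<^sup>2 \<le> b2"
      unfolding b2_def using that(2) by (intro member_le_sum) auto
    finally show "(dst E h0 (Z n k \<omega> + \<beta> n k \<omega>))\<^sup>2 \<le> 2 * R\<^sup>2 + 2 * b2" by simp
  qed
  show ?thesis
  proof (cases "act \<delta> \<epsilon> n 0 \<omega>")
    case False
    have "\<not> hit \<delta> \<epsilon> n \<omega>"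
    proof
      assume h: "hit \<delta> \<epsilon> n \<omega>"
      then have "good n 0 \<omega>" "\<delta> \<le> dst E h0 (Z n 0 \<omega>)" using good_mono[of 0 n n \<omega>] by (auto simp: hit_def)
      moreover have "0 \<le> dst E h0 (Z n 0 \<omega>)" by simp
      ultimately have "\<epsilon> < dst E h0 (Z n 0 \<omega>)" using \<epsilon> by linarith
      then have "act \<delta> \<epsilon> n 0 \<omega>"
        using \<open>good n 0 \<omega>\<close> \<open>\<delta> \<le> dst E h0 (Z n 0 \<omega>)\<close> by (simp add: act_def)
      with False show False by simp
    qed
    then show ?thesis using False err by (simp add: b2_def)
  next
    case True
    define V where "V = pot K (q e (Z n 0 \<omega>)) + S e \<delta> \<epsilon> n \<omega>"
    have V1: "act \<delta> \<epsilon> n n \<omega> \<Longrightarrow> V = pot K (q e (Z n n \<omega>))"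
      unfolding V_def S_def
      by (rule stopped_telescope(1)[where act = "\<lambda>k. act \<delta> \<epsilon> n k \<omega>" and good = "\<lambda>k. good n k \<omega>"
        and D = "\<lambda>k. Dm e n k \<omega>" and J = "\<lambda>k. Jm e n k \<omega>" and g = "\<lambda>k. pot K (q e (Z n k \<omega>))"
        and g' = "\<lambda>k. pot K (q e (Z n k \<omega> + \<beta> n k \<omega>))"]) (use True act_Suc act_good in \<open>auto simp: Dm_def Jm_def\<close>)
    have V2: "\<not> act \<delta> \<epsilon> n n \<omega> \<Longrightarrow> \<exists>m<n. act \<delta> \<epsilon> n m \<omega> \<and> \<not> act \<delta> \<epsilon> n (Suc m) \<omega> \<and>
       V = (if good n (Suc m) \<omega> then pot K (q e (Z n (Suc m) \<omega>)) else pot K (q e (Z n m \<omega> + \<beta> n m \<omega>)))"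
      unfolding V_def S_def
      by (rule stopped_telescope(2)[where act = "\<lambda>k. act \<delta> \<epsilon> n k \<omega>" and good = "\<lambda>k. good n k \<omega>"
        and D = "\<lambda>k. Dm e n k \<omega>" and J = "\<lambda>k. Jm e n k \<omega>" and g = "\<lambda>k. pot K (q e (Z n k \<omega>))"
        and g' = "\<lambda>k. pot K (q e (Z n k \<omega> + \<beta> n k \<omega>))"]) (use True act_Suc act_good in \<open>auto simp: Dm_def Jm_def\<close>)
    have "- ((1 + K) * (2 + 2 * R\<^sup>2 + 2 * b2)) \<le> V"
    proof (cases "act \<delta> \<epsilon> n n \<omega>")
      case True then show ?thesis using V1 low1 act_good by auto
    next
      case False then show ?thesis using V2[OF False] low1 low2 act_good by auto
    qed
    moreover have "pot K (e + \<epsilon>\<^sup>2) \<le> V" if "hit \<delta> \<epsilon> n \<omega>"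
    proof -
      have "\<not> act \<delta> \<epsilon> n n \<omega>" using that by (auto simp: hit_def act_def not_less)
      then obtain m where m: "m < n" "act \<delta> \<epsilon> n m \<omega>" "\<not> act \<delta> \<epsilon> n (Suc m) \<omega>"
        "V = (if good n (Suc m) \<omega> then pot K (q e (Z n (Suc m) \<omega>)) else pot K (q e (Z n m \<omega> + \<beta> n m \<omega>)))"
        using V2 by blast
      \<comment> \<open>A path with a hit is good throughout, so the exit is due to the distance and
        the last step is counted in full.\<close>
      have g: "good n (Suc m) \<omega>" using good_mono[of "Suc m" n n \<omega>] that m(1) by (auto simp: hit_def)
      have "dst E h0 (Z n (Suc m) \<omega>) \<le> \<epsilon>"
        using m(2,3) g unfolding act_def by (auto simp: le_Suc_eq not_less)
      then have "(dst E h0 (Z n (Suc m) \<omega>))\<^sup>2 \<le> \<epsilon>\<^sup>2" by (intro power_mono) auto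
      then have "pot K (e + \<epsilon>\<^sup>2) \<le> pot K (q e (Z n (Suc m) \<omega>))"
        by (intro pot_antimono) (use e in \<open>auto simp: q_def intro: add_pos_nonneg\<close>)
      then show ?thesis using m(4) g by simp
    qed
    ultimately show ?thesis
      using True err unfolding V_def[symmetric] b2_def[symmetric] by (auto split: split_indicator)
  qed
qed

lemma exc_nonneg: "0 \<le> exc e n k \<omega>"
  by (simp add: exc_def jump_excess_def)

text \<open>A crude Cauchy-Schwarz bound without sign information; it only has to dominate, with a
  constant that does not depend on \<open>n\<close>.\<close>

lemma exc_le:
  assumes e: "0 < e" and g: "good n (Suc k) \<omega>"
  shows "exc e n k \<omega> \<le> - pot1 K e * (2 * R + \<kappa>) * v n k \<omega>"
proof -
  define d where "d = Z n (Suc k) \<omega> - Z n k \<omega> - \<beta> n k \<omega>"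
  define y where "y = Z n (Suc k) \<omega>"
  have v: "v n k \<omega> = norm d" by (simp add: v_def d_def)
  have yd: "y - d = Z n k \<omega> + \<beta> n k \<omega>" by (simp add: y_def d_def)
  have "v n k \<omega> \<le> (\<Sum>j<Suc k. v n j \<omega>)" by (intro member_le_sum v_nonneg) auto
  also have "\<dots> \<le> \<kappa>" using g by (simp add: good_def)
  finally have vk: "norm d \<le> \<kappa>" by (simp add: v)
  have c: "0 \<le> - pot1 K (q e y)" "- pot1 K (q e y) \<le> - pot1 K e"
    using pot1_bound[OF e q_ge K, of y] pot1_nonpos[of "q e y" K] e q_ge[of e y] K by auto
  have "- (proj_span E (y - h0) \<bullet> d) \<le> norm (proj_span E (y - h0)) * norm d"
    using Cauchy_Schwarz_ineq2[of "proj_span E (y - h0)" d] by simp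
  also have "\<dots> \<le> R * norm d"
    using good_near[OF g order_refl] by (intro mult_right_mono) (auto simp: dst_def y_def)
  finally have "- 2 * (proj_span E (y - h0) \<bullet> d) \<le> 2 * R * norm d" by linarith
  moreover have "(norm d)\<^sup>2 \<le> \<kappa> * norm d" unfolding power2_eq_square using vk by (intro mult_right_mono) auto
  ultimately have le: "- 2 * (proj_span E (y - h0) \<bullet> d) + (norm d)\<^sup>2 \<le> (2 * R + \<kappa>) * norm d"
    unfolding distrib_right by linarith
  have "pot K (q e y) - pot K (q e (y - d)) \<le> - pot1 K (q e y) * (- 2 * (proj_span E (y - h0) \<bullet> d) + (norm d)\<^sup>2)"
    unfolding q_def by (rule pot_increment[OF E(1) e K])
  also have "\<dots> \<le> - pot1 K (q e y) * ((2 * R + \<kappa>) * norm d)" using le c by (intro mult_left_mono) auto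
  also have "\<dots> \<le> - pot1 K e * ((2 * R + \<kappa>) * norm d)" using c R \<kappa> by (intro mult_right_mono) auto
  finally have 1: "pot K (q e y) - pot K (q e (Z n k \<omega> + \<beta> n k \<omega>)) \<le> - pot1 K e * (2 * R + \<kappa>) * norm d"
    by (simp add: yd)
  have 2: "0 \<le> - pot1 K e * (2 * R + \<kappa>) * norm d"
    using c R \<kappa> by (intro mult_nonneg_nonneg) auto
  have 3: "0 \<le> (C / sqrt (q e (Z n k \<omega>)) + C * K) * ((T - s) / real n)"
    using C e q_ge[of e "Z n k \<omega>"] sT by (intro mult_nonneg_nonneg add_nonneg_nonneg) auto
  show ?thesis
    using 1 2 3 g unfolding v exc_def jump_excess_def q_def y_def by simp
qed

lemma exc_sum_le:
  assumes e: "0 < e"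
  shows "(\<Sum>k<n. exc e n k \<omega>) \<le> - pot1 K e * (2 * R + \<kappa>) * \<kappa>"
proof -
  define c where "c = - pot1 K e * (2 * R + \<kappa>)"
  have c: "0 \<le> c" unfolding c_def using pot1_nonpos[OF e K] R \<kappa> by (intro mult_nonneg_nonneg) auto
  have "(\<Sum>k<n. exc e n k \<omega>) \<le> (\<Sum>k<n. c * (if good n (Suc k) \<omega> then v n k \<omega> else 0))"
    using exc_le[OF e] by (intro sum_mono) (auto simp: c_def exc_def)
  also have "\<dots> = c * (\<Sum>k<n. if good n (Suc k) \<omega> then v n k \<omega> else 0)"
    by (simp add: sum_distrib_left)
  also have "\<dots> \<le> c * \<kappa>"
    by (rule mult_left_mono[OF stopped_sum_le c]) (use good_Suc \<kappa> in \<open>auto simp: good_def\<close>)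
  finally show ?thesis by (simp add: c_def)
qed

text \<open>Each \<open>exc\<close> is at most the corresponding term of \<open>excess_sum\<close>,
  which tends to 0 path by path; \<open>exc_sum_le\<close> supplies the domination.\<close>

lemma exc_sum_tendsto_0:
  assumes e: "0 < e"
  shows "(\<lambda>n. \<integral>\<omega>. (\<Sum>k<n. exc e n k \<omega>) \<partial>M) \<longlonglongrightarrow> 0"
proof -
  have "(\<lambda>n. \<integral>\<omega>. (\<Sum>k<n. exc e n k \<omega>) \<partial>M) \<longlonglongrightarrow> (\<integral>\<omega>. 0 \<partial>M)"
  proof (rule integral_dominated_convergence[where w = "\<lambda>_. - pot1 K e * (2 * R + \<kappa>) * \<kappa>"])
    show "AE \<omega> in M. norm (\<Sum>k<n. exc e n k \<omega>) \<le> - pot1 K e * (2 * R + \<kappa>) * \<kappa>" for n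
      using exc_sum_le[OF e, of n] by (auto simp: sum_nonneg exc_nonneg)
    show "AE \<omega> in M. (\<lambda>n. \<Sum>k<n. exc e n k \<omega>) \<longlonglongrightarrow> 0"
      using jump_limit[OF sT(1,2) e]
    proof eventually_elim
      case (elim \<omega>)
      show ?case
      proof (rule tendsto_sandwich[OF _ _ tendsto_const elim])
        show "\<forall>\<^sub>F n in sequentially. 0 \<le> (\<Sum>k<n. exc e n k \<omega>)"
          by (intro always_eventually allI sum_nonneg exc_nonneg)
        show "\<forall>\<^sub>F n in sequentially. (\<Sum>k<n. exc e n k \<omega>) \<le> excess_sum E h0 C e x0 r s T (\<lambda>t. X t \<omega>) (\<lambda>t. B t \<omega>) n"
          unfolding excess_sum_def by (intro always_eventually allI sum_mono) (auto simp: exc_def good_def \<beta>_def jump_excess_def)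
      qed
    qed
  qed auto
  then show ?thesis by simp
qed

text \<open>The error of \<open>S_lower\<close> in mean plus the constant part of the allowance,
  both over an interval of length at most 1. It is free of \<open>e\<close>, \<open>\<delta>\<close>
  and \<open>\<epsilon>\<close>.\<close>

definition "drift_const = (1 + K) * (2 + 2 * R\<^sup>2 + 2 * real CARD('d)) + C * K"

lemma S_upper:
  assumes e: "0 < e" and n: "0 < n"
  shows "S e \<delta> \<epsilon> n \<omega> \<le> (\<Sum>k<n. act_ind \<delta> \<epsilon> n k \<omega> * Dm e n k \<omega>
    + act_ind \<delta> \<epsilon> n k \<omega> * ((C / sqrt (q e (Z n k \<omega>)) + C * K) * ((T - s) / real n)) + exc e n k \<omega>)"
  unfolding S_def
proof (rule sum_mono)
  fix k
  \<comment> \<open>Being nonnegative, the allowance may also be charged for a step whose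
    finite-variation half is discarded.\<close>
  have pos: "0 \<le> (C / sqrt (q e (Z n k \<omega>)) + C * K) * ((T - s) / real n)"
    using C e q_ge[of e "Z n k \<omega>"] sT by (intro mult_nonneg_nonneg add_nonneg_nonneg) auto
  have "Jm e n k \<omega> \<le> (C / sqrt (q e (Z n k \<omega>)) + C * K) * ((T - s) / real n) + exc e n k \<omega>" if "good n (Suc k) \<omega>"
    using that by (simp add: exc_def jump_excess_def Jm_def q_def)
  then show "(if act \<delta> \<epsilon> n k \<omega> then Dm e n k \<omega> + (if good n (Suc k) \<omega> then Jm e n k \<omega> else 0) else 0)
    \<le> act_ind \<delta> \<epsilon> n k \<omega> * Dm e n k \<omega>
    + act_ind \<delta> \<epsilon> n k \<omega> * ((C / sqrt (q e (Z n k \<omega>)) + C * K) * ((T - s) / real n)) + exc e n k \<omega>"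
    using pos exc_nonneg[of e n k \<omega>] by auto
qed

text \<open>The gain \<open>K / (2 * sqrt q)\<close> of the Brownian half cancels the allowance
  \<open>C / sqrt q\<close>. What remains is the constant \<open>C * K\<close>, the singular term
  with \<open>e / q\<^sup>2\<close> and an error that vanishes with the mesh.\<close>

lemma step_expectation:
  assumes e: "0 < e" "e \<le> 1" and n: "0 < n"
  defines "h \<equiv> (T - s) / real n"
  shows "integrable M (\<lambda>\<omega>. act_ind \<delta> \<epsilon> n k \<omega> * Dm e n k \<omega>
      + act_ind \<delta> \<epsilon> n k \<omega> * ((C / sqrt (q e (Z n k \<omega>)) + C * K) * h))" (is "integrable M ?f")
    and "(\<integral>\<omega>. act_ind \<delta> \<epsilon> n k \<omega> * Dm e n k \<omega>
      + act_ind \<delta> \<epsilon> n k \<omega> * ((C / sqrt (q e (Z n k \<omega>)) + C * K) * h) \<partial>M)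
     \<le> C * K * h - h * (\<integral>\<omega>. act_ind \<delta> \<epsilon> n k \<omega> * (e / (q e (Z n k \<omega>))\<^sup>2) \<partial>M)
       + step_const e K R * (h * sqrt h)"
    and "integrable M (\<lambda>\<omega>. act_ind \<delta> \<epsilon> n k \<omega> * (e / (q e (Z n k \<omega>))\<^sup>2))"
proof -
  define A where "A = {\<omega> \<in> space M. act \<delta> \<epsilon> n k \<omega>}"
  define a where "a \<omega> = (act_ind \<delta> \<epsilon> n k \<omega> :: real)" for \<omega>
  define Q where "Q \<omega> = q e (Z n k \<omega>)" for \<omega>
  have aA: "\<omega> \<in> space M \<Longrightarrow> indicator A \<omega> = a \<omega>" for \<omega> by (auto simp: A_def a_def split: split_indicator)
  have a01: "0 \<le> a \<omega>" "a \<omega> \<le> 1" for \<omega> by (auto simp: a_def)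
  have Q: "e \<le> Q \<omega>" "0 < Q \<omega>" for \<omega> using q_ge[of e "Z n k \<omega>"] e by (auto simp: Q_def)
  have am [measurable]: "a \<in> borel_measurable M" unfolding a_def[abs_def] by measurable
  have Qm [measurable]: "Q \<in> borel_measurable M" unfolding Q_def[abs_def] by measurable
  have h: "0 < h" "h \<le> 1"
  proof -
    show "0 < h" using sT n by (simp add: h_def)
    have "T - s \<le> real n" using sT n by linarith
    then show "h \<le> 1" using n by (simp add: h_def)
  qed
  have R': "norm (proj_span E (Z n k \<omega> - h0)) \<le> R" if "\<omega> \<in> A" for \<omega>
    using that good_near[OF act_good order_refl] by (auto simp: A_def dst_def)
  note ps = pot_step[OF t_nonneg h E e K R Z_measurable_F[OF order_refl] act_measurable_F[of \<delta> \<epsilon> n k, folded A_def] R',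
     folded t_Suc[folded h_def] \<beta>_def dst_def q_def]
  have D: "integrable M (\<lambda>\<omega>. a \<omega> * Dm e n k \<omega>)"
  proof -
    have "integrable M (\<lambda>\<omega>. indicator A \<omega> * Dm e n k \<omega>)"
      using ps(1) by (simp add: Dm_def t_Suc h_def \<beta>_def q_def dst_def)
    then show ?thesis
      using aA by (subst Bochner_Integration.integrable_cong[OF refl, where g = "\<lambda>\<omega>. indicator A \<omega> * Dm e n k \<omega>"]) auto
  qed
  have g1: "integrable M (\<lambda>\<omega>. a \<omega> * (e / (Q \<omega>)\<^sup>2))"
  proof (rule integrable_const_bound[where B = "e / e\<^sup>2"])
    have "e / (Q \<omega>)\<^sup>2 \<le> e / e\<^sup>2" for \<omega> using e Q[of \<omega>] by (intro divide_left_mono power_mono) auto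
    then have "a \<omega> * (e / (Q \<omega>)\<^sup>2) \<le> 1 * (e / e\<^sup>2)" for \<omega> using a01 e by (intro mult_mono) auto
    then show "AE \<omega> in M. norm (a \<omega> * (e / (Q \<omega>)\<^sup>2)) \<le> e / e\<^sup>2" using a01 e by (auto simp: abs_mult)
  qed measurable
  have g2: "integrable M (\<lambda>\<omega>. a \<omega> * (C / sqrt (Q \<omega>)))"
  proof (rule integrable_const_bound[where B = "C / sqrt e"])
    have "C / sqrt (Q \<omega>) \<le> C / sqrt e" for \<omega> using e C Q[of \<omega>] by (intro divide_left_mono) auto
    then have "a \<omega> * (C / sqrt (Q \<omega>)) \<le> 1 * (C / sqrt e)" for \<omega> using a01 C Q[of \<omega>] by (intro mult_mono) (auto simp: less_imp_le)
    then show "AE \<omega> in M. norm (a \<omega> * (C / sqrt (Q \<omega>))) \<le> C / sqrt e"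
      using a01 C Q by (auto simp: abs_mult less_imp_le)
  qed measurable
  have g3: "integrable M a" by (rule integrable_const_bound[where B = 1]) (use a01 in auto)
  have J: "integrable M (\<lambda>\<omega>. a \<omega> * ((C / sqrt (Q \<omega>) + C * K) * h))"
    using integrable_mult_left[OF Bochner_Integration.integrable_add[OF g2 integrable_mult_left[OF g3, of "C * K"]], of h]
    by (simp add: algebra_simps)
  show f: "integrable M ?f" using Bochner_Integration.integrable_add[OF D J] by (simp add: a_def Q_def)
  show "integrable M (\<lambda>\<omega>. act_ind \<delta> \<epsilon> n k \<omega> * (e / (q e (Z n k \<omega>))\<^sup>2))"
    using g1 by (simp add: a_def Q_def)
  have I: "(\<integral>\<omega>. a \<omega> * Dm e n k \<omega> \<partial>M) \<le> h * (\<integral>\<omega>. a \<omega> * (- e / (Q \<omega>)\<^sup>2 - K / (2 * sqrt (Q \<omega>))) \<partial>M) + step_const e K R * (h * sqrt h)"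
  proof -
    have "(\<integral>\<omega>. a \<omega> * Dm e n k \<omega> \<partial>M) = (\<integral>\<omega>. indicator A \<omega> * Dm e n k \<omega> \<partial>M)"
      by (rule Bochner_Integration.integral_cong) (use aA in auto)
    moreover have "(\<integral>\<omega>. a \<omega> * (- e / (Q \<omega>)\<^sup>2 - K / (2 * sqrt (Q \<omega>))) \<partial>M) = (\<integral>\<omega>. indicator A \<omega> * (- e / (Q \<omega>)\<^sup>2 - K / (2 * sqrt (Q \<omega>))) \<partial>M)"
      by (rule Bochner_Integration.integral_cong) (use aA in auto)
    ultimately show ?thesis
      using ps(3) by (simp add: Dm_def t_Suc h_def \<beta>_def q_def dst_def Q_def)
  qed
  also have "(\<integral>\<omega>. a \<omega> * (- e / (Q \<omega>)\<^sup>2 - K / (2 * sqrt (Q \<omega>))) \<partial>M) = - (\<integral>\<omega>. a \<omega> * (e / (Q \<omega>)\<^sup>2) \<partial>M) - (\<integral>\<omega>. a \<omega> * (C / sqrt (Q \<omega>)) \<partial>M)"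
  proof -
    have "(\<integral>\<omega>. a \<omega> * (- e / (Q \<omega>)\<^sup>2 - K / (2 * sqrt (Q \<omega>))) \<partial>M) = (\<integral>\<omega>. - (a \<omega> * (e / (Q \<omega>)\<^sup>2)) - a \<omega> * (C / sqrt (Q \<omega>)) \<partial>M)"
      by (rule Bochner_Integration.integral_cong) (auto simp: algebra_simps)
    then show ?thesis using g1 g2 by simp
  qed
  finally have I': "(\<integral>\<omega>. a \<omega> * Dm e n k \<omega> \<partial>M) \<le> h * (- (\<integral>\<omega>. a \<omega> * (e / (Q \<omega>)\<^sup>2) \<partial>M) - (\<integral>\<omega>. a \<omega> * (C / sqrt (Q \<omega>)) \<partial>M)) + step_const e K R * (h * sqrt h)" .
  have "(\<integral>\<omega>. a \<omega> * ((C / sqrt (Q \<omega>) + C * K) * h) \<partial>M) = (\<integral>\<omega>. (a \<omega> * (C / sqrt (Q \<omega>)) + a \<omega> * (C * K)) * h \<partial>M)"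
    by (rule Bochner_Integration.integral_cong) (auto simp: algebra_simps)
  also have "\<dots> = ((\<integral>\<omega>. a \<omega> * (C / sqrt (Q \<omega>)) \<partial>M) + (\<integral>\<omega>. a \<omega> \<partial>M) * (C * K)) * h"
    using g2 g3 by simp
  also have "\<dots> \<le> ((\<integral>\<omega>. a \<omega> * (C / sqrt (Q \<omega>)) \<partial>M) + 1 * (C * K)) * h"
  proof (intro mult_right_mono add_left_mono)
    have "(\<integral>\<omega>. a \<omega> \<partial>M) \<le> (\<integral>\<omega>. 1 \<partial>M)" by (rule integral_mono[OF g3]) (use a01 in auto)
    then show "(\<integral>\<omega>. a \<omega> \<partial>M) \<le> 1" by (simp add: prob_space)
  qed (use h C in auto)
  finally have J': "(\<integral>\<omega>. a \<omega> * ((C / sqrt (Q \<omega>) + C * K) * h) \<partial>M) \<le> ((\<integral>\<omega>. a \<omega> * (C / sqrt (Q \<omega>)) \<partial>M) + 1 * (C * K)) * h" .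
  have "(\<integral>\<omega>. a \<omega> * Dm e n k \<omega> + a \<omega> * ((C / sqrt (Q \<omega>) + C * K) * h) \<partial>M)
     \<le> C * K * h - h * (\<integral>\<omega>. a \<omega> * (e / (Q \<omega>)\<^sup>2) \<partial>M) + step_const e K R * (h * sqrt h)"
    using I' J' by (subst Bochner_Integration.integral_add[OF D J]) (simp add: algebra_simps)
  then show "(\<integral>\<omega>. act_ind \<delta> \<epsilon> n k \<omega> * Dm e n k \<omega>
      + act_ind \<delta> \<epsilon> n k \<omega> * ((C / sqrt (q e (Z n k \<omega>)) + C * K) * h) \<partial>M)
     \<le> C * K * h - h * (\<integral>\<omega>. act_ind \<delta> \<epsilon> n k \<omega> * (e / (q e (Z n k \<omega>))\<^sup>2) \<partial>M)
       + step_const e K R * (h * sqrt h)"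
    by (simp add: a_def Q_def)
qed

end

section \<open>Expectation of the stopped sum and the limits in the mesh and in
  \<open>e\<close>\<close>

context corner_grid
begin

text \<open>Lower and upper bound for the stopped sum compared in mean. The first term on the left
  penalises hits at small \<open>\<epsilon>\<close>, the second penalises time spent where
  \<open>q\<close> is close to \<open>e\<close>; \<open>no_hit\<close> and \<open>no_stay\<close>
  exploit one each.\<close>

lemma main_inequality:
  assumes e: "0 < e" "e \<le> 1" and n: "0 < n" and \<epsilon>: "\<epsilon> < \<delta> \<or> \<epsilon> < 0" and \<delta>: "0 \<le> \<delta>"
  defines "h \<equiv> (T - s) / real n"
  shows "prob {\<omega> \<in> space M. hit \<delta> \<epsilon> n \<omega>} * pot K (e + \<epsilon>\<^sup>2)
      + h * (\<Sum>k<n. \<integral>\<omega>. act_ind \<delta> \<epsilon> n k \<omega> * (e / (q e (Z n k \<omega>))\<^sup>2) \<partial>M)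
    \<le> max 0 (pot K (e + \<delta>\<^sup>2)) + drift_const + \<bar>step_const e K R\<bar> * sqrt h + (\<integral>\<omega>. (\<Sum>k<n. exc e n k \<omega>) \<partial>M)"
proof -
  define f where "f k \<omega> = act_ind \<delta> \<epsilon> n k \<omega> * Dm e n k \<omega>
      + act_ind \<delta> \<epsilon> n k \<omega> * ((C / sqrt (q e (Z n k \<omega>)) + C * K) * h)" for k \<omega>
  define b2 where "b2 \<omega> = (\<Sum>k<n. (norm (\<beta> n k \<omega>))\<^sup>2)" for \<omega>
  define I where "I k = (\<integral>\<omega>. act_ind \<delta> \<epsilon> n k \<omega> * (e / (q e (Z n k \<omega>))\<^sup>2) \<partial>M)" for k
  \<comment> \<open>The maximum with 0 covers paths that are not active at the start, where the
    initial value is multiplied by 0.\<close>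
  define g0 where "g0 = max 0 (pot K (e + \<delta>\<^sup>2))"
  define ex where "ex \<omega> = (\<Sum>k<n. exc e n k \<omega>)" for \<omega>
  have h: "0 < h" "h \<le> 1" "real n * h = T - s"
  proof -
    show "0 < h" using sT n by (simp add: h_def)
    have "T - s \<le> real n" using sT n by linarith
    then show "h \<le> 1" using n by (simp add: h_def)
    show "real n * h = T - s" using n by (simp add: h_def)
  qed
  have ub: "act_ind \<delta> \<epsilon> n 0 \<omega> * (pot K (q e (Z n 0 \<omega>)) + S e \<delta> \<epsilon> n \<omega>) \<le> g0 + ((\<Sum>k<n. f k \<omega>) + ex \<omega>)" for \<omega>
  proof -
    have S: "S e \<delta> \<epsilon> n \<omega> \<le> (\<Sum>k<n. f k \<omega>) + ex \<omega>"
      using S_upper[OF e(1) n, of \<delta> \<epsilon> \<omega>] by (simp add: f_def ex_def h_def sum.distrib)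
    show ?thesis
    proof (cases "act \<delta> \<epsilon> n 0 \<omega>")
      case True
      then have "\<delta>\<^sup>2 \<le> (dst E h0 (Z n 0 \<omega>))\<^sup>2" using \<delta> by (intro power_mono) (auto simp: act_def)
      then have "pot K (q e (Z n 0 \<omega>)) \<le> pot K (e + \<delta>\<^sup>2)"
        by (intro pot_antimono) (use e in \<open>auto simp: q_def intro: add_pos_nonneg\<close>)
      then show ?thesis using True S by (simp add: g0_def)
    next
      case False
      have "\<not> act \<delta> \<epsilon> n k \<omega>" for k
        by (induction k) (use False act_Suc in auto)
      then have "S e \<delta> \<epsilon> n \<omega> = 0" by (simp add: S_def)
      then show ?thesis using False S by (simp add: g0_def)
    qed
  qed
  have pw: "indicator {\<omega> \<in> space M. hit \<delta> \<epsilon> n \<omega>} \<omega> * pot K (e + \<epsilon>\<^sup>2)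
     \<le> (1 + K) * (2 + 2 * R\<^sup>2 + 2 * b2 \<omega>) + (g0 + ((\<Sum>k<n. f k \<omega>) + ex \<omega>))" if "\<omega> \<in> space M" for \<omega>
    using S_lower[OF e \<epsilon>, of n \<omega>] ub[of \<omega>] that unfolding b2_def[symmetric]
    by (auto split: split_indicator)
  have fi: "integrable M (f k)" for k
    using step_expectation(1)[OF e n, of \<delta> \<epsilon> k] by (simp add: f_def[abs_def] h_def)
  have fI: "(\<integral>\<omega>. f k \<omega> \<partial>M) \<le> C * K * h - h * I k + step_const e K R * (h * sqrt h)" for k
    using step_expectation(2)[OF e n, of \<delta> \<epsilon> k] by (simp add: f_def[abs_def] h_def I_def)
  have exi: "integrable M ex"
    by (rule integrable_const_bound[where B = "- pot1 K e * (2 * R + \<kappa>) * \<kappa>"])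
      (use exc_sum_le[OF e(1)] in \<open>auto simp: ex_def[abs_def] sum_nonneg exc_nonneg\<close>)
  have b2i: "integrable M b2" "(\<integral>\<omega>. b2 \<omega> \<partial>M) = real CARD('d) * (T - s)"
    using norm_beta_square[OF n] by (auto simp: has_bochner_integral_iff b2_def[abs_def])
  have hm: "{\<omega> \<in> space M. hit \<delta> \<epsilon> n \<omega>} \<in> sets M" by measurable
  have "(\<integral>\<omega>. indicator {\<omega> \<in> space M. hit \<delta> \<epsilon> n \<omega>} \<omega> * pot K (e + \<epsilon>\<^sup>2) \<partial>M)
    \<le> (\<integral>\<omega>. (1 + K) * (2 + 2 * R\<^sup>2 + 2 * b2 \<omega>) + (g0 + ((\<Sum>k<n. f k \<omega>) + ex \<omega>)) \<partial>M)"
  proof (rule integral_mono)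
    show "integrable M (\<lambda>\<omega>. indicator {\<omega> \<in> space M. hit \<delta> \<epsilon> n \<omega>} \<omega> * pot K (e + \<epsilon>\<^sup>2))"
      using hm by (intro integrable_mult_left integrable_real_indicator) (auto simp: emeasure_eq_measure)
    show "integrable M (\<lambda>\<omega>. (1 + K) * (2 + 2 * R\<^sup>2 + 2 * b2 \<omega>) + (g0 + ((\<Sum>k<n. f k \<omega>) + ex \<omega>)))"
      by (intro Bochner_Integration.integrable_add integrable_mult_right b2i integrable_const
        Bochner_Integration.integrable_sum fi exi)
  qed (use pw in auto)
  also have "(\<integral>\<omega>. indicator {\<omega> \<in> space M. hit \<delta> \<epsilon> n \<omega>} \<omega> * pot K (e + \<epsilon>\<^sup>2) \<partial>M) = prob {\<omega> \<in> space M. hit \<delta> \<epsilon> n \<omega>} * pot K (e + \<epsilon>\<^sup>2)"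
    using hm by (simp add: Int_absorb2 sets.sets_into_space)
  also have "(\<integral>\<omega>. (1 + K) * (2 + 2 * R\<^sup>2 + 2 * b2 \<omega>) + (g0 + ((\<Sum>k<n. f k \<omega>) + ex \<omega>)) \<partial>M)
    = (1 + K) * (2 + 2 * R\<^sup>2 + 2 * (real CARD('d) * (T - s))) + (g0 + ((\<Sum>k<n. \<integral>\<omega>. f k \<omega> \<partial>M) + (\<integral>\<omega>. ex \<omega> \<partial>M)))"
  proof -
    have "has_bochner_integral M (\<lambda>\<omega>. (1 + K) * (2 + 2 * R\<^sup>2 + 2 * b2 \<omega>) + (g0 + ((\<Sum>k<n. f k \<omega>) + ex \<omega>)))
      ((1 + K) * (2 * prob (space M) + 2 * R\<^sup>2 * prob (space M) + 2 * (\<integral>\<omega>. b2 \<omega> \<partial>M)) + (g0 * prob (space M) + ((\<Sum>k<n. \<integral>\<omega>. f k \<omega> \<partial>M) + (\<integral>\<omega>. ex \<omega> \<partial>M))))"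
      unfolding has_bochner_integral_iff using b2i(1) fi exi by (simp add: prob_space Bochner_Integration.integral_add Bochner_Integration.integrable_add Bochner_Integration.integral_sum)
    then show ?thesis
      by (simp only: has_bochner_integral_iff prob_space b2i mult_1_right)
  qed
  also have "\<dots> \<le> (1 + K) * (2 + 2 * R\<^sup>2 + 2 * (real CARD('d) * 1)) + (g0 + ((\<Sum>k<n. C * K * h - h * I k + step_const e K R * (h * sqrt h)) + (\<integral>\<omega>. ex \<omega> \<partial>M)))"
    using sT K by (intro add_mono mult_left_mono sum_mono fI order_refl) auto
  also have "(\<Sum>k<n. C * K * h - h * I k + step_const e K R * (h * sqrt h)) = C * K * (T - s) - h * (\<Sum>k<n. I k) + step_const e K R * ((T - s) * sqrt h)"
  proof -
    have "(\<Sum>k<n. C * K * h - h * I k + step_const e K R * (h * sqrt h))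
      = C * K * (real n * h) - h * (\<Sum>k<n. I k) + step_const e K R * ((real n * h) * sqrt h)"
      by (simp add: sum.distrib sum_subtractf sum_distrib_left)
    then show ?thesis using h(3) by simp
  qed
  finally have fin: "prob {\<omega> \<in> space M. hit \<delta> \<epsilon> n \<omega>} * pot K (e + \<epsilon>\<^sup>2)
    \<le> (1 + K) * (2 + 2 * R\<^sup>2 + 2 * (real CARD('d) * 1)) + (g0 + (C * K * (T - s) - h * (\<Sum>k<n. I k) + step_const e K R * ((T - s) * sqrt h) + (\<integral>\<omega>. ex \<omega> \<partial>M)))" .
  have "C * K * (T - s) \<le> C * K * 1" using C sT by (intro mult_left_mono) auto
  moreover have "step_const e K R * ((T - s) * sqrt h) \<le> \<bar>step_const e K R\<bar> * sqrt h"
  proof -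
    have "step_const e K R * ((T - s) * sqrt h) \<le> \<bar>step_const e K R\<bar> * ((T - s) * sqrt h)"
      using sT h by (intro mult_right_mono) auto
    also have "\<dots> \<le> \<bar>step_const e K R\<bar> * (1 * sqrt h)" using sT h by (intro mult_left_mono mult_right_mono) auto
    finally show ?thesis by simp
  qed
  moreover have "c1 \<le> c2 \<Longrightarrow> st \<le> st' \<Longrightarrow> p \<le> P + (g + (c1 - hs + st + x))
      \<Longrightarrow> p + hs \<le> g + (P + c2) + st' + x" for c1 c2 st st' p P g hs x :: real
    by linarith
  ultimately show ?thesis
    using fin unfolding drift_const_def g0_def[symmetric] I_def[symmetric] ex_def[symmetric] mult_1_right
    by blast
qed

definition "rhs e \<delta> n = max 0 (pot K (e + \<delta>\<^sup>2)) + drift_const + \<bar>step_const e K R\<bar> * sqrt ((T - s) / real n) + (\<integral>\<omega>. (\<Sum>k<n. exc e n k \<omega>) \<partial>M)"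

lemma rhs_tendsto:
  assumes "0 < e" shows "rhs e \<delta> \<longlonglongrightarrow> max 0 (pot K (e + \<delta>\<^sup>2)) + drift_const"
proof -
  have "(\<lambda>n. max 0 (pot K (e + \<delta>\<^sup>2)) + drift_const + \<bar>step_const e K R\<bar> * sqrt ((T - s) / real n) + (\<integral>\<omega>. (\<Sum>k<n. exc e n k \<omega>) \<partial>M))
     \<longlonglongrightarrow> max 0 (pot K (e + \<delta>\<^sup>2)) + drift_const + \<bar>step_const e K R\<bar> * sqrt 0 + 0"
    by (intro tendsto_intros exc_sum_tendsto_0 assms lim_const_over_n)
  then show ?thesis by (simp add: rhs_def[abs_def])
qed

text \<open>On the event \<open>e / q\<^sup>2\<close> equals \<open>1 / e\<close> at every step,
  while the right side of \<open>main_inequality\<close> grows only like \<open>- ln e\<close>. The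
  probability is therefore of order at most \<open>- e * ln e\<close>.\<close>

lemma no_stay:
  "AE \<omega> in M. \<not> (\<forall>n>0. good n n \<omega> \<and> (\<forall>j\<le>n. dst E h0 (Z n j \<omega>) = 0))"
proof -
  define A where "A n = {\<omega> \<in> space M. good n n \<omega> \<and> (\<forall>j\<le>n. dst E h0 (Z n j \<omega>) = 0)}" for n
  have Am: "A n \<in> sets M" for n unfolding A_def by measurable
  define \<Omega> where "\<Omega> = (\<Inter>n\<in>{0<..}. A n)"
  have \<Omega>m: "\<Omega> \<in> sets M" unfolding \<Omega>_def by (intro sets.countable_INT) (use Am in auto)
  have bound: "(T - s) / e * prob \<Omega> \<le> max 0 (pot K e) + drift_const" if e: "0 < e" "e \<le> 1" for e
  proof (rule LIMSEQ_le_const[OF rhs_tendsto[OF e(1), of 0, simplified]])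
    show "\<exists>N. \<forall>n\<ge>N. (T - s) / e * prob \<Omega> \<le> rhs e 0 n"
    proof (intro exI[of _ 1] allI impI)
      fix n assume "1 \<le> (n::nat)"
      then have n: "0 < n" by simp
      define h where "h = (T - s) / real n"
      \<comment> \<open>A negative \<open>\<epsilon>\<close> turns off the hitting term of
        \<open>main_inequality\<close>.\<close>
      have "prob {\<omega> \<in> space M. hit 0 (- 1) n \<omega>} = 0"
      proof -
        have "\<not> hit 0 (- 1) n \<omega>" for \<omega>
          unfolding hit_def using dst_nonneg[of E h0] by (smt (verit))
        then show ?thesis by simp
      qed
      then have le: "h * (\<Sum>k<n. \<integral>\<omega>. act_ind 0 (- 1) n k \<omega> * (e / (q e (Z n k \<omega>))\<^sup>2) \<partial>M) \<le> rhs e 0 n"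
        using main_inequality[OF e n, of "- 1" 0] by (simp add: rhs_def h_def)
      have "prob \<Omega> * (1 / e) \<le> (\<integral>\<omega>. act_ind 0 (- 1) n k \<omega> * (e / (q e (Z n k \<omega>))\<^sup>2) \<partial>M)" if k: "k < n" for k
      proof -
        have "prob \<Omega> * (1 / e) = (\<integral>\<omega>. indicator \<Omega> \<omega> * (1 / e) \<partial>M)"
          using \<Omega>m by (simp add: Int_absorb2 sets.sets_into_space)
        also have "\<dots> \<le> (\<integral>\<omega>. act_ind 0 (- 1) n k \<omega> * (e / (q e (Z n k \<omega>))\<^sup>2) \<partial>M)"
        proof (rule integral_mono[OF _ step_expectation(3)[OF e n]])
          show "integrable M (\<lambda>\<omega>. indicator \<Omega> \<omega> * (1 / e))"
            using \<Omega>m by (intro integrable_mult_left integrable_real_indicator) (auto simp: emeasure_eq_measure)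
          fix \<omega>
          show "indicator \<Omega> \<omega> * (1 / e) \<le> act_ind 0 (- 1) n k \<omega> * (e / (q e (Z n k \<omega>))\<^sup>2)"
          proof (cases "\<omega> \<in> \<Omega>")
            case True
            then have "good n n \<omega>" "\<forall>j\<le>n. dst E h0 (Z n j \<omega>) = 0" using n by (auto simp: \<Omega>_def A_def)
            then have "act 0 (- 1) n k \<omega>" "q e (Z n k \<omega>) = e"
              using good_mono[of k n n \<omega>] k by (auto simp: act_def q_def)
            then show ?thesis using True e by (simp add: power2_eq_square)
          qed (use e in simp)
        qed
        finally show ?thesis .
      qed
      then have "(\<Sum>k<n. prob \<Omega> * (1 / e)) \<le> (\<Sum>k<n. \<integral>\<omega>. act_ind 0 (- 1) n k \<omega> * (e / (q e (Z n k \<omega>))\<^sup>2) \<partial>M)"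
        by (intro sum_mono) auto
      then have "h * (\<Sum>k<n. prob \<Omega> * (1 / e)) \<le> rhs e 0 n"
        by (rule order_trans[OF mult_left_mono le]) (use sT in \<open>simp add: h_def\<close>)
      moreover have "h * (\<Sum>k<n. prob \<Omega> * (1 / e)) = (T - s) / e * prob \<Omega>"
      proof -
        have "h * (\<Sum>k<n. prob \<Omega> * (1 / e)) = (real n * h) * (prob \<Omega> * (1 / e))" by simp
        also have "real n * h = T - s" using n by (simp add: h_def)
        finally show ?thesis by simp
      qed
      ultimately show "(T - s) / e * prob \<Omega> \<le> rhs e 0 n" by (simp only:)
    qed
  qed
  have dc0: "0 \<le> drift_const" unfolding drift_const_def using K C by (intro add_nonneg_nonneg mult_nonneg_nonneg) auto
  have "(T - s) * prob \<Omega> \<le> (1 + drift_const) / real m" if m: "0 < m" for m :: nat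
  proof -
    \<comment> \<open>With \<open>e = x\<^sup>2\<close> the logarithm is at most
      \<open>1 / x\<close>, which loses against the factor \<open>1 / e\<close>.\<close>
    define x where "x = 1 / real m"
    have x1: "0 < x" "x \<le> 1" using m by (auto simp: x_def)
    then have "x * x \<le> x * 1" by (intro mult_left_mono) auto
    then have "x * x \<le> x" by (simp only: mult_1_right)
    note x = x1 this
    have e: "0 < x\<^sup>2" "x\<^sup>2 \<le> 1" using x by (auto simp: power_le_one)
    have "pot K (x\<^sup>2) \<le> 1 / x"
    proof -
      have "ln (1 / x) \<le> 1 / x - 1" using x by (intro ln_le_minus_one) auto
      then have "- ln (x\<^sup>2) / 2 \<le> 1 / x" using x by (simp add: ln_realpow ln_div)
      moreover have "0 \<le> K * sqrt (x\<^sup>2)" using K by simp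
      ultimately show ?thesis unfolding pot_def by linarith
    qed
    then have "max 0 (pot K (x\<^sup>2)) \<le> 1 / x" using x by simp
    then have "(T - s) / x\<^sup>2 * prob \<Omega> \<le> 1 / x + drift_const" using bound[OF e] by linarith
    then have "x\<^sup>2 * ((T - s) / x\<^sup>2 * prob \<Omega>) \<le> x\<^sup>2 * (1 / x + drift_const)" by (rule mult_left_mono) simp
    then have "(T - s) * prob \<Omega> \<le> x + (x * x) * drift_const" using x by (simp add: power2_eq_square distrib_left)
    also have "\<dots> \<le> x + x * drift_const" using x dc0 by (intro add_left_mono mult_right_mono) auto
    finally show ?thesis by (simp add: x_def add_divide_distrib)
  qed
  then have "(T - s) * prob \<Omega> \<le> 0"
    by (intro LIMSEQ_le_const[OF lim_const_over_n[of "1 + drift_const"]] exI[of _ 1]) auto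
  then have "prob \<Omega> = 0" using sT measure_nonneg[of M \<Omega>] by (simp add: mult_le_0_iff)
  then have "\<Omega> \<in> null_sets M" using \<Omega>m by (auto simp: null_sets_def emeasure_eq_measure)
  then show ?thesis
    by (rule AE_I') (unfold \<Omega>_def A_def INT_iff Int_iff mem_Collect_eq greaterThan_iff subset_iff, blast)
qed

text \<open>Three limits in this order: the mesh to 0, then \<open>N\<close> to infinity along the
  increasing events \<open>A m N\<close>, then \<open>m\<close> to infinity. In the last one the
  potential at the hit level grows like \<open>ln m\<close>, whereas \<open>c\<close> does not
  depend on \<open>m\<close>.\<close>

lemma no_hit:
  assumes \<delta>: "0 < \<delta>"
  shows "AE \<omega> in M. \<not> (\<forall>m>0. 1 / real m < \<delta> \<longrightarrow> (\<forall>\<^sub>F n in sequentially. hit \<delta> (1 / real m) n \<omega>))"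
proof -
  define A where "A m N = {\<omega> \<in> space M. \<forall>n\<ge>N. hit \<delta> (1 / real m) n \<omega>}" for m N :: nat
  have Am: "A m N \<in> sets M" for m N unfolding A_def by measurable
  define M0 where "M0 = {m::nat. 0 < m \<and> 1 / real m < \<delta>}"
  define \<Omega> where "\<Omega> = (\<Inter>m\<in>M0. \<Union>N. A m N)"
  obtain m1 :: nat where m1: "1 / \<delta> < real m1" using reals_Archimedean2 by blast
  have M0: "m \<in> M0" if "m1 \<le> m" for m
  proof -
    have "1 / \<delta> < real m" using m1 that by linarith
    moreover from this have "0 < real m" using \<delta> by (meson divide_pos_pos less_trans zero_less_one)
    ultimately show ?thesis using \<delta> by (simp add: M0_def field_simps)
  qed
  then have "M0 \<noteq> {}" by auto
  then have \<Omega>m: "\<Omega> \<in> sets M" unfolding \<Omega>_def by (intro sets.countable_INT) (use Am in auto)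
  define c where "c = max 0 (pot K (\<delta>\<^sup>2)) + drift_const"
  \<comment> \<open>Both \<open>\<epsilon>\<close> and \<open>sqrt e\<close> are
    \<open>1 / m\<close>, which makes the hit level \<open>e + \<epsilon>\<^sup>2\<close> this
    sum.\<close>
  define \<Lambda> where "\<Lambda> m = pot K ((1 / real m)\<^sup>2 + (1 / real m)\<^sup>2)" for m
  have bound: "prob \<Omega> * \<Lambda> m \<le> c" if m: "m \<in> M0" and \<Lambda>: "0 \<le> \<Lambda> m" for m
  proof -
    define e where "e = (1 / real m)\<^sup>2"
    have e: "0 < e" "e \<le> 1" using m by (auto simp: e_def M0_def power_le_one)
    have 1: "prob (A m N) * \<Lambda> m \<le> c" for N
    proof -
    have "prob (A m N) * \<Lambda> m \<le> max 0 (pot K (e + \<delta>\<^sup>2)) + drift_const"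
    proof (rule LIMSEQ_le_const)
      show "rhs e \<delta> \<longlonglongrightarrow> max 0 (pot K (e + \<delta>\<^sup>2)) + drift_const" by (rule rhs_tendsto[OF e(1)])
      show "\<exists>N'. \<forall>n\<ge>N'. prob (A m N) * \<Lambda> m \<le> rhs e \<delta> n"
      proof (intro exI[of _ "max 1 N"] allI impI)
        fix n assume n: "max 1 N \<le> n"
        have "prob (A m N) \<le> prob {\<omega> \<in> space M. hit \<delta> (1 / real m) n \<omega>}"
          by (rule finite_measure_mono) (use n in \<open>auto simp: A_def\<close>)
        then have "prob (A m N) * \<Lambda> m \<le> prob {\<omega> \<in> space M. hit \<delta> (1 / real m) n \<omega>} * \<Lambda> m"
          by (rule mult_right_mono[OF _ \<Lambda>])
        also have "\<dots> \<le> rhs e \<delta> n"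
        proof -
          have n0: "0 < n" using n by simp
          have "0 \<le> (T - s) / real n * (\<Sum>k<n. \<integral>\<omega>. act_ind \<delta> (1 / real m) n k \<omega> * (e / (q e (Z n k \<omega>))\<^sup>2) \<partial>M)"
            using sT e by (intro mult_nonneg_nonneg sum_nonneg integral_nonneg_AE AE_I2) auto
          then show ?thesis
            using main_inequality[OF e n0, of "1 / real m" \<delta>] m \<delta>
            by (simp add: rhs_def \<Lambda>_def e_def M0_def)
        qed
        finally show "prob (A m N) * \<Lambda> m \<le> rhs e \<delta> n" .
      qed
    qed
    moreover have "pot K (e + \<delta>\<^sup>2) \<le> pot K (\<delta>\<^sup>2)" using \<delta> e by (intro pot_antimono) auto
    ultimately show ?thesis by (simp add: c_def)
    qed
    have "(\<lambda>N. prob (A m N)) \<longlonglongrightarrow> prob (\<Union>N. A m N)"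
    proof (rule finite_Lim_measure_incseq)
      show "range (A m) \<subseteq> sets M" using Am by auto
      show "incseq (A m)" by (rule monoI) (auto simp: A_def)
    qed
    then have "prob (\<Union>N. A m N) * \<Lambda> m \<le> c"
      by (intro LIMSEQ_le_const2[OF tendsto_mult_right]) (use 1 in auto)
    moreover have "prob \<Omega> \<le> prob (\<Union>N. A m N)"
      by (rule finite_measure_mono) (use Am m in \<open>auto simp: \<Omega>_def\<close>)
    ultimately show ?thesis using \<Lambda> mult_right_mono order_trans by blast
  qed
  have \<Lambda>_lower: "ln (real m) - 1 - 2 * K \<le> \<Lambda> m" if m: "0 < m" for m :: nat
  proof -
    define x where "x = 1 / real m"
    have x: "0 < x" "x \<le> 1" using m by (auto simp: x_def)
    have "ln (x\<^sup>2 + x\<^sup>2) = ln (2 * x\<^sup>2)" by simp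
    also have "\<dots> = ln 2 - 2 * ln (real m)" using m x by (simp add: ln_mult ln_realpow x_def ln_div)
    also have "ln (2::real) \<le> 2" using ln_le_minus_one[of "2::real"] by simp
    finally have "ln (x\<^sup>2 + x\<^sup>2) \<le> 2 - 2 * ln (real m)" by simp
    moreover have "sqrt (x\<^sup>2 + x\<^sup>2) \<le> 2"
    proof (rule real_le_lsqrt)
      have "x\<^sup>2 \<le> 1" using x by (simp add: power_le_one)
      then show "x\<^sup>2 + x\<^sup>2 \<le> 2\<^sup>2" by simp
    qed auto
    then have "K * sqrt (x\<^sup>2 + x\<^sup>2) \<le> K * 2" using K by (rule mult_left_mono)
    ultimately show ?thesis unfolding \<Lambda>_def pot_def x_def[symmetric] by linarith
  qed
  have "prob \<Omega> = 0"
  proof (rule ccontr)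
    assume "prob \<Omega> \<noteq> 0"
    then have p: "0 < prob \<Omega>" using measure_nonneg[of M \<Omega>] by linarith
    \<comment> \<open>Large enough for the lower bound \<open>ln m - 1 - 2 * K\<close> of
      \<open>\<Lambda> m\<close> to exceed \<open>\<bar>c\<bar> / prob \<Omega>\<close>.\<close>
    obtain m2 :: nat where m2: "exp (1 + 2 * K + \<bar>c\<bar> / prob \<Omega> + 1) < real m2" using reals_Archimedean2 by blast
    define m where "m = max 1 (max m1 m2)"
    have m: "0 < m" "m \<in> M0" using M0 by (auto simp: m_def)
    have "exp (1 + 2 * K + \<bar>c\<bar> / prob \<Omega> + 1) < real m" using m2 by (simp add: m_def)
    then have "1 + 2 * K + \<bar>c\<bar> / prob \<Omega> + 1 < ln (real m)" using m(1) by (metis exp_less_cancel_iff exp_ln of_nat_0_less_iff)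
    then have L: "\<bar>c\<bar> / prob \<Omega> < \<Lambda> m" using \<Lambda>_lower[OF m(1)] by linarith
    moreover have "0 \<le> \<bar>c\<bar> / prob \<Omega>" using p by simp
    ultimately have "prob \<Omega> * \<Lambda> m \<le> c" by (intro bound m) linarith
    moreover have "\<bar>c\<bar> < prob \<Omega> * \<Lambda> m" using L p by (simp add: pos_divide_less_eq mult.commute)
    ultimately show False by linarith
  qed
  then have "\<Omega> \<in> null_sets M" using \<Omega>m by (auto simp: null_sets_def emeasure_eq_measure)
  then show ?thesis
    by (rule AE_I') (auto simp: \<Omega>_def A_def M0_def eventually_sequentially)
qed

section \<open>From grid times to continuous time\<close>

lemma grid_in:
  assumes "0 < n" "j \<le> n" shows "t n j \<in> {s..T}"
proof -
  have "real j * ((T - s) / real n) \<le> real n * ((T - s) / real n)"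
    using assms sT by (intro mult_right_mono) auto
  then show ?thesis using assms sT by (simp add: grid_def)
qed

lemma eventually_grid_near:
  assumes u: "u \<in> {s..T}" and d: "0 < d"
  shows "\<forall>\<^sub>F n in sequentially. 0 < n \<and> (\<exists>j\<le>n. \<bar>t n j - u\<bar> < d)"
proof -
  obtain n0 :: nat where n0: "(T - s) / d < real n0" using reals_Archimedean2 by blast
  show ?thesis
    unfolding eventually_sequentially
  proof (intro exI[of _ "max 1 n0"] allI impI)
    fix n assume n: "max 1 n0 \<le> n"
    then have n1: "0 < n" by simp
    define h where "h = (T - s) / real n"
    have h: "0 < h" using sT n1 by (simp add: h_def)
    have "T - s < real n0 * d" using n0 d by (simp add: pos_divide_less_eq)
    also have "\<dots> \<le> real n * d" using n d by (intro mult_right_mono) auto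
    finally have hd: "h < d" using n1 by (simp add: h_def pos_divide_less_eq mult.commute)
    define j where "j = nat \<lfloor>(u - s) / h\<rfloor>"
    have "0 \<le> (u - s) / h" using u h by simp
    then have j: "real j \<le> (u - s) / h" "(u - s) / h < real j + 1"
      unfolding j_def by linarith+
    have "(u - s) / h \<le> real n"
    proof -
      have "u - s \<le> real n * h" using u n1 by (simp add: h_def)
      then show ?thesis using h by (simp add: pos_divide_le_eq)
    qed
    then have "j \<le> n" using j(1) by linarith
    moreover have "\<bar>t n j - u\<bar> < d"
    proof -
      have "real j * h \<le> u - s" using j(1) h by (simp add: pos_le_divide_eq)
      moreover have "u - s < (real j + 1) * h" using j(2) h by (simp add: pos_divide_less_eq)
      ultimately show ?thesis using hd by (simp add: grid_def h_def[symmetric] distrib_right)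
    qed
    ultimately show "0 < n \<and> (\<exists>j\<le>n. \<bar>t n j - u\<bar> < d)" using n1 by blast
  qed
qed

text \<open>By continuity, a zero of the distance at \<open>u\<close> puts points of every
  sufficiently fine grid within any \<open>1 / m\<close> of the edge, the event excluded by
  \<open>no_hit\<close>.\<close>

lemma no_visit:
  assumes \<delta>: "0 < \<delta>"
  shows "AE \<omega> in M. (\<forall>n. (\<Sum>j<n. v n j \<omega>) \<le> \<kappa>) \<longrightarrow> (\<forall>u\<in>{s..T}. dist (X u \<omega>) x0 < r) \<longrightarrow>
     (\<delta> \<le> dst E h0 (X s \<omega>) \<longrightarrow> (\<forall>u\<in>{s..T}. dst E h0 (X u \<omega>) \<noteq> 0)) \<and>
     \<not> (\<forall>n>0. \<forall>j\<le>n. dst E h0 (Z n j \<omega>) = 0)"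
  using no_hit[OF \<delta>] no_stay AE_space
proof eventually_elim
  case (elim \<omega>)
  show ?case
  proof (intro impI)
    assume var: "\<forall>n. (\<Sum>j<n. v n j \<omega>) \<le> \<kappa>" and near: "\<forall>u\<in>{s..T}. dist (X u \<omega>) x0 < r"
    have good: "good n n \<omega>" if "0 < n" for n
      using var near grid_in[OF that] by (auto simp: good_def)
    have stay: "\<not> (\<forall>n>0. \<forall>j\<le>n. dst E h0 (Z n j \<omega>) = 0)" using elim(2) good by blast
    have "dst E h0 (X u \<omega>) \<noteq> 0" if start: "\<delta> \<le> dst E h0 (X s \<omega>)" and u: "u \<in> {s..T}" for u
    proof
      assume z: "dst E h0 (X u \<omega>) = 0"
      have "\<forall>\<^sub>F n in sequentially. hit \<delta> (1 / real m) n \<omega>" if m: "0 < m" for m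
      proof -
        have "continuous_on {s..T} (\<lambda>t. X t \<omega>)"
          by (rule continuous_on_subset[OF X_cont[OF elim(3)]]) (use sT in auto)
        then obtain d where d: "0 < d" "\<And>y. y \<in> {s..T} \<Longrightarrow> dist y u < d \<Longrightarrow> dist (X y \<omega>) (X u \<omega>) < 1 / real m"
          using u m unfolding continuous_on_iff by (metis of_nat_0_less_iff zero_less_divide_1_iff)
        show ?thesis
          using eventually_grid_near[OF u d(1)]
        proof eventually_elim
          case (elim n)
          then obtain j where n: "0 < n" and j: "j \<le> n" "\<bar>t n j - u\<bar> < d" by auto
          have "dist (Z n j \<omega>) (X u \<omega>) < 1 / real m"
            using d(2)[OF grid_in[OF n j(1)]] j(2) by (simp add: dist_real_def)
          then have "dst E h0 (Z n j \<omega>) \<le> 1 / real m"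
            using dst_lipschitz[OF E(1), of h0 "Z n j \<omega>" "X u \<omega>"] z by (simp add: dist_norm)
          moreover have "Z n 0 \<omega> = X s \<omega>" by (simp add: grid_def)
          ultimately show ?case using good[OF n] start j(1) by (auto simp: hit_def)
        qed
      qed
      then show False using elim(1) by blast
    qed
    with stay show "(\<delta> \<le> dst E h0 (X s \<omega>) \<longrightarrow> (\<forall>u\<in>{s..T}. dst E h0 (X u \<omega>) \<noteq> 0)) \<and>
     \<not> (\<forall>n>0. \<forall>j\<le>n. dst E h0 (Z n j \<omega>) = 0)" by blast
  qed
qed

end

section \<open>Avoiding the edges\<close>

text \<open>The bound is the same for all \<open>n\<close>, so almost every path satisfies the
  cutoff of \<open>corner_grid\<close> for some natural \<open>\<kappa>\<close>.\<close>

lemma grid_variation_le: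
  assumes "bv_path b nn L N V" and sT: "0 \<le> s" "s \<le> T"
  shows "(\<Sum>j<n. norm (V (grid s T n (Suc j)) - V (grid s T n j))) \<le> bv_path.W b L T - bv_path.W b L s"
proof -
  interpret bv_path b nn L N V by fact
  have inc: "0 \<le> grid s T n j" "grid s T n j \<le> grid s T n (Suc j)" for j
    using sT unfolding grid_def by (auto intro!: mult_right_mono simp del: times_divide_eq_right)
  have "(\<Sum>j<n. norm (V (grid s T n (Suc j)) - V (grid s T n j))) \<le> (\<Sum>j<n. W (grid s T n (Suc j)) - W (grid s T n j))"
    by (intro sum_mono V_increment_le inc)
  also have "\<dots> = W (grid s T n n) - W (grid s T n 0)" by (rule sum_lessThan_telescope)
  also have "\<dots> \<le> W T - W s"
  proof (cases "n = 0")
    case True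
    have "0 \<le> W T - W s" using V_increment_le[OF sT] norm_ge_zero order_trans by blast
    then show ?thesis using True by (simp add: grid_def)
  qed (simp add: grid_def)
  finally show ?thesis .
qed

lemma msde_bv_path:
  fixes B :: "real \<Rightarrow> 'a \<Rightarrow> real ^ 'b"
  assumes "msde_solution M F B I \<phi> n a X L nn"
  shows "AE \<omega> in M. bv_path (\<lambda>s. gradPhi I \<phi> n a (X s \<omega>)) (\<lambda>s. nn s \<omega>) (\<lambda>s. L s \<omega>)
    (\<lambda>s. inward_normal (Dom I n a) (X s \<omega>)) (\<lambda>t. X t \<omega> - X 0 \<omega> - B t \<omega>)"
proof -
  have 1: "AE \<omega> in M. \<forall>t\<ge>0.
        set_integrable lborel {0..t} (\<lambda>s. gradPhi I \<phi> n a (X s \<omega>)) \<and>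
        integrable (dL (\<lambda>s. L s \<omega>) t) (\<lambda>s. nn s \<omega>) \<and>
        (AE s in dL (\<lambda>s. L s \<omega>) t. inward_normal (Dom I n a) (X s \<omega>) (nn s \<omega>)) \<and>
        X t \<omega> = X 0 \<omega> + B t \<omega> - (LINT s:{0..t}|lborel. gradPhi I \<phi> n a (X s \<omega>))
                 + (\<integral>s. nn s \<omega> \<partial>dL (\<lambda>s. L s \<omega>) t) \<and>
        L t \<omega> = (\<integral>s. indicator (frontier (Dom I n a)) (X s \<omega>) \<partial>dL (\<lambda>s. L s \<omega>) t)"
    and 2: "\<And>\<omega>. \<omega> \<in> space M \<Longrightarrow> continuous_on {0..} (\<lambda>t. L t \<omega>) \<and> mono_on {0..} (\<lambda>t. L t \<omega>)"
    using assms unfolding msde_solution_def by blast+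
  show ?thesis
    using 1 AE_space
  proof eventually_elim
    case (elim \<omega>)
    show ?case
    proof
      show "X t \<omega> - X 0 \<omega> - B t \<omega> = - (LINT s:{0..t}|lborel. gradPhi I \<phi> n a (X s \<omega>))
                 + (\<integral>s. nn s \<omega> \<partial>dL (\<lambda>s. L s \<omega>) t)" if "0 \<le> t" for t
      proof -
        have "X t \<omega> = X 0 \<omega> + B t \<omega> - (LINT s:{0..t}|lborel. gradPhi I \<phi> n a (X s \<omega>))
                 + (\<integral>s. nn s \<omega> \<partial>dL (\<lambda>s. L s \<omega>) t)" using elim(1) that by blast
        moreover have "x = y + b - l + k \<Longrightarrow> x - y - b = - l + k" for x y b l k :: "real ^ 'b" by simp
        ultimately show ?thesis by blast
      qed
    qed (use elim 2 in \<open>auto simp: inward_normal_def\<close>)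
  qed
qed

locale reflected_diffusion = filtered_brownian M F B
  for M :: "'a measure" and F :: "real \<Rightarrow> 'a measure" and B :: "real \<Rightarrow> 'a \<Rightarrow> real ^ 'd" +
  fixes I :: "nat set" and \<phi> :: "nat \<Rightarrow> real \<Rightarrow> ereal" and n :: "nat \<Rightarrow> real ^ 'd" and a :: "nat \<Rightarrow> real"
    and X :: "real \<Rightarrow> 'a \<Rightarrow> real ^ 'd" and L :: "real \<Rightarrow> 'a \<Rightarrow> real" and nn :: "real \<Rightarrow> 'a \<Rightarrow> real ^ 'd"
  assumes I: "finite I"
    and conv: "\<And>i. i \<in> I \<Longrightarrow> ereal_convex (\<phi> i)"
    and smooth: "\<And>i. i \<in> I \<Longrightarrow> \<exists>f. (\<forall>x>0. \<phi> i x = ereal (f x)) \<and>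
            (\<forall>x>0. f differentiable (at x)) \<and> continuous_on {0<..} (deriv f)"
    and unit: "\<And>i. i \<in> I \<Longrightarrow> norm (n i) = 1" and inj: "inj_on n I"
    and D: "Dom I n a \<noteq> {}" and sol: "msde_solution M F B I \<phi> n a X L nn"
begin

definition "grid_variation s T k \<omega> = (\<Sum>j<k. norm (X (grid s T k (Suc j)) \<omega> - X (grid s T k j) \<omega>
  - (B (grid s T k (Suc j)) \<omega> - B (grid s T k j) \<omega>)))"

lemma X_paths:
  shows "0 \<le> t \<Longrightarrow> X t \<in> borel_measurable (F t)"
    and "\<omega> \<in> space M \<Longrightarrow> continuous_on {0..} (\<lambda>t. X t \<omega>)"
    and "\<omega> \<in> space M \<Longrightarrow> 0 \<le> t \<Longrightarrow> i \<in> I \<Longrightarrow> a i \<le> X t \<omega> \<bullet> n i"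
  using sol closure_Dom[OF D] unfolding msde_solution_def adapted_def by blast+

lemma B_cont: "\<omega> \<in> space M \<Longrightarrow> continuous_on {0..} (\<lambda>t. B t \<omega>)"
  using brownian unfolding brownian_motion_def by blast

text \<open>The projection \<open>p\<close> of \<open>x - h0\<close> satisfies
  \<open>p \<bullet> n j = x \<bullet> n j - a j\<close> for all \<open>j\<close> in
  \<open>A\<close>, the very form of vector that the drift and the reflection estimate ask for.
  Within \<open>2 * r\<close> of \<open>x0\<close> no other face is active.\<close>

lemma corner_near_edge:
  assumes A: "A \<subseteq> I" and h0: "h0 \<in> Hyp A n a"
    and E: "orthonormal E" "2 \<le> card E" "span E = span (n ` A)"
    and r: "0 < r" "\<And>k. k \<in> I - A \<Longrightarrow> 2 * r < x0 \<bullet> n k - a k"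
  shows "\<exists>C. corner M F B X E h0 x0 r C"
proof -
  obtain C where C: "0 \<le> C" "\<And>x p. dist x x0 < 2 * r \<Longrightarrow> \<forall>i\<in>I. a i \<le> x \<bullet> n i \<Longrightarrow>
           \<forall>j\<in>A. p \<bullet> n j = x \<bullet> n j - a j \<Longrightarrow> gradPhi I \<phi> n a x \<bullet> p \<le> C * norm p"
    using gradPhi_inner_bound[where \<phi> = \<phi> and n = n and a = a and ?x0.0 = x0, OF I A unit conv smooth r] by blast
  have proj: "proj_span E (x - h0) \<bullet> n j = x \<bullet> n j - a j" if "j \<in> A" for x j
  proof -
    have "n j \<in> span E" using that by (auto simp: E(3) intro: span_base)
    then show ?thesis
      using proj_span_inner_span[OF E(1)] h0 that by (auto simp: Hyp_def inner_diff_left)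
  qed
  have free: "a k < x \<bullet> n k" if "dist x x0 < 2 * r" "k \<in> I - A" for x k
  proof -
    have "\<bar>(x - x0) \<bullet> n k\<bar> \<le> norm (x - x0)"
      using Cauchy_Schwarz_ineq2[of "x - x0" "n k"] unit that by simp
    then show ?thesis using that r(2)[OF that(2)] by (simp add: dist_norm inner_diff_left)
  qed
  have "corner M F B X E h0 x0 r C"
  proof
    fix s T e :: real assume s: "0 \<le> s" and T: "s < T" and e: "0 < e"
    show "AE \<omega> in M.
      excess_sum E h0 C e x0 r s T (\<lambda>t. X t \<omega>) (\<lambda>t. B t \<omega>) \<longlonglongrightarrow> 0"
      using msde_bv_path[OF sol] AE_space
    proof eventually_elim
      case (elim \<omega>)
      interpret bv_path "\<lambda>s. gradPhi I \<phi> n a (X s \<omega>)" "\<lambda>s. nn s \<omega>" "\<lambda>s. L s \<omega>"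
        "\<lambda>s. inward_normal (Dom I n a) (X s \<omega>)" "\<lambda>t. X t \<omega> - X 0 \<omega> - B t \<omega>" by (rule elim(1))
      show ?case
      proof (rule jump_excess_sum_tendsto_0[OF s T E(1) e C(1) r(1) X_paths(2)[OF elim(2)] B_cont[OF elim(2)] refl])
        fix t :: real assume t: "0 \<le> t" "dist (X t \<omega>) x0 < 2 * r"
        show "gradPhi I \<phi> n a (X t \<omega>) \<bullet> proj_span E (X t \<omega> - h0) \<le> C * dst E h0 (X t \<omega>)"
          unfolding dst_def by (rule C(2)[OF t(2)]) (use X_paths(3)[OF elim(2) t(1)] proj in auto)
        fix \<nu> assume "inward_normal (Dom I n a) (X t \<omega>) \<nu>"
        moreover have "X t \<omega> \<in> closure (Dom I n a)" using X_paths(3)[OF elim(2) t(1)] by (simp add: closure_Dom[OF D])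
        ultimately show "0 \<le> \<nu> \<bullet> proj_span E (X t \<omega> - h0)"
          by (intro inward_normal_inner_nonneg[OF D I A _ free[OF t(2)] proj])
      qed
    qed
  qed (use X_paths E r C in auto)
  then show ?thesis ..
qed

lemma no_visit_near_edge:
  assumes A: "A \<subseteq> I" and h0: "h0 \<in> Hyp A n a"
    and E: "orthonormal E" "2 \<le> card E" "span E = span (n ` A)"
    and r: "0 < r" "\<And>k. k \<in> I - A \<Longrightarrow> 2 * r < x0 \<bullet> n k - a k"
    and sT: "0 \<le> s" "s < T" "T \<le> s + 1" and \<kappa>: "0 \<le> \<kappa>" and \<delta>: "0 < \<delta>"
  shows "AE \<omega> in M. (\<forall>k. grid_variation s T k \<omega> \<le> \<kappa>)
     \<longrightarrow> (\<forall>u\<in>{s..T}. dist (X u \<omega>) x0 < r) \<longrightarrow>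
     (\<delta> \<le> dst E h0 (X s \<omega>) \<longrightarrow> (\<forall>u\<in>{s..T}. dst E h0 (X u \<omega>) \<noteq> 0)) \<and>
     \<not> (\<forall>k>0. \<forall>j\<le>k. dst E h0 (X (grid s T k j) \<omega>) = 0)"
proof -
  obtain C where "corner M F B X E h0 x0 r C" using corner_near_edge[OF A h0 E r] by blast
  then interpret corner M F B X E h0 x0 r C .
  interpret corner_grid M F B X E h0 x0 r C s T \<kappa>
    by standard (use sT \<kappa> in auto)
  show ?thesis using no_visit[OF \<delta>] unfolding v_def \<beta>_def grid_variation_def .
qed

lemma dst_eq_0_iff:
  assumes h0: "h0 \<in> Hyp A n a" and E: "orthonormal E" "span E = span (n ` A)"
  shows "dst E h0 x = 0 \<longleftrightarrow> x \<in> Hyp A n a"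
proof
  assume "dst E h0 x = 0"
  then have z: "proj_span E (x - h0) = 0" by (simp add: dst_def)
  show "x \<in> Hyp A n a"
    unfolding Hyp_def
  proof (intro CollectI ballI)
    fix j assume j: "j \<in> A"
    then have "n j \<in> span E" by (auto simp: E(2) intro: span_base)
    then have "(x - h0) \<bullet> n j = 0" using proj_span_inner_span[OF E(1), of "n j" "x - h0"] z by simp
    then show "x \<bullet> n j = a j" using h0 j by (simp add: Hyp_def inner_diff_left)
  qed
next
  assume x: "x \<in> Hyp A n a"
  have "(x - h0) \<bullet> v = 0" if "v \<in> span (n ` A)" for v
    using that
  proof (induction rule: span_induct_alt)
    case (step c y z)
    then show ?case using x h0 by (auto simp: Hyp_def inner_diff_left inner_add_right)
  qed simp
  then have "proj_span E (x - h0) = 0"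
    unfolding proj_span_def by (intro sum.neutral) (auto simp: E(2)[symmetric] intro: span_base)
  then show "dst E h0 x = 0" by (simp add: dst_def)
qed

text \<open>The null set must be fixed before the visiting time and point are known. Hence the local
  result is applied to finitely many face sets and countably many centres, radii, times and cutoffs,
  and a visit on a given path is then matched with one of these choices.\<close>

lemma AE_avoids_edges:
  assumes J: "J \<subseteq> I" "2 \<le> card J"
  shows "AE \<omega> in M. \<forall>t>0. X t \<omega> \<notin> Hyp J n a"
proof -
  define Faces where "Faces = {A. A \<subseteq> I \<and> 2 \<le> card A \<and> Hyp A n a \<noteq> {}}"
  have fin: "finite Faces" unfolding Faces_def using I by (auto intro: finite_subset[of _ "Pow I"])
  have "\<forall>A\<in>Faces. \<exists>h E. h \<in> Hyp A n a \<and> orthonormal E \<and> 2 \<le> card E \<and> span E = span (n ` A)"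
  proof
    fix A assume A: "A \<in> Faces"
    then obtain h where h: "h \<in> Hyp A n a" by (auto simp: Faces_def)
    then show "\<exists>h E. h \<in> Hyp A n a \<and> orthonormal E \<and> 2 \<le> card E \<and> span E = span (n ` A)"
      using normals_basis[OF unit inj D _ _ h] A by (auto simp: Faces_def)
  qed
  then obtain h E where hE: "\<And>A. A \<in> Faces \<Longrightarrow> h A \<in> Hyp A n a" "\<And>A. A \<in> Faces \<Longrightarrow> orthonormal (E A)"
    "\<And>A. A \<in> Faces \<Longrightarrow> 2 \<le> card (E A)" "\<And>A. A \<in> Faces \<Longrightarrow> span (E A) = span (n ` A)"
    by metis
  obtain U :: "(real ^ 'd) set" where U: "countable U" "\<And>S. open S \<Longrightarrow> S \<noteq> {} \<Longrightarrow> \<exists>d\<in>U. d \<in> S"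
    using countable_dense_setE by blast
  \<comment> \<open>\<open>1 / real k\<close> takes the place of \<open>\<delta>\<close>, which
    thereby ranges over a countable set.\<close>
  define P where "P A x r s T \<kappa> k \<omega> \<longleftrightarrow>
    (\<forall>k. grid_variation s T k \<omega> \<le> real \<kappa>)
     \<longrightarrow> (\<forall>u\<in>{s..T}. dist (X u \<omega>) x < r) \<longrightarrow>
     (1 / real k \<le> dst (E A) (h A) (X s \<omega>) \<longrightarrow> (\<forall>u\<in>{s..T}. dst (E A) (h A) (X u \<omega>) \<noteq> 0)) \<and>
     \<not> (\<forall>k>0. \<forall>j\<le>k. dst (E A) (h A) (X (grid s T k j) \<omega>) = 0)" for A x r s T and \<kappa> k :: nat and \<omega>
  have "AE \<omega> in M. 0 < r \<and> (\<forall>k\<in>I - A. 2 * r < x \<bullet> n k - a k) \<and> 0 \<le> s \<and> s < T \<and> T \<le> s + 1 \<and> 0 < k \<longrightarrow> P A x r s T \<kappa> k \<omega>"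
    if A: "A \<in> Faces" for A x r s T \<kappa> k
  proof (cases "0 < r \<and> (\<forall>k\<in>I - A. 2 * r < x \<bullet> n k - a k) \<and> 0 \<le> s \<and> s < T \<and> T \<le> s + 1 \<and> 0 < k")
    case True
    have "AE \<omega> in M. P A x r s T \<kappa> k \<omega>"
      unfolding P_def
      by (rule no_visit_near_edge[OF _ hE(1-4)[OF A]]) (use True A in \<open>auto simp: Faces_def\<close>)
    then show ?thesis by auto
  next
    case False then show ?thesis by (intro AE_I2) blast
  qed
  then have "AE \<omega> in M. \<forall>A\<in>Faces. \<forall>x\<in>U. \<forall>r\<in>\<rat>. \<forall>s\<in>\<rat>. \<forall>T\<in>\<rat>. \<forall>\<kappa> k.
     0 < r \<and> (\<forall>k\<in>I - A. 2 * r < x \<bullet> n k - a k) \<and> 0 \<le> s \<and> s < T \<and> T \<le> s + 1 \<and> 0 < k \<longrightarrow> P A x r s T \<kappa> k \<omega>"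
    using U(1) fin by (simp add: AE_ball_countable countable_rat countable_finite AE_all_countable)
  then show ?thesis
    using msde_bv_path[OF sol] AE_space
  proof eventually_elim
    case (elim \<omega>)
    show ?case
    proof (intro allI impI notI)
      fix t :: real assume t: "0 < t" and hit: "X t \<omega> \<in> Hyp J n a"
      \<comment> \<open>All faces through the visited point and not just those of \<open>J\<close>,
        so that the remaining ones have positive slack.\<close>
      define A where "A = {i \<in> I. X t \<omega> \<bullet> n i = a i}"
      have A: "A \<subseteq> I" "J \<subseteq> A" "X t \<omega> \<in> Hyp A n a" using hit J(1) by (auto simp: A_def Hyp_def)
      have "card J \<le> card A" by (rule card_mono[OF finite_subset[OF A(1) I] A(2)])
      then have AF: "A \<in> Faces" using A J by (auto simp: Faces_def)
      \<comment> \<open>Moving the centre from the visited point to a point of the dense set costs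
        less than \<open>r\<close> of the slack \<open>4 * r\<close>, so more than the required
        \<open>2 * r\<close> is left.\<close>
      have "\<exists>r\<in>\<rat>. 0 < r \<and> (\<forall>k\<in>I - A. 4 * r < X t \<omega> \<bullet> n k - a k)"
      proof -
        define l where "l = Min (insert 1 ((\<lambda>k. X t \<omega> \<bullet> n k - a k) ` (I - A)))"
        have f: "finite (insert 1 ((\<lambda>k. X t \<omega> \<bullet> n k - a k) ` (I - A)))" using I by auto
        have "0 < X t \<omega> \<bullet> n k - a k" if "k \<in> I - A" for k
          using X_paths(3)[OF elim(3), of t k] t that by (auto simp: A_def)
        then have "0 < l" using f by (auto simp: l_def)
        then obtain r where "r \<in> \<rat>" "0 < r" "r < l / 4" using Rats_dense_in_real[of 0 "l / 4"] by auto
        moreover have "l \<le> X t \<omega> \<bullet> n k - a k" if "k \<in> I - A" for k using f that by (auto simp: l_def)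
        ultimately show ?thesis by (intro bexI[of _ r]) force+
      qed
      then obtain r where r: "r \<in> \<rat>" "0 < r" "\<And>k. k \<in> I - A \<Longrightarrow> 4 * r < X t \<omega> \<bullet> n k - a k" by blast
      obtain x where x: "x \<in> U" "dist x (X t \<omega>) < r"
        using U(2)[of "ball (X t \<omega>) r"] r(2) by (auto simp: dist_commute)
      have far: "\<forall>k\<in>I - A. 2 * r < x \<bullet> n k - a k"
      proof
        fix k assume k: "k \<in> I - A"
        have "\<bar>(x - X t \<omega>) \<bullet> n k\<bar> \<le> norm (x - X t \<omega>)"
          using Cauchy_Schwarz_ineq2[of "x - X t \<omega>" "n k"] unit k by simp
        then show "2 * r < x \<bullet> n k - a k"
          using r(2) r(3)[OF k] x(2) unfolding dist_norm inner_diff_left by linarith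
      qed
      have "0 < r - dist x (X t \<omega>)" using x by simp
      then obtain d where d: "0 < d" "\<And>u. 0 \<le> u \<Longrightarrow> dist u t < d \<Longrightarrow> dist (X u \<omega>) (X t \<omega>) < r - dist x (X t \<omega>)"
        using X_paths(2)[OF elim(3)] t unfolding continuous_on_iff by (metis atLeast_iff less_imp_le)
      obtain s where s: "s \<in> \<rat>" "max 0 (max (t - d) (t - 1 / 2)) < s" "s < t"
        using Rats_dense_in_real[of "max 0 (max (t - d) (t - 1 / 2))" t] t d(1) by auto
      obtain T where T: "T \<in> \<rat>" "t < T" "T < min (t + d) (t + 1 / 2)"
        using Rats_dense_in_real[of t "min (t + d) (t + 1 / 2)"] d(1) by auto
      have near: "dist (X u \<omega>) x < r" if "u \<in> {s..T}" for u
      proof -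
        have "0 \<le> u" "dist u t < d" using that s T by (auto simp: dist_real_def)
        then have "dist (X u \<omega>) (X t \<omega>) < r - dist x (X t \<omega>)" by (rule d(2))
        then show ?thesis using dist_triangle[of "X u \<omega>" x "X t \<omega>"] by (simp add: dist_commute)
      qed
      have var: "\<exists>\<kappa>::nat. \<forall>k. grid_variation s' T' k \<omega> \<le> real \<kappa>"
        if "0 \<le> s'" "s' \<le> T'" for s' T'
      proof -
        obtain \<kappa> :: nat where \<kappa>: "bv_path.W (\<lambda>s. gradPhi I \<phi> n a (X s \<omega>)) (\<lambda>s. L s \<omega>) T'
           - bv_path.W (\<lambda>s. gradPhi I \<phi> n a (X s \<omega>)) (\<lambda>s. L s \<omega>) s' \<le> real \<kappa>" using real_arch_simple by blast
        show ?thesis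
        proof (intro exI[of _ \<kappa>] allI)
          fix k
          show "grid_variation s' T' k \<omega> \<le> real \<kappa>"
            using order_trans[OF grid_variation_le[OF elim(2) that, of k] \<kappa>]
            by (simp add: grid_variation_def algebra_simps)
        qed
      qed
      have avoid: "P A x r s' T' \<kappa> k \<omega>" if "s' \<in> \<rat>" "T' \<in> \<rat>" "s \<le> s'" "s' < T'" "T' \<le> T" "0 < k" for s' T' \<kappa> k
      proof -
        have "0 \<le> s'" "T' \<le> s' + 1" using that s T by auto
        then have "0 < r \<and> (\<forall>k\<in>I - A. 2 * r < x \<bullet> n k - a k) \<and> 0 \<le> s' \<and> s' < T' \<and> T' \<le> s' + 1 \<and> 0 < k"
          using r(2) far that by blast
        then show ?thesis using elim(1) AF x(1) r(1) that(1,2) by blast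
      qed
      have t0: "dst (E A) (h A) (X t \<omega>) = 0"
        using dst_eq_0_iff[OF hE(1)[OF AF] hE(2)[OF AF] hE(4)[OF AF]] A(3) by simp
      \<comment> \<open>Either the path is off the edge at some rational time shortly before
        \<open>t\<close>, and a visit at \<open>t\<close> is impossible from there; or it is on the
        edge at all rational times of an interval, hence on all its rational grids, which is
        impossible too.\<close>
      show False
      proof (cases "\<exists>s'\<in>\<rat>. s \<le> s' \<and> s' < t \<and> dst (E A) (h A) (X s' \<omega>) \<noteq> 0")
        case True
        then obtain s' where s': "s' \<in> \<rat>" "s \<le> s'" "s' < t" "0 < dst (E A) (h A) (X s' \<omega>)"
          using dst_nonneg[of "E A" "h A"] by (metis less_le)
        obtain k :: nat where k: "0 < k" "1 / real k \<le> dst (E A) (h A) (X s' \<omega>)"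
          using real_arch_inverse[of "dst (E A) (h A) (X s' \<omega>)"] s'(4) by (auto simp: inverse_eq_divide)
        obtain \<kappa> :: nat where \<kappa>: "\<forall>k. grid_variation s' T k \<omega> \<le> real \<kappa>"
          using var[of s' T] s s' T by auto
        have "P A x r s' T \<kappa> k \<omega>" using s' T k by (intro avoid) auto
        moreover have "\<forall>u\<in>{s'..T}. dist (X u \<omega>) x < r" using near s' by auto
        ultimately have "\<forall>u\<in>{s'..T}. dst (E A) (h A) (X u \<omega>) \<noteq> 0" using \<kappa> k unfolding P_def by blast
        then show False using t0 s' T by auto
      next
        case False
        obtain T' where T': "T' \<in> \<rat>" "s < T'" "T' < t" using Rats_dense_in_real[of s t] s by auto
        obtain \<kappa> :: nat where \<kappa>: "\<forall>k. grid_variation s T' k \<omega> \<le> real \<kappa>"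
          using var[of s T'] s T' by auto
        have "P A x r s T' \<kappa> 1 \<omega>" using s T T' by (intro avoid) auto
        moreover have "\<forall>u\<in>{s..T'}. dist (X u \<omega>) x < r" using near T T' by auto
        ultimately have "\<not> (\<forall>k>0. \<forall>j\<le>k. dst (E A) (h A) (X (grid s T' k j) \<omega>) = 0)" using \<kappa> unfolding P_def by blast
        moreover have "dst (E A) (h A) (X (grid s T' k j) \<omega>) = 0" if "0 < k" "j \<le> k" for k j
        proof -
          have "grid s T' k j \<in> \<rat>" using s(1) T'(1) by (simp add: grid_def)
          moreover have "real j * ((T' - s) / real k) \<le> real k * ((T' - s) / real k)"
            using that T' by (intro mult_right_mono) auto
          then have "s \<le> grid s T' k j" "grid s T' k j \<le> T'" using that T' by (auto simp: grid_def)
          ultimately show ?thesis using False T' by fastforce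
        qed
        ultimately show False by blast
      qed
    qed
  qed
qed

end

theorem theorem4:
  fixes M :: "'a measure" and F :: "real \<Rightarrow> 'a measure"
    and B :: "real \<Rightarrow> 'a \<Rightarrow> real ^ 'd"
    and m :: nat and \<phi> :: "nat \<Rightarrow> real \<Rightarrow> ereal"
    and n :: "nat \<Rightarrow> real ^ 'd" and a :: "nat \<Rightarrow> real"
    and X :: "real \<Rightarrow> 'a \<Rightarrow> real ^ 'd" and L :: "real \<Rightarrow> 'a \<Rightarrow> real"
    and nn :: "real \<Rightarrow> 'a \<Rightarrow> real ^ 'd"
    and J :: "nat set"
  assumes "prob_space M"
    and "is_filtration M F" and "usual_conditions M F"
    and "brownian_motion M F B"
    and "\<And>i. i \<in> {1..m} \<Longrightarrow> ereal_convex (\<phi> i) \<and> ereal_lsc (\<phi> i) \<and> (\<forall>x. \<phi> i x \<noteq> -\<infinity>)"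
    and "\<And>i x. i \<in> {1..m} \<Longrightarrow> x < 0 \<Longrightarrow> \<phi> i x = \<infinity>"
    and "\<And>i. i \<in> {1..m} \<Longrightarrow> \<exists>f. (\<forall>x>0. \<phi> i x = ereal (f x)) \<and>
            (\<forall>x>0. f differentiable (at x)) \<and> continuous_on {0<..} (deriv f)"
    and "\<And>i. i \<in> {1..m} \<Longrightarrow> norm (n i) = 1"
    and "inj_on n {1..m}"
    and "Dom {1..m} n a \<noteq> {}"
    and "X 0 \<in> borel_measurable (F 0)"
    and "msde_solution M F B {1..m} \<phi> n a X L nn"
    and "J \<subseteq> {1..m}" and "card J \<ge> 2"
  shows "measure M {\<omega> \<in> space M. hitting_time X (Hyp J n a) \<omega> = \<infinity>} = 1"
proof -
  interpret prob_space M by fact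
  interpret reflected_diffusion M F B "{1..m}" \<phi> n a X L nn
    by standard (use assms in auto)
  have "AE \<omega> in M. \<forall>t>0. X t \<omega> \<notin> Hyp J n a" by (rule AE_avoids_edges) (use assms in auto)
  then have AE: "AE \<omega> in M. hitting_time X (Hyp J n a) \<omega> = \<infinity>"
  proof eventually_elim
    case (elim \<omega>)
    then have empty: "{ereal t | t. t > 0 \<and> X t \<omega> \<in> Hyp J n a} = {}" by auto
    show ?case unfolding hitting_time_def empty by (simp add: top_ereal_def)
  qed
  \<comment> \<open>Measurability of the event comes from completeness: its complement lies in a
    null set.\<close>
  then obtain N where N: "{\<omega> \<in> space M. hitting_time X (Hyp J n a) \<omega> \<noteq> \<infinity>} \<subseteq> N" "N \<in> null_sets M"
    by (auto elim!: AE_E simp: null_sets_def)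
  then have "{\<omega> \<in> space M. hitting_time X (Hyp J n a) \<omega> \<noteq> \<infinity>} \<in> sets M"
    using \<open>usual_conditions M F\<close> unfolding usual_conditions_def by blast
  then have "space M - {\<omega> \<in> space M. hitting_time X (Hyp J n a) \<omega> \<noteq> \<infinity>} \<in> sets M" by (rule sets.compl_sets)
  also have "space M - {\<omega> \<in> space M. hitting_time X (Hyp J n a) \<omega> \<noteq> \<infinity>} = {\<omega> \<in> space M. hitting_time X (Hyp J n a) \<omega> = \<infinity>}" by auto
  finally show ?thesis using AE by (simp add: prob_Collect_eq_1)
qed

end
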